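(* Let $\mathcal{G}$ be the graph-indexing category, so that $\mathcal{G}\text{-}\mathbf{Set}$ is the category of directed multigraphs. Let $\mathit{paths}\colon\mathcal{G}\text{-}\mathbf{Set}\to\mathbf{Set}$ send a graph to the set of all finite directed paths in it, and let $\mathit{frcat}\colon\mathcal{G}\text{-}\mathbf{Set}\to\mathcal{G}\text{-}\mathbf{Set}$ be the free-category monad. Then the left Kan extension $\mathrm{Lan}_{\mathit{paths}\,\circ\,\mathit{frcat}}(\mathit{paths})\colon\mathbf{Set}\to\mathbf{Set}$, with its canonical comonad structure (described in the context), is a polynomial comonad whose corresponding category is isomorphic to the simplicial indexing category $\mathbf{\Delta}^{\mathrm{op}}$.
   Context: $\mathcal{G}$ is the category with two objects $E,V$ and two parallel non-identity arrows $E\rightrightarrows V$; $\mathcal{G}\text{-}\mathbf{Set}$ is the category of functors $\mathcal{G}\to\mathbf{Set}$. For $n\in\mathbb{N}$ let $\underline{n}$ be the graph $\bullet\xrightarrow{e_1}\cdots\xrightarrow{e_n}\bullet$ ($n$ edges, $n+1$ vertices); $\mathit{paths}(X)=\sum_{n\in\mathbb{N}}\mathcal{G}\text{-}\mathbf{Set}(\underline{n},X)$. The monad $\mathit{frcat}$ sends a graph to the underlying graph of the free category on it (same vertices, edges are the finite paths), with unit given by length-one paths and multiplication by concatenation. $\mathbf{\Delta}$ is the category of finite nonempty ordinals $\{0<\cdots<n\}$, $n\in\mathbb{N}$, and order-preserving maps. $\mathrm{Lan}_q(p)$ denotes the left Kan extension of $p$ along $q$, with universal unit $p\Rightarrow\mathrm{Lan}_q(p)\circ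 q$ giving a bijection between maps $\mathrm{Lan}_q(p)\Rightarrow r$ and maps $p\Rightarrow r\circ q$. For an accessible functor $p\colon\mathcal{A}\to\mathcal{D}$ between accessible categories with $\mathcal{D}$ cocomplete and an accessible monad $(t,\eta,\mu)$ on $\mathcal{A}$, the functor $L=\mathrm{Lan}_{pt}(p)$ is a comonad on $\mathcal{D}$: its counit $L\Rightarrow\mathrm{id}$ corresponds to $p\eta\colon p\Rightarrow pt$, and its comultiplication $L\Rightarrow LL$ corresponds to $p\Rightarrow Lpt\Rightarrow LLptt\xrightarrow{LLp\mu}LLpt$ (first two maps being Kan extension units). Polynomial comonads and categories: a functor $\mathbf{Set}\to\mathbf{Set}$ is polynomial if it is a coproduct of representables. For a small category $\mathcal{C}$ let $\mathcal{C}[c]=\sum_{c'}\mathcal{C}(c,c')$. The comonad $k_{\mathcal{C}}$ on $\mathbf{Set}$ has functor $X\mapsto\sum_{c\in\mathrm{Ob}\,\mathcal{C}}\mathbf{Set}(\mathcal{C}[c],X)$, counit $(c,x)\mapsto x(\mathrm{id}_c)$, and comultiplication $(c,x)\mapsto\big(c,\ f\mapsto(\mathrm{cod}(f),\ f'\mapsto x(f'\circ f))\big)$. By a theorem of Ahman and Uustalu every comonad on $\mathbf{Set}$ with polynomial underlying functor is isomorphic to $k_{\mathcal{C}}$ for a small category $\mathcal{C}$, unique up to isomorphism: the corresponding category. *)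

theory Defs
  imports "Graph_Theory.Digraph" "HOL-Library.Equipollence" "HOL-Library.FuncSet"
begin

section \<open>Categories, functors, natural transformations\<close>

record ('o, 'a) cat =
  Obj :: "'o set"
  Arr :: "'a set"
  Dom :: "'a \<Rightarrow> 'o"
  Cod :: "'a \<Rightarrow> 'o"
  Ide :: "'o \<Rightarrow> 'a"
  Cmp :: "'a \<Rightarrow> 'a \<Rightarrow> 'a" (infixr "\<cdot>\<index>" 70)

definition Hom :: "('o, 'a) cat \<Rightarrow> 'o \<Rightarrow> 'o \<Rightarrow> 'a set" where
  "Hom C X Y = {f \<in> Arr C. Dom C f = X \<and> Cod C f = Y}"

locale category =
  fixes C :: "('o, 'a) cat" (structure)
  assumes Dom_Obj: "f \<in> Arr C \<Longrightarrow> Dom C f \<in> Obj C"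
    and Cod_Obj: "f \<in> Arr C \<Longrightarrow> Cod C f \<in> Obj C"
    and Ide_Hom: "X \<in> Obj C \<Longrightarrow> Ide C X \<in> Hom C X X"
    and Cmp_Hom: "f \<in> Hom C X Y \<Longrightarrow> g \<in> Hom C Y Z \<Longrightarrow> g \<cdot> f \<in> Hom C X Z"
    and Cmp_Ide_right: "f \<in> Hom C X Y \<Longrightarrow> f \<cdot> Ide C X = f"
    and Cmp_Ide_left: "f \<in> Hom C X Y \<Longrightarrow> Ide C Y \<cdot> f = f"
    and Cmp_assoc: "f \<in> Hom C X Y \<Longrightarrow> g \<in> Hom C Y Z \<Longrightarrow> h \<in> Hom C Z W \<Longrightarrow>
      (h \<cdot> g) \<cdot> f = h \<cdot> (g \<cdot> f)"

definition op_cat :: "('o, 'a) cat \<Rightarrow> ('o, 'a) cat" where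
  "op_cat C = \<lparr>Obj = Obj C, Arr = Arr C, Dom = Cod C, Cod = Dom C, Ide = Ide C,
     Cmp = (\<lambda>g f. f \<cdot>\<^bsub>C\<^esub> g)\<rparr>"

record ('o, 'a, 'p, 'b) fctr =
  omap :: "'o \<Rightarrow> 'p"
  amap :: "'a \<Rightarrow> 'b"

definition is_functor ::
  "('o, 'a) cat \<Rightarrow> ('p, 'b) cat \<Rightarrow> ('o, 'a, 'p, 'b) fctr \<Rightarrow> bool" where
  "is_functor C D F \<longleftrightarrow> category C \<and> category D \<and>
     (\<forall>X\<in>Obj C. omap F X \<in> Obj D) \<and>
     (\<forall>f\<in>Arr C. amap F f \<in> Hom D (omap F (Dom C f)) (omap F (Cod C f))) \<and>
     (\<forall>X\<in>Obj C. amap F (Ide C X) = Ide D (omap F X)) \<and>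
     (\<forall>f\<in>Arr C. \<forall>g\<in>Arr C. Cod C f = Dom C g \<longrightarrow>
        amap F (g \<cdot>\<^bsub>C\<^esub> f) = amap F g \<cdot>\<^bsub>D\<^esub> amap F f)"

definition id_functor :: "('o, 'a, 'o, 'a) fctr" where
  "id_functor = \<lparr>omap = (\<lambda>X. X), amap = (\<lambda>f. f)\<rparr>"

definition comp_functor ::
  "('p, 'b, 'q, 'c) fctr \<Rightarrow> ('o, 'a, 'p, 'b) fctr \<Rightarrow> ('o, 'a, 'q, 'c) fctr"
  (infixr "\<circ>\<^sub>F" 75) where
  "G \<circ>\<^sub>F F = \<lparr>omap = omap G \<circ> omap F, amap = amap G \<circ> amap F\<rparr>"

text \<open>Components are extensional outside the objects, so that equality of natural
  transformations, as in the universal property of a Kan extension, is equality in HOL.\<close>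

definition nat_trans ::
  "('o, 'a) cat \<Rightarrow> ('p, 'b) cat \<Rightarrow> ('o, 'a, 'p, 'b) fctr \<Rightarrow> ('o, 'a, 'p, 'b) fctr \<Rightarrow>
   ('o \<Rightarrow> 'b) \<Rightarrow> bool" where
  "nat_trans C D F G \<tau> \<longleftrightarrow> is_functor C D F \<and> is_functor C D G \<and>
     \<tau> \<in> extensional (Obj C) \<and>
     (\<forall>X\<in>Obj C. \<tau> X \<in> Hom D (omap F X) (omap G X)) \<and>
     (\<forall>f\<in>Arr C. amap G f \<cdot>\<^bsub>D\<^esub> \<tau> (Dom C f) = \<tau> (Cod C f) \<cdot>\<^bsub>D\<^esub> amap F f)"

definition is_iso :: "('o, 'a) cat \<Rightarrow> 'a \<Rightarrow> bool" where
  "is_iso C f \<longleftrightarrow> f \<in> Arr C \<and> (\<exists>g\<in>Hom C (Cod C f) (Dom C f).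
     g \<cdot>\<^bsub>C\<^esub> f = Ide C (Dom C f) \<and> f \<cdot>\<^bsub>C\<^esub> g = Ide C (Cod C f))"

definition nat_iso ::
  "('o, 'a) cat \<Rightarrow> ('p, 'b) cat \<Rightarrow> ('o, 'a, 'p, 'b) fctr \<Rightarrow> ('o, 'a, 'p, 'b) fctr \<Rightarrow>
   ('o \<Rightarrow> 'b) \<Rightarrow> bool" where
  "nat_iso C D F G \<tau> \<longleftrightarrow> nat_trans C D F G \<tau> \<and> (\<forall>X\<in>Obj C. is_iso D (\<tau> X))"

definition iso_cat :: "('o, 'a) cat \<Rightarrow> ('p, 'b) cat \<Rightarrow> bool" where
  "iso_cat C D \<longleftrightarrow> (\<exists>F. is_functor C D F \<and>
     bij_betw (omap F) (Obj C) (Obj D) \<and> bij_betw (amap F) (Arr C) (Arr D))"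


section \<open>Comonads\<close>

record ('o, 'a) comonad =
  cfun :: "('o, 'a, 'o, 'a) fctr"
  counit :: "'o \<Rightarrow> 'a"
  comult :: "'o \<Rightarrow> 'a"

definition is_comonad :: "('o, 'a) cat \<Rightarrow> ('o, 'a) comonad \<Rightarrow> bool" where
  "is_comonad D M \<longleftrightarrow>
     nat_trans D D (cfun M) id_functor (counit M) \<and>
     nat_trans D D (cfun M) (cfun M \<circ>\<^sub>F cfun M) (comult M) \<and>
     (\<forall>X\<in>Obj D.
        counit M (omap (cfun M) X) \<cdot>\<^bsub>D\<^esub> comult M X = Ide D (omap (cfun M) X) \<and>
        amap (cfun M) (counit M X) \<cdot>\<^bsub>D\<^esub> comult M X = Ide D (omap (cfun M) X) \<and>
        comult M (omap (cfun M) X) \<cdot>\<^bsub>D\<^esub> comult M X =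
          amap (cfun M) (comult M X) \<cdot>\<^bsub>D\<^esub> comult M X)"

definition comonad_iso ::
  "('o, 'a) cat \<Rightarrow> ('o, 'a) comonad \<Rightarrow> ('o, 'a) comonad \<Rightarrow> bool" where
  "comonad_iso D M N \<longleftrightarrow> is_comonad D M \<and> is_comonad D N \<and>
     (\<exists>\<theta>. nat_iso D D (cfun M) (cfun N) \<theta> \<and>
        (\<forall>X\<in>Obj D.
           counit N X \<cdot>\<^bsub>D\<^esub> \<theta> X = counit M X \<and>
           comult N X \<cdot>\<^bsub>D\<^esub> \<theta> X =
             (amap (cfun N) (\<theta> X) \<cdot>\<^bsub>D\<^esub> \<theta> (omap (cfun M) X)) \<cdot>\<^bsub>D\<^esub> comult M X))"


section \<open>Left Kan extensions\<close>

text \<open>\<open>(L, \<alpha>)\<close> is the left Kan extension of \<open>p : A \<rightarrow> D\<close> along \<open>q : A \<rightarrow> B\<close>.\<close>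

definition is_lan ::
  "('o, 'a) cat \<Rightarrow> ('p, 'b) cat \<Rightarrow> ('q, 'c) cat \<Rightarrow>
   ('o, 'a, 'q, 'c) fctr \<Rightarrow> ('o, 'a, 'p, 'b) fctr \<Rightarrow>
   ('p, 'b, 'q, 'c) fctr \<Rightarrow> ('o \<Rightarrow> 'c) \<Rightarrow> bool" where
  "is_lan A B D p q L \<alpha> \<longleftrightarrow>
     is_functor A D p \<and> is_functor A B q \<and> is_functor B D L \<and>
     nat_trans A D p (L \<circ>\<^sub>F q) \<alpha> \<and>
     (\<forall>r \<beta>. is_functor B D r \<and> nat_trans A D p (r \<circ>\<^sub>F q) \<beta> \<longrightarrow>
        (\<exists>!\<gamma>. nat_trans B D L r \<gamma> \<and>
           (\<forall>X\<in>Obj A. \<gamma> (omap q X) \<cdot>\<^bsub>D\<^esub> \<alpha> X = \<beta> X)))"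

text \<open>The transformation \<open>L \<Rightarrow> r\<close> corresponding to \<open>\<beta> : p \<Rightarrow> r q\<close>.\<close>

definition lan_induced ::
  "('o, 'a) cat \<Rightarrow> ('p, 'b) cat \<Rightarrow> ('q, 'c) cat \<Rightarrow> ('o, 'a, 'p, 'b) fctr \<Rightarrow>
   ('p, 'b, 'q, 'c) fctr \<Rightarrow> ('o \<Rightarrow> 'c) \<Rightarrow> ('p, 'b, 'q, 'c) fctr \<Rightarrow> ('o \<Rightarrow> 'c) \<Rightarrow> ('p \<Rightarrow> 'c)" where
  "lan_induced A B D q L \<alpha> r \<beta> =
     (THE \<gamma>. nat_trans B D L r \<gamma> \<and> (\<forall>X\<in>Obj A. \<gamma> (omap q X) \<cdot>\<^bsub>D\<^esub> \<alpha> X = \<beta> X))"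

text \<open>The canonical comonad structure on a left Kan extension \<open>(L, \<alpha>)\<close> of \<open>p : A \<rightarrow> D\<close>
  along \<open>p t : A \<rightarrow> D\<close>, for a monad \<open>(t, \<eta>, \<mu>)\<close> on \<open>A\<close>.\<close>

definition lan_comonad ::
  "('o, 'a) cat \<Rightarrow> ('p, 'b) cat \<Rightarrow> ('o, 'a, 'p, 'b) fctr \<Rightarrow>
   ('o, 'a, 'o, 'a) fctr \<Rightarrow> ('o \<Rightarrow> 'a) \<Rightarrow> ('o \<Rightarrow> 'a) \<Rightarrow>
   ('p, 'b, 'p, 'b) fctr \<Rightarrow> ('o \<Rightarrow> 'b) \<Rightarrow> ('p, 'b) comonad" where
  "lan_comonad A D p t \<eta> \<mu> L \<alpha> =
     \<lparr>cfun = L,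
      counit = lan_induced A D D (p \<circ>\<^sub>F t) L \<alpha> id_functor (\<lambda>X. amap p (\<eta> X)),
      comult = lan_induced A D D (p \<circ>\<^sub>F t) L \<alpha> (L \<circ>\<^sub>F L)
        (\<lambda>X. amap L (amap L (amap p (\<mu> X))) \<cdot>\<^bsub>D\<^esub> amap L (\<alpha> (omap t X)) \<cdot>\<^bsub>D\<^esub> \<alpha> X)\<rparr>"


section \<open>The category of sets\<close>

text \<open>Sets are the members of a universe \<open>\<U>\<close> of subsets of a type. Only the closure
  properties that are needed are required: \<open>\<U>\<close> may be a Grothendieck universe (on an
  inaccessible type), but also the family of all subsets of any type \<open>'u\<close> with as many
  elements as \<open>nat \<Rightarrow> 'u\<close>. Closure under power sets is not demanded, since in HOL one cannot
  exhibit a universe with this property that contains an infinite set.\<close>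

definition small :: "'u set set \<Rightarrow> 'x set \<Rightarrow> bool" where
  "small \<U> S \<longleftrightarrow> (\<exists>B\<in>\<U>. S \<lesssim> B)"

definition set_universe :: "'u set set \<Rightarrow> bool" where
  "set_universe \<U> \<longleftrightarrow>
     (\<forall>S :: 'u set. small \<U> S \<longrightarrow> S \<in> \<U>) \<and>
     small \<U> (UNIV :: nat set) \<and>
     (\<forall>I\<in>\<U>. \<forall>F. (\<forall>i\<in>I. F i \<in> \<U>) \<longrightarrow> (\<Union>i\<in>I. F i) \<in> \<U>) \<and>
     (\<forall>S\<in>\<U>. small \<U> ((UNIV :: nat set) \<rightarrow> S))"

text \<open>A small set of elements of any type \<open>'x\<close> (paths, pairs, functions, ...) is not
  literally a member of \<open>\<U>\<close>; it is replaced by the isomorphic member \<open>realize \<U> S\<close>.\<close>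

definition code :: "'u set set \<Rightarrow> 'x set \<Rightarrow> 'x \<Rightarrow> 'u" where
  "code \<U> S = (SOME f. inj_on f S \<and> f ` S \<in> \<U>)"

definition decode :: "'u set set \<Rightarrow> 'x set \<Rightarrow> 'u \<Rightarrow> 'x" where
  "decode \<U> S = inv_into S (code \<U> S)"

definition realize :: "'u set set \<Rightarrow> 'x set \<Rightarrow> 'u set" where
  "realize \<U> S = code \<U> S ` S"

definition realize_map ::
  "'u set set \<Rightarrow> 'x set \<Rightarrow> 'y set \<Rightarrow> ('x \<Rightarrow> 'y) \<Rightarrow> 'u \<Rightarrow> 'u" where
  "realize_map \<U> S T \<phi> = (\<lambda>u\<in>realize \<U> S. code \<U> T (\<phi> (decode \<U> S u)))"

lemma set_universe_nonvacuous: "set_universe (UNIV :: (nat \<Rightarrow> bool) set set)"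
proof -
  have "inj (\<lambda>n::nat. \<lambda>k. k = n)"
    by (auto simp: inj_def fun_eq_iff)
  then have nat: "(UNIV :: nat set) \<lesssim> (UNIV :: (nat \<Rightarrow> bool) set)"
    by (auto simp: lepoll_def)
  have "inj (\<lambda>f :: nat \<Rightarrow> nat \<Rightarrow> bool. case_prod f \<circ> prod_decode)"
  proof (rule injI, intro ext)
    fix f g :: "nat \<Rightarrow> nat \<Rightarrow> bool" and i j
    assume "case_prod f \<circ> prod_decode = case_prod g \<circ> prod_decode"
    from fun_cong[OF this, of "prod_encode (i, j)"] show "f i j = g i j"
      by simp
  qed
  then have "(UNIV :: (nat \<Rightarrow> nat \<Rightarrow> bool) set) \<lesssim> (UNIV :: (nat \<Rightarrow> bool) set)"
    by (auto simp: lepoll_def)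
  then have "((UNIV :: nat set) \<rightarrow> S) \<lesssim> (UNIV :: (nat \<Rightarrow> bool) set)" for S :: "(nat \<Rightarrow> bool) set"
    by (meson lepoll_trans subset_UNIV subset_imp_lepoll)
  with nat show ?thesis
    by (auto simp: set_universe_def small_def)
qed

type_synonym 'u set_arr = "'u set \<times> ('u \<Rightarrow> 'u) \<times> 'u set"

definition set_cat :: "'u set set \<Rightarrow> ('u set, 'u set_arr) cat" where
  "set_cat \<U> = \<lparr>Obj = \<U>,
     Arr = {(X, f, Y). X \<in> \<U> \<and> Y \<in> \<U> \<and> f \<in> X \<rightarrow>\<^sub>E Y},
     Dom = (\<lambda>(X, f, Y). X),
     Cod = (\<lambda>(X, f, Y). Y),
     Ide = (\<lambda>X. (X, (\<lambda>x\<in>X. x), X)),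
     Cmp = (\<lambda>(Y', g, Z) (X, f, Y). (X, compose X g f, Z))\<rparr>"


section \<open>Polynomial functors and comonads\<close>

text \<open>The coproduct \<open>\<Sum>i\<in>I. Set(A i, -)\<close> of representables.\<close>

abbreviation poly_set :: "'i set \<Rightarrow> ('i \<Rightarrow> 'x set) \<Rightarrow> 'u set \<Rightarrow> ('i \<times> ('x \<Rightarrow> 'u)) set" where
  "poly_set I A X \<equiv> (SIGMA i:I. A i \<rightarrow>\<^sub>E X)"

definition poly_functor ::
  "'u set set \<Rightarrow> 'i set \<Rightarrow> ('i \<Rightarrow> 'x set) \<Rightarrow> ('u set, 'u set_arr, 'u set, 'u set_arr) fctr" where
  "poly_functor \<U> I A =
     \<lparr>omap = (\<lambda>X. realize \<U> (poly_set I A X)),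
      amap = (\<lambda>(X, f, Y).
        (realize \<U> (poly_set I A X),
         realize_map \<U> (poly_set I A X) (poly_set I A Y) (\<lambda>(i, x). (i, compose (A i) f x)),
         realize \<U> (poly_set I A Y)))\<rparr>"

definition polynomial ::
  "'u set set \<Rightarrow> ('u set, 'u set_arr, 'u set, 'u set_arr) fctr \<Rightarrow> bool" where
  "polynomial \<U> F \<longleftrightarrow> (\<exists>I A. I \<in> \<U> \<and> (\<forall>i\<in>I. A i \<in> \<U>) \<and>
     (\<forall>X\<in>\<U>. small \<U> (poly_set I A X)) \<and>
     (\<exists>\<theta>. nat_iso (set_cat \<U>) (set_cat \<U>) F (poly_functor \<U> I A) \<theta>))"

definition polynomial_comonad :: "'u set set \<Rightarrow> ('u set, 'u set_arr) comonad \<Rightarrow> bool" where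
  "polynomial_comonad \<U> M \<longleftrightarrow> is_comonad (set_cat \<U>) M \<and> polynomial \<U> (cfun M)"

definition out_arrs :: "('o, 'a) cat \<Rightarrow> 'o \<Rightarrow> 'a set" where
  "out_arrs C c = {f \<in> Arr C. Dom C f = c}"

abbreviation k_set :: "('o, 'a) cat \<Rightarrow> 'u set \<Rightarrow> ('o \<times> ('a \<Rightarrow> 'u)) set" where
  "k_set C X \<equiv> poly_set (Obj C) (out_arrs C) X"

definition k_comonad :: "'u set set \<Rightarrow> ('o, 'a) cat \<Rightarrow> ('u set, 'u set_arr) comonad" where
  "k_comonad \<U> C =
     \<lparr>cfun = poly_functor \<U> (Obj C) (out_arrs C),
      counit = (\<lambda>X\<in>\<U>.
        (realize \<U> (k_set C X),
         (\<lambda>u\<in>realize \<U> (k_set C X). case decode \<U> (k_set C X) u of (c, x) \<Rightarrow> x (Ide C c)),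
         X)),
      comult = (\<lambda>X\<in>\<U>.
        (realize \<U> (k_set C X),
         realize_map \<U> (k_set C X) (k_set C (realize \<U> (k_set C X)))
           (\<lambda>(c, x). (c, \<lambda>f\<in>out_arrs C c.
              code \<U> (k_set C X) (Cod C f, \<lambda>f'\<in>out_arrs C (Cod C f). x (f' \<cdot>\<^bsub>C\<^esub> f)))),
         realize \<U> (k_set C (realize \<U> (k_set C X)))))\<rparr>"

definition corresponding_category ::
  "'u set set \<Rightarrow> ('u set, 'u set_arr) comonad \<Rightarrow> ('u, 'u) cat \<Rightarrow> bool" where
  "corresponding_category \<U> M C \<longleftrightarrow> category C \<and> Obj C \<in> \<U> \<and> Arr C \<in> \<U> \<and>
     (\<forall>X\<in>\<U>. small \<U> (k_set C X)) \<and>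
     comonad_iso (set_cat \<U>) M (k_comonad \<U> C)"


section \<open>Directed multigraphs\<close>

text \<open>A functor from the graph-indexing category \<open>E \<rightrightarrows> V\<close> to sets is a pair of sets with a
  parallel pair of functions; a natural transformation is a pair of functions commuting with
  these. The incidence functions are taken to be extensional, so that each graph has a unique
  representation.\<close>

definition graph_homs ::
  "('v, 'e) pre_digraph \<Rightarrow> ('w, 'd) pre_digraph \<Rightarrow> (('v \<Rightarrow> 'w) \<times> ('e \<Rightarrow> 'd)) set" where
  "graph_homs G H = {(h, k). h \<in> verts G \<rightarrow>\<^sub>E verts H \<and> k \<in> arcs G \<rightarrow>\<^sub>E arcs H \<and>
     (\<forall>e\<in>arcs G. tail H (k e) = h (tail G e) \<and> head H (k e) = h (head G e))}"

definition graph_comp ::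
  "('v, 'e) pre_digraph \<Rightarrow> ('w \<Rightarrow> 'x) \<times> ('d \<Rightarrow> 'f) \<Rightarrow> ('v \<Rightarrow> 'w) \<times> ('e \<Rightarrow> 'd) \<Rightarrow>
   ('v \<Rightarrow> 'x) \<times> ('e \<Rightarrow> 'f)" where
  "graph_comp G g f = (compose (verts G) (fst g) (fst f), compose (arcs G) (snd g) (snd f))"

type_synonym 'u graph = "('u, 'u) pre_digraph"
type_synonym 'u graph_arr = "'u graph \<times> (('u \<Rightarrow> 'u) \<times> ('u \<Rightarrow> 'u)) \<times> 'u graph"

definition small_graphs :: "'u set set \<Rightarrow> 'u graph set" where
  "small_graphs \<U> = {G. wf_digraph G \<and> verts G \<in> \<U> \<and> arcs G \<in> \<U> \<and>
     tail G \<in> extensional (arcs G) \<and> head G \<in> extensional (arcs G)}"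

definition graph_cat :: "'u set set \<Rightarrow> ('u graph, 'u graph_arr) cat" where
  "graph_cat \<U> = \<lparr>Obj = small_graphs \<U>,
     Arr = {(G, f, H). G \<in> small_graphs \<U> \<and> H \<in> small_graphs \<U> \<and> f \<in> graph_homs G H},
     Dom = (\<lambda>(G, f, H). G),
     Cod = (\<lambda>(G, f, H). H),
     Ide = (\<lambda>G. (G, (\<lambda>v\<in>verts G. v, \<lambda>e\<in>arcs G. e), G)),
     Cmp = (\<lambda>(H', g, K) (G, f, H). (G, graph_comp G g f, K))\<rparr>"


section \<open>Paths and the free-category monad\<close>

text \<open>The graph with vertices \<open>0, \<dots>, n\<close> and edges \<open>e\<^sub>i : i - 1 \<rightarrow> i\<close> for \<open>1 \<le> i \<le> n\<close>.\<close>

definition line :: "nat \<Rightarrow> (nat, nat) pre_digraph" where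
  "line n = \<lparr>verts = {0..n}, arcs = {1..n}, tail = (\<lambda>i. i - 1), head = (\<lambda>i. i)\<rparr>"

type_synonym 'u gpath = "nat \<times> (nat \<Rightarrow> 'u) \<times> (nat \<Rightarrow> 'u)"

definition path_set :: "'u graph \<Rightarrow> 'u gpath set" where
  "path_set G = (SIGMA n:UNIV. graph_homs (line n) G)"

definition map_path :: "('u \<Rightarrow> 'u) \<times> ('u \<Rightarrow> 'u) \<Rightarrow> 'u gpath \<Rightarrow> 'u gpath" where
  "map_path f = (\<lambda>(n, h). (n, graph_comp (line n) f h))"

definition paths :: "'u set set \<Rightarrow> ('u graph, 'u graph_arr, 'u set, 'u set_arr) fctr" where
  "paths \<U> =
     \<lparr>omap = (\<lambda>G. realize \<U> (path_set G)),
      amap = (\<lambda>(G, f, H).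
        (realize \<U> (path_set G), realize_map \<U> (path_set G) (path_set H) (map_path f),
         realize \<U> (path_set H)))\<rparr>"

fun path_source :: "'u gpath \<Rightarrow> 'u" where
  "path_source (n, h, k) = h 0"

fun path_target :: "'u gpath \<Rightarrow> 'u" where
  "path_target (n, h, k) = h n"

fun path_edges :: "'u gpath \<Rightarrow> 'u list" where
  "path_edges (n, h, k) = map k [1..<Suc n]"

text \<open>A path is determined by its source and its list of edges.\<close>

definition mk_path :: "'u graph \<Rightarrow> 'u \<Rightarrow> 'u list \<Rightarrow> 'u gpath" where
  "mk_path G v es = (length es,
     (\<lambda>i\<in>{0..length es}. if i = 0 then v else head G (es ! (i - 1))),
     (\<lambda>i\<in>{1..length es}. es ! (i - 1)))"

definition frcat_graph :: "'u set set \<Rightarrow> 'u graph \<Rightarrow> 'u graph" where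
  "frcat_graph \<U> G =
     \<lparr>verts = verts G, arcs = realize \<U> (path_set G),
      tail = (\<lambda>u\<in>realize \<U> (path_set G). path_source (decode \<U> (path_set G) u)),
      head = (\<lambda>u\<in>realize \<U> (path_set G). path_target (decode \<U> (path_set G) u))\<rparr>"

definition frcat :: "'u set set \<Rightarrow> ('u graph, 'u graph_arr, 'u graph, 'u graph_arr) fctr" where
  "frcat \<U> =
     \<lparr>omap = frcat_graph \<U>,
      amap = (\<lambda>(G, f, H).
        (frcat_graph \<U> G,
         (fst f, realize_map \<U> (path_set G) (path_set H) (map_path f)),
         frcat_graph \<U> H))\<rparr>"

definition frcat_unit :: "'u set set \<Rightarrow> 'u graph \<Rightarrow> 'u graph_arr" where
  "frcat_unit \<U> = (\<lambda>G\<in>small_graphs \<U>.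
     (G, (\<lambda>v\<in>verts G. v, \<lambda>e\<in>arcs G. code \<U> (path_set G) (mk_path G (tail G e) [e])),
      frcat_graph \<U> G))"

text \<open>The edges of a path in \<open>frcat_graph \<U> G\<close> are (codes of) paths in \<open>G\<close>.\<close>

definition concat_path :: "'u set set \<Rightarrow> 'u graph \<Rightarrow> 'u gpath \<Rightarrow> 'u gpath" where
  "concat_path \<U> G P = mk_path G (path_source P)
     (concat (map (\<lambda>u. path_edges (decode \<U> (path_set G) u)) (path_edges P)))"

definition frcat_mult :: "'u set set \<Rightarrow> 'u graph \<Rightarrow> 'u graph_arr" where
  "frcat_mult \<U> = (\<lambda>G\<in>small_graphs \<U>.
     (frcat_graph \<U> (frcat_graph \<U> G),
      (\<lambda>v\<in>verts G. v,
       realize_map \<U> (path_set (frcat_graph \<U> G)) (path_set G) (concat_path \<U> G)),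
      frcat_graph \<U> G))"


section \<open>The simplicial indexing category\<close>

text \<open>The object \<open>n\<close> is the ordinal \<open>{0 < \<dots> < n}\<close>.\<close>

definition Delta :: "(nat, nat \<times> (nat \<Rightarrow> nat) \<times> nat) cat" where
  "Delta = \<lparr>Obj = UNIV,
     Arr = {(m, f, n). f \<in> {0..m} \<rightarrow>\<^sub>E {0..n} \<and> mono_on {0..m} f},
     Dom = (\<lambda>(m, f, n). m),
     Cod = (\<lambda>(m, f, n). n),
     Ide = (\<lambda>n. (n, (\<lambda>i\<in>{0..n}. i), n)),
     Cmp = (\<lambda>(n', g, k) (m, f, n). (m, compose {0..m} g f, k))\<rparr>"

end

theory Submission
  imports Defs "HOL-Library.Countable_Set" "Graph_Theory.Arc_Walk"
begin

text \<open>
  The functor \<open>paths\<close> is the coproduct of the representables on the graphs \<open>\<^bold>n\<close> with \<open>n\<close> consecutive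
  edges. The left Kan extension of a representable \<open>A(a, -)\<close> along \<open>q\<close> is represented by \<open>q a\<close>, so
  the Kan extension of \<open>p = \<Sum>c. A(a c, -)\<close> along \<open>p t\<close> is \<open>X \<mapsto> \<Sum>c. Set(p (t (a c)), X)\<close>, and an
  element of \<open>p (t (a c))\<close> is a Kleisli map \<open>a d \<rightarrow> t (a c)\<close> for some \<open>d\<close>. Unwinding the two
  universal properties, the canonical comonad is that of the opposite of the full subcategory of
  the Kleisli category of \<open>t\<close> on the objects \<open>a c\<close>. For the free-category monad, a Kleisli map
  \<open>\<^bold>m \<rightarrow> frcat \<^bold>n\<close> is determined by its action on vertices, which can be any monotone map
  \<open>{0..m} \<rightarrow> {0..n}\<close>, because the free category on \<open>\<^bold>n\<close> is the ordinal \<open>{0..n}\<close>.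
\<close>

section \<open>Kan extensions and comonads\<close>

text \<open>Why the opposite: in \<open>k_comonad\<close> the exponent over c consists of the arrows
  out of c, while the exponent over c in the Kan extension is p (t (a c)), whose elements are maps
  into t (a c) from a varying a d. An arrow from c to d must therefore be a Kleisli map from a d to
  a c. The theorem speaks of every Kan extension, and the structure maps of an arbitrary one are
  definite descriptions on which nothing can be computed. It is compared with one explicit
  extension, the functor of \<open>k_comonad\<close>; maps out of a Kan extension that agree on the
  unit are equal, and the comonad laws travel along the comparison isomorphism. The other constraint
  is size. Of function sets, the universe is only assumed to contain those of sequences, so the
  function sets of the polynomial are small because each object of the category has countably many
  outgoing arrows. Functors take sets of codes as values, and the category itself is copied into the
  universe, since \<open>corresponding_category\<close> asks for objects and arrows of type
  \<open>'u\<close>.\<close>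

lemma (in category) Cmp_arr [simp]:
  assumes "f \<in> Arr C" "g \<in> Arr C" "Dom C g = Cod C f"
  shows "g \<cdot> f \<in> Arr C" "Dom C (g \<cdot> f) = Dom C f" "Cod C (g \<cdot> f) = Cod C g"
  using Cmp_Hom[of f "Dom C f" "Cod C f" g "Cod C g"] assms by (auto simp: Hom_def)

lemma (in category) assoc:
  assumes "f \<in> Arr C" "g \<in> Arr C" "h \<in> Arr C" "Dom C g = Cod C f" "Dom C h = Cod C g"
  shows "(h \<cdot> g) \<cdot> f = h \<cdot> (g \<cdot> f)"
  using Cmp_assoc[of f _ _ g _ h] assms by (auto simp: Hom_def)

lemma (in category) Ide_arr [simp]:
  assumes "X \<in> Obj C"
  shows "Ide C X \<in> Arr C" "Dom C (Ide C X) = X" "Cod C (Ide C X) = X"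
  using Ide_Hom[OF assms] by (auto simp: Hom_def)

lemma (in category) Ide_unit [simp]:
  assumes "f \<in> Arr C"
  shows "Dom C f = X \<Longrightarrow> f \<cdot> Ide C X = f" "Cod C f = Y \<Longrightarrow> Ide C Y \<cdot> f = f"
  using Cmp_Ide_right[of f] Cmp_Ide_left[of f] assms by (auto simp: Hom_def)

lemma (in category) Dom_Cod_Obj [simp]:
  assumes "f \<in> Arr C"
  shows "Dom C f \<in> Obj C" "Cod C f \<in> Obj C"
  using assms Dom_Obj Cod_Obj by auto

lemma (in category) category_op: "category (op_cat C)"
  by unfold_locales (auto simp: op_cat_def Hom_def assoc)

lemma (in category) iso_cancel:
  assumes "is_iso C h" "f \<in> Arr C" "g \<in> Arr C" "Cod C f = Dom C h" "Cod C g = Dom C h"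
    and "h \<cdot> f = h \<cdot> g"
  shows "f = g"
proof -
  obtain k where k: "k \<in> Arr C" "Dom C k = Cod C h" "Cod C k = Dom C h" "k \<cdot> h = Ide C (Dom C h)"
    and h: "h \<in> Arr C"
    using assms(1) by (auto simp: is_iso_def Hom_def)
  have "f = (k \<cdot> h) \<cdot> f" using k assms by simp
  also have "\<dots> = (k \<cdot> h) \<cdot> g" using k(1-3) h assms(2-) by (simp add: assoc)
  finally show ?thesis using k assms by simp
qed

lemma (in category) is_iso_Cmp:
  assumes "is_iso C f" "is_iso C g" "Dom C g = Cod C f"
  shows "is_iso C (g \<cdot> f)"
proof -
  obtain f' where f': "f' \<in> Arr C" "Dom C f' = Cod C f" "Cod C f' = Dom C f"
      "f' \<cdot> f = Ide C (Dom C f)" "f \<cdot> f' = Ide C (Cod C f)"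
    using assms(1) by (auto simp: is_iso_def Hom_def)
  obtain g' where g': "g' \<in> Arr C" "Dom C g' = Cod C g" "Cod C g' = Dom C g"
      "g' \<cdot> g = Ide C (Dom C g)" "g \<cdot> g' = Ide C (Cod C g)"
    using assms(2) by (auto simp: is_iso_def Hom_def)
  have fg: "f \<in> Arr C" "g \<in> Arr C" using assms by (auto simp: is_iso_def)
  have "(f' \<cdot> g') \<cdot> (g \<cdot> f) = f' \<cdot> ((g' \<cdot> g) \<cdot> f)"
    using f'(1-3) g'(1-3) fg assms(3) by (simp add: assoc)
  moreover have "(g \<cdot> f) \<cdot> (f' \<cdot> g') = g \<cdot> ((f \<cdot> f') \<cdot> g')"
    using f'(1-3) g'(1-3) fg assms(3) by (simp add: assoc)
  ultimately show ?thesis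
    unfolding is_iso_def using f' g' fg assms(3)
    by (intro conjI bexI[of _ "f' \<cdot> g'"]) (simp_all add: Hom_def)
qed

lemma functor_simps:
  assumes "is_functor C D F"
  shows "category C" "category D"
    and "X \<in> Obj C \<Longrightarrow> omap F X \<in> Obj D"
    and "f \<in> Arr C \<Longrightarrow> amap F f \<in> Arr D"
    and "f \<in> Arr C \<Longrightarrow> Dom D (amap F f) = omap F (Dom C f)"
    and "f \<in> Arr C \<Longrightarrow> Cod D (amap F f) = omap F (Cod C f)"
    and "X \<in> Obj C \<Longrightarrow> amap F (Ide C X) = Ide D (omap F X)"
  using assms by (auto simp: is_functor_def Hom_def)

lemma functor_Cmp:
  assumes "is_functor C D F" "f \<in> Arr C" "g \<in> Arr C" "Dom C g = Cod C f"
  shows "amap F (g \<cdot>\<^bsub>C\<^esub> f) = amap F g \<cdot>\<^bsub>D\<^esub> amap F f"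
  using assms by (auto simp: is_functor_def)

lemma is_functor_comp:
  assumes "is_functor A B F" "is_functor B D G"
  shows "is_functor A D (G \<circ>\<^sub>F F)"
  using assms by (auto simp: is_functor_def comp_functor_def Hom_def)

lemma is_functor_id: "category C \<Longrightarrow> is_functor C C id_functor"
  by (auto simp: is_functor_def id_functor_def Hom_def)

lemma comp_functor_simps [simp]:
  "omap (G \<circ>\<^sub>F F) X = omap G (omap F X)" "amap (G \<circ>\<^sub>F F) f = amap G (amap F f)"
  by (simp_all add: comp_functor_def)

lemma id_functor_simps [simp]: "omap id_functor X = X" "amap id_functor f = f"
  by (simp_all add: id_functor_def)

lemma comp_functor_assoc: "(H \<circ>\<^sub>F G) \<circ>\<^sub>F F = H \<circ>\<^sub>F (G \<circ>\<^sub>F F)"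
  by (simp add: comp_functor_def comp_assoc)

lemma comp_functor_id [simp]: "id_functor \<circ>\<^sub>F F = F" "F \<circ>\<^sub>F id_functor = F"
  by (simp_all add: comp_functor_def id_functor_def comp_def)

lemma functor_is_iso:
  assumes F: "is_functor C D F" and f: "is_iso C f"
  shows "is_iso D (amap F f)"
proof -
  interpret C: category C using functor_simps(1)[OF F] .
  obtain g where "f \<in> Arr C" "g \<in> Arr C" "Dom C g = Cod C f" "Cod C g = Dom C f"
      "g \<cdot>\<^bsub>C\<^esub> f = Ide C (Dom C f)" "f \<cdot>\<^bsub>C\<^esub> g = Ide C (Cod C f)"
    using f by (auto simp: is_iso_def Hom_def)
  then show ?thesis
    unfolding is_iso_def
    by (intro conjI bexI[of _ "amap F g"])
      (simp_all add: Hom_def functor_simps[OF F] flip: functor_Cmp[OF F])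
qed

section \<open>Natural transformations and whiskering\<close>

lemma nat_trans_simps:
  assumes "nat_trans C D F G \<tau>"
  shows "is_functor C D F" "is_functor C D G" "\<tau> \<in> extensional (Obj C)"
    and "X \<in> Obj C \<Longrightarrow> \<tau> X \<in> Arr D"
    and "X \<in> Obj C \<Longrightarrow> Dom D (\<tau> X) = omap F X"
    and "X \<in> Obj C \<Longrightarrow> Cod D (\<tau> X) = omap G X"
  using assms by (auto simp: nat_trans_def Hom_def)

lemma nat_trans_natural:
  assumes "nat_trans C D F G \<tau>" "f \<in> Arr C" "Dom C f = X" "Cod C f = Y"
  shows "amap G f \<cdot>\<^bsub>D\<^esub> \<tau> X = \<tau> Y \<cdot>\<^bsub>D\<^esub> amap F f"
  using assms by (auto simp: nat_trans_def)

text \<open>Composites are kept nested to the right, where the two arrows of a naturality square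
  come with a tail. Plain naturality does not match such a term; this version carries the tail
  \<open>h\<close> along.\<close>

lemma nat_trans_natural':
  assumes "nat_trans C D F G \<tau>" "f \<in> Arr C" "Dom C f = X" "Cod C f = Y"
    and "h \<in> Arr D" "Cod D h = omap F X"
  shows "amap G f \<cdot>\<^bsub>D\<^esub> \<tau> X \<cdot>\<^bsub>D\<^esub> h = \<tau> Y \<cdot>\<^bsub>D\<^esub> amap F f \<cdot>\<^bsub>D\<^esub> h"
proof -
  have FG: "is_functor C D F" "is_functor C D G" using assms(1) by (auto simp: nat_trans_simps)
  interpret C: category C using functor_simps(1)[OF FG(1)] .
  interpret D: category D using functor_simps(2)[OF FG(1)] .
  have XY: "X \<in> Obj C" "Y \<in> Obj C" using assms(2-4) by auto
  note s = functor_simps[OF FG(1)] functor_simps[OF FG(2)] nat_trans_simps[OF assms(1)] assms(2-) XY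
  have "amap G f \<cdot>\<^bsub>D\<^esub> \<tau> X \<cdot>\<^bsub>D\<^esub> h = (amap G f \<cdot>\<^bsub>D\<^esub> \<tau> X) \<cdot>\<^bsub>D\<^esub> h"
    by (simp add: s D.assoc)
  also have "\<dots> = \<tau> Y \<cdot>\<^bsub>D\<^esub> amap F f \<cdot>\<^bsub>D\<^esub> h"
    by (simp add: s D.assoc nat_trans_natural[OF assms(1)])
  finally show ?thesis .
qed

lemma nat_trans_Ide:
  assumes F: "is_functor C D F"
  shows "nat_trans C D F F (\<lambda>X\<in>Obj C. Ide D (omap F X))"
proof -
  interpret C: category C using functor_simps(1)[OF F] .
  interpret D: category D using functor_simps(2)[OF F] .
  show ?thesis using F by (auto simp: nat_trans_def Hom_def functor_simps[OF F])
qed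

lemma nat_trans_Cmp:
  assumes \<sigma>: "nat_trans C D F G \<sigma>" and \<tau>: "nat_trans C D G H \<tau>"
  shows "nat_trans C D F H (\<lambda>X\<in>Obj C. \<tau> X \<cdot>\<^bsub>D\<^esub> \<sigma> X)"
proof -
  note F = nat_trans_simps(1)[OF \<sigma>] and G = nat_trans_simps(1)[OF \<tau>] and H = nat_trans_simps(2)[OF \<tau>]
  interpret C: category C using functor_simps(1)[OF F] .
  interpret D: category D using functor_simps(2)[OF F] .
  note s = functor_simps[OF F] functor_simps[OF G] functor_simps[OF H]
    nat_trans_simps[OF \<sigma>] nat_trans_simps[OF \<tau>]
  show ?thesis
    by (auto simp: nat_trans_def Hom_def F H s D.assoc nat_trans_natural[OF \<sigma>]
        nat_trans_natural'[OF \<tau>])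
qed

lemma nat_trans_whisker_right:
  assumes F: "is_functor A B F" and \<tau>: "nat_trans B D G H \<tau>"
  shows "nat_trans A D (G \<circ>\<^sub>F F) (H \<circ>\<^sub>F F) (\<lambda>X\<in>Obj A. \<tau> (omap F X))"
proof -
  note G = nat_trans_simps(1)[OF \<tau>] and H = nat_trans_simps(2)[OF \<tau>]
  interpret A: category A using functor_simps(1)[OF F] .
  note s = functor_simps[OF F] nat_trans_simps[OF \<tau>]
  show ?thesis
    by (auto simp: nat_trans_def Hom_def is_functor_comp[OF F] G H s nat_trans_natural[OF \<tau>])
qed

lemma nat_trans_whisker_left:
  assumes \<tau>: "nat_trans A B F G \<tau>" and H: "is_functor B D H"
  shows "nat_trans A D (H \<circ>\<^sub>F F) (H \<circ>\<^sub>F G) (\<lambda>X\<in>Obj A. amap H (\<tau> X))"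
proof -
  note F = nat_trans_simps(1)[OF \<tau>] and G = nat_trans_simps(2)[OF \<tau>]
  interpret A: category A using functor_simps(1)[OF F] .
  note s = functor_simps[OF F] functor_simps[OF G] functor_simps[OF H] nat_trans_simps[OF \<tau>]
  show ?thesis
    by (auto simp: nat_trans_def Hom_def is_functor_comp[OF _ H] F G s
        functor_Cmp[OF H, symmetric] nat_trans_natural[OF \<tau>])
qed

text \<open>Right whiskering followed by left whiskering. With both factors equal to the comparison
  of two Kan extensions it yields the map from L L to G G needed to compare
  comultiplications.\<close>

lemma nat_trans_hcomp:
  assumes \<sigma>: "nat_trans C C F F' \<sigma>" and \<tau>: "nat_trans C C G G' \<tau>"
  shows "nat_trans C C (G \<circ>\<^sub>F F) (G' \<circ>\<^sub>F F')
    (\<lambda>X\<in>Obj C. amap G' (\<sigma> X) \<cdot>\<^bsub>C\<^esub> \<tau> (omap F X))"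
proof -
  have "(\<lambda>X\<in>Obj C. (\<lambda>X\<in>Obj C. amap G' (\<sigma> X)) X \<cdot>\<^bsub>C\<^esub> (\<lambda>X\<in>Obj C. \<tau> (omap F X)) X)
      = (\<lambda>X\<in>Obj C. amap G' (\<sigma> X) \<cdot>\<^bsub>C\<^esub> \<tau> (omap F X))"
    by auto
  then show ?thesis
    using nat_trans_Cmp[OF nat_trans_whisker_right[OF nat_trans_simps(1)[OF \<sigma>] \<tau>]
        nat_trans_whisker_left[OF \<sigma> nat_trans_simps(2)[OF \<tau>]]] by simp
qed

lemma nat_trans_eqI:
  assumes "nat_trans C D F G \<sigma>" "nat_trans C D F G \<tau>" "\<And>X. X \<in> Obj C \<Longrightarrow> \<sigma> X = \<tau> X"
  shows "\<sigma> = \<tau>"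
  using assms by (auto simp: nat_trans_def intro: extensionalityI)

section \<open>Left Kan extensions and their uniqueness\<close>

lemma is_lanD:
  assumes "is_lan A B D p q L \<alpha>"
  shows "is_functor A D p" "is_functor A B q" "is_functor B D L" "nat_trans A D p (L \<circ>\<^sub>F q) \<alpha>"
  using assms by (auto simp: is_lan_def)

text \<open>Both transformations factor the same map \<open>?\<beta>\<close> through the unit
  \<open>\<alpha>\<close>, and such a factorisation is unique. The identities between maps out of
  \<open>L\<close> in \<open>lan_inverse\<close> and \<open>lan_comonad_iso\<close> rest on
  this.\<close>

lemma lan_unique:
  assumes L: "is_lan A B D p q L \<alpha>"
    and \<gamma>: "nat_trans B D L r \<gamma>" and \<gamma>': "nat_trans B D L r \<gamma>'"
    and eq: "\<And>X. X \<in> Obj A \<Longrightarrow> \<gamma> (omap q X) \<cdot>\<^bsub>D\<^esub> \<alpha> X = \<gamma>' (omap q X) \<cdot>\<^bsub>D\<^esub> \<alpha> X"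
  shows "\<gamma> = \<gamma>'"
proof -
  let ?\<beta> = "\<lambda>X\<in>Obj A. (\<lambda>X\<in>Obj A. \<gamma> (omap q X)) X \<cdot>\<^bsub>D\<^esub> \<alpha> X"
  have "is_functor B D r" "nat_trans A D p (r \<circ>\<^sub>F q) ?\<beta>"
    using nat_trans_simps(2)[OF \<gamma>]
      nat_trans_Cmp[OF is_lanD(4)[OF L] nat_trans_whisker_right[OF is_lanD(2)[OF L] \<gamma>]] by auto
  with L have "\<exists>!\<gamma>. nat_trans B D L r \<gamma> \<and> (\<forall>X\<in>Obj A. \<gamma> (omap q X) \<cdot>\<^bsub>D\<^esub> \<alpha> X = ?\<beta> X)"
    unfolding is_lan_def by blast
  moreover have "nat_trans B D L r \<gamma> \<and> (\<forall>X\<in>Obj A. \<gamma> (omap q X) \<cdot>\<^bsub>D\<^esub> \<alpha> X = ?\<beta> X)"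
    "nat_trans B D L r \<gamma>' \<and> (\<forall>X\<in>Obj A. \<gamma>' (omap q X) \<cdot>\<^bsub>D\<^esub> \<alpha> X = ?\<beta> X)"
    using \<gamma> \<gamma>' eq by auto
  ultimately show ?thesis by blast
qed

text \<open>The hypothesis restricts \<open>\<beta>\<close> because the formulas in
  \<open>lan_comonad\<close> are not extensional, as \<open>nat_trans\<close> demands. The defining
  equations look only at objects, so restricted and unrestricted \<open>\<beta>\<close> describe the
  same transformation.\<close>

lemma lan_induced:
  assumes L: "is_lan A B D p q L \<alpha>"
    and \<beta>: "nat_trans A D p (r \<circ>\<^sub>F q) (restrict \<beta> (Obj A))" and r: "is_functor B D r"
  shows "nat_trans B D L r (lan_induced A B D q L \<alpha> r \<beta>)"
    and "X \<in> Obj A \<Longrightarrow> lan_induced A B D q L \<alpha> r \<beta> (omap q X) \<cdot>\<^bsub>D\<^esub> \<alpha> X = \<beta> X"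
proof -
  have "\<exists>!\<gamma>. nat_trans B D L r \<gamma> \<and>
      (\<forall>X\<in>Obj A. \<gamma> (omap q X) \<cdot>\<^bsub>D\<^esub> \<alpha> X = restrict \<beta> (Obj A) X)"
    using L \<beta> r unfolding is_lan_def by blast
  then have "\<exists>!\<gamma>. nat_trans B D L r \<gamma> \<and> (\<forall>X\<in>Obj A. \<gamma> (omap q X) \<cdot>\<^bsub>D\<^esub> \<alpha> X = \<beta> X)"
    by simp
  from theI'[OF this, folded lan_induced_def]
  show "nat_trans B D L r (lan_induced A B D q L \<alpha> r \<beta>)"
    and "X \<in> Obj A \<Longrightarrow> lan_induced A B D q L \<alpha> r \<beta> (omap q X) \<cdot>\<^bsub>D\<^esub> \<alpha> X = \<beta> X"
    by auto
qed

lemma lan_map: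
  assumes L: "is_lan A B D p q L \<alpha>" and L': "is_lan A B D p q L' \<alpha>'"
  obtains \<theta> where "nat_trans B D L L' \<theta>" "\<And>X. X \<in> Obj A \<Longrightarrow> \<theta> (omap q X) \<cdot>\<^bsub>D\<^esub> \<alpha> X = \<alpha>' X"
proof -
  have "\<exists>!\<gamma>. nat_trans B D L L' \<gamma> \<and> (\<forall>X\<in>Obj A. \<gamma> (omap q X) \<cdot>\<^bsub>D\<^esub> \<alpha> X = \<alpha>' X)"
    using L is_lanD(3,4)[OF L'] unfolding is_lan_def by blast
  with that show thesis by blast
qed

text \<open>The composite and the identity both carry \<open>\<alpha>\<close> to itself, so
  \<open>lan_unique\<close> equates them.\<close>

lemma lan_inverse:
  assumes L: "is_lan A B D p q L \<alpha>"
    and \<theta>: "nat_trans B D L L' \<theta>" "\<And>X. X \<in> Obj A \<Longrightarrow> \<theta> (omap q X) \<cdot>\<^bsub>D\<^esub> \<alpha> X = \<alpha>' X"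
    and \<theta>': "nat_trans B D L' L \<theta>'" "\<And>X. X \<in> Obj A \<Longrightarrow> \<theta>' (omap q X) \<cdot>\<^bsub>D\<^esub> \<alpha>' X = \<alpha> X"
    and X: "X \<in> Obj B"
  shows "\<theta>' X \<cdot>\<^bsub>D\<^esub> \<theta> X = Ide D (omap L X)"
proof -
  note F = is_lanD[OF L]
  interpret D: category D using functor_simps(2)[OF F(3)] .
  note s = functor_simps[OF F(1)] functor_simps[OF F(2)] functor_simps[OF F(3)]
    nat_trans_simps[OF F(4)] nat_trans_simps[OF \<theta>(1)] nat_trans_simps[OF \<theta>'(1)]
  have "(\<lambda>X\<in>Obj B. \<theta>' X \<cdot>\<^bsub>D\<^esub> \<theta> X) = (\<lambda>X\<in>Obj B. Ide D (omap L X))"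
    by (rule lan_unique[OF L nat_trans_Cmp[OF \<theta>(1) \<theta>'(1)] nat_trans_Ide[OF F(3)]])
      (simp add: s D.assoc \<theta>(2) \<theta>'(2))
  from fun_cong[OF this, of X] X show ?thesis by simp
qed

lemma lan_iso:
  assumes L: "is_lan A B D p q L \<alpha>" and L': "is_lan A B D p q L' \<alpha>'"
  obtains \<theta> where "nat_iso B D L L' \<theta>" "\<And>X. X \<in> Obj A \<Longrightarrow> \<theta> (omap q X) \<cdot>\<^bsub>D\<^esub> \<alpha> X = \<alpha>' X"
proof -
  obtain \<theta> where \<theta>: "nat_trans B D L L' \<theta>" "\<And>X. X \<in> Obj A \<Longrightarrow> \<theta> (omap q X) \<cdot>\<^bsub>D\<^esub> \<alpha> X = \<alpha>' X"
    by (rule lan_map[OF L L']) blast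
  obtain \<theta>' where \<theta>': "nat_trans B D L' L \<theta>'" "\<And>X. X \<in> Obj A \<Longrightarrow> \<theta>' (omap q X) \<cdot>\<^bsub>D\<^esub> \<alpha>' X = \<alpha> X"
    by (rule lan_map[OF L' L]) blast
  have "is_iso D (\<theta> X)" if X: "X \<in> Obj B" for X
    unfolding is_iso_def
    using X lan_inverse[OF L \<theta> \<theta>' X] lan_inverse[OF L' \<theta>' \<theta> X]
    by (intro conjI bexI[of _ "\<theta>' X"])
      (simp_all add: Hom_def nat_trans_simps[OF \<theta>(1)] nat_trans_simps[OF \<theta>'(1)])
  then have "nat_iso B D L L' \<theta>"
    using \<theta>(1) by (simp add: nat_iso_def)
  with \<theta>(2) that show thesis by blast
qed

text \<open>The laws are checked after composing with \<open>\<theta>\<close>, which is cancellable.\<close>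

lemma comonad_transport:
  assumes N: "is_comonad D N" and \<theta>: "nat_iso D D (cfun M) (cfun N) \<theta>"
    and \<epsilon>: "nat_trans D D (cfun M) id_functor (counit M)"
    and \<delta>: "nat_trans D D (cfun M) (cfun M \<circ>\<^sub>F cfun M) (comult M)"
    and counit: "\<And>X. X \<in> Obj D \<Longrightarrow> counit N X \<cdot>\<^bsub>D\<^esub> \<theta> X = counit M X"
    and comult: "\<And>X. X \<in> Obj D \<Longrightarrow> comult N X \<cdot>\<^bsub>D\<^esub> \<theta> X =
      (amap (cfun N) (\<theta> X) \<cdot>\<^bsub>D\<^esub> \<theta> (omap (cfun M) X)) \<cdot>\<^bsub>D\<^esub> comult M X"
  shows "comonad_iso D M N"
proof -
  define F G where "F = cfun M" and "G = cfun N"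
  have \<theta>t: "nat_trans D D F G \<theta>" and \<theta>i: "\<And>X. X \<in> Obj D \<Longrightarrow> is_iso D (\<theta> X)"
    using \<theta> by (auto simp: nat_iso_def F_def G_def)
  note F = nat_trans_simps(1)[OF \<theta>t] and G = nat_trans_simps(2)[OF \<theta>t]
  interpret D: category D using functor_simps(2)[OF F] .
  have \<epsilon>N: "nat_trans D D G id_functor (counit N)" and \<delta>N: "nat_trans D D G (G \<circ>\<^sub>F G) (comult N)"
    and laws: "\<And>X. X \<in> Obj D \<Longrightarrow> counit N (omap G X) \<cdot>\<^bsub>D\<^esub> comult N X = Ide D (omap G X)"
      "\<And>X. X \<in> Obj D \<Longrightarrow> amap G (counit N X) \<cdot>\<^bsub>D\<^esub> comult N X = Ide D (omap G X)"
      "\<And>X. X \<in> Obj D \<Longrightarrow> comult N (omap G X) \<cdot>\<^bsub>D\<^esub> comult N X =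
        amap G (comult N X) \<cdot>\<^bsub>D\<^esub> comult N X"
    using N by (auto simp: is_comonad_def G_def)
  note s = functor_simps(3-)[OF F] functor_simps(3-)[OF G]
    nat_trans_simps(4-)[OF \<theta>t] nat_trans_simps(4-)[OF \<epsilon>[folded F_def]] nat_trans_simps(4-)[OF \<delta>[folded F_def]]
    nat_trans_simps(4-)[OF \<epsilon>N] nat_trans_simps(4-)[OF \<delta>N]
  note \<epsilon>Nn = nat_trans_natural'[OF \<epsilon>N, simplified] and \<delta>Nn = nat_trans_natural'[OF \<delta>N, simplified]
    and \<theta>n = nat_trans_natural'[OF \<theta>t]
  have comult': "amap G (\<theta> X) \<cdot>\<^bsub>D\<^esub> \<theta> (omap F X) \<cdot>\<^bsub>D\<^esub> comult M X = comult N X \<cdot>\<^bsub>D\<^esub> \<theta> X"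
    if "X \<in> Obj D" for X
    using comult[OF that] that by (simp add: s D.assoc flip: F_def G_def)
  have 1: "counit M (omap F X) \<cdot>\<^bsub>D\<^esub> comult M X = Ide D (omap F X)" if X: "X \<in> Obj D" for X
  proof (rule D.iso_cancel[OF \<theta>i[OF X]])
    have "\<theta> X \<cdot>\<^bsub>D\<^esub> counit M (omap F X) \<cdot>\<^bsub>D\<^esub> comult M X
        = \<theta> X \<cdot>\<^bsub>D\<^esub> counit N (omap F X) \<cdot>\<^bsub>D\<^esub> \<theta> (omap F X) \<cdot>\<^bsub>D\<^esub> comult M X"
      using X by (simp add: s D.assoc flip: counit)
    also have "\<dots> = counit N (omap G X) \<cdot>\<^bsub>D\<^esub> amap G (\<theta> X) \<cdot>\<^bsub>D\<^esub> \<theta> (omap F X) \<cdot>\<^bsub>D\<^esub> comult M X"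
      using X by (subst \<epsilon>Nn) (auto simp: s)
    also have "\<dots> = (counit N (omap G X) \<cdot>\<^bsub>D\<^esub> comult N X) \<cdot>\<^bsub>D\<^esub> \<theta> X"
      using X by (simp add: comult' s D.assoc)
    finally show "\<theta> X \<cdot>\<^bsub>D\<^esub> counit M (omap F X) \<cdot>\<^bsub>D\<^esub> comult M X = \<theta> X \<cdot>\<^bsub>D\<^esub> Ide D (omap F X)"
      using X by (simp add: laws s)
  qed (use X in \<open>auto simp: s\<close>)
  have 2: "amap F (counit M X) \<cdot>\<^bsub>D\<^esub> comult M X = Ide D (omap F X)" if X: "X \<in> Obj D" for X
  proof (rule D.iso_cancel[OF \<theta>i[OF X]])
    have "\<theta> X \<cdot>\<^bsub>D\<^esub> amap F (counit M X) \<cdot>\<^bsub>D\<^esub> comult M X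
        = amap G (counit M X) \<cdot>\<^bsub>D\<^esub> \<theta> (omap F X) \<cdot>\<^bsub>D\<^esub> comult M X"
      using X by (subst \<theta>n) (auto simp: s)
    also have "\<dots> = amap G (counit N X) \<cdot>\<^bsub>D\<^esub> amap G (\<theta> X) \<cdot>\<^bsub>D\<^esub> \<theta> (omap F X) \<cdot>\<^bsub>D\<^esub> comult M X"
      using X by (simp add: s D.assoc functor_Cmp[OF G] flip: counit)
    also have "\<dots> = (amap G (counit N X) \<cdot>\<^bsub>D\<^esub> comult N X) \<cdot>\<^bsub>D\<^esub> \<theta> X"
      using X by (simp add: comult' s D.assoc)
    finally show "\<theta> X \<cdot>\<^bsub>D\<^esub> amap F (counit M X) \<cdot>\<^bsub>D\<^esub> comult M X = \<theta> X \<cdot>\<^bsub>D\<^esub> Ide D (omap F X)"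
      using X by (simp add: laws s)
  qed (use X in \<open>auto simp: s\<close>)
  have 3: "comult M (omap F X) \<cdot>\<^bsub>D\<^esub> comult M X = amap F (comult M X) \<cdot>\<^bsub>D\<^esub> comult M X"
    if X: "X \<in> Obj D" for X
  proof (rule D.iso_cancel)
    \<comment> \<open>\<open>?h\<close> is the threefold comparison from F F F to G G G. Both sides
      of coassociativity end in F F F, so this, and not \<open>\<theta>\<close> at X, is the
      isomorphism to cancel.\<close>
    let ?h = "amap G (amap G (\<theta> X)) \<cdot>\<^bsub>D\<^esub> amap G (\<theta> (omap F X)) \<cdot>\<^bsub>D\<^esub> \<theta> (omap F (omap F X))"
    show "is_iso D ?h"
      using X by (intro D.is_iso_Cmp functor_is_iso[OF G] \<theta>i) (auto simp: s)
    have "?h \<cdot>\<^bsub>D\<^esub> comult M (omap F X) \<cdot>\<^bsub>D\<^esub> comult M X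
        = amap G (amap G (\<theta> X)) \<cdot>\<^bsub>D\<^esub> (amap G (\<theta> (omap F X)) \<cdot>\<^bsub>D\<^esub>
          \<theta> (omap F (omap F X)) \<cdot>\<^bsub>D\<^esub> comult M (omap F X)) \<cdot>\<^bsub>D\<^esub> comult M X"
      using X by (simp add: s D.assoc)
    also have "\<dots> = amap G (amap G (\<theta> X)) \<cdot>\<^bsub>D\<^esub> comult N (omap F X) \<cdot>\<^bsub>D\<^esub> \<theta> (omap F X) \<cdot>\<^bsub>D\<^esub> comult M X"
      using X by (subst comult') (auto simp: s D.assoc)
    also have "\<dots> = comult N (omap G X) \<cdot>\<^bsub>D\<^esub> amap G (\<theta> X) \<cdot>\<^bsub>D\<^esub> \<theta> (omap F X) \<cdot>\<^bsub>D\<^esub> comult M X"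
      using X by (subst \<delta>Nn) (auto simp: s)
    also have "\<dots> = (comult N (omap G X) \<cdot>\<^bsub>D\<^esub> comult N X) \<cdot>\<^bsub>D\<^esub> \<theta> X"
      using X by (simp add: comult' s D.assoc)
    finally have l: "?h \<cdot>\<^bsub>D\<^esub> comult M (omap F X) \<cdot>\<^bsub>D\<^esub> comult M X
      = amap G (comult N X) \<cdot>\<^bsub>D\<^esub> comult N X \<cdot>\<^bsub>D\<^esub> \<theta> X"
      using X by (simp add: laws s D.assoc)
    have "?h \<cdot>\<^bsub>D\<^esub> amap F (comult M X) \<cdot>\<^bsub>D\<^esub> comult M X
        = amap G (amap G (\<theta> X)) \<cdot>\<^bsub>D\<^esub> amap G (\<theta> (omap F X)) \<cdot>\<^bsub>D\<^esub>
          \<theta> (omap F (omap F X)) \<cdot>\<^bsub>D\<^esub> amap F (comult M X) \<cdot>\<^bsub>D\<^esub> comult M X"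
      using X by (simp add: s D.assoc)
    also have "\<dots> = amap G (amap G (\<theta> X)) \<cdot>\<^bsub>D\<^esub> amap G (\<theta> (omap F X)) \<cdot>\<^bsub>D\<^esub>
          amap G (comult M X) \<cdot>\<^bsub>D\<^esub> \<theta> (omap F X) \<cdot>\<^bsub>D\<^esub> comult M X"
      using X by (subst \<theta>n) (auto simp: s)
    also have "\<dots> = amap G (amap G (\<theta> X) \<cdot>\<^bsub>D\<^esub> \<theta> (omap F X) \<cdot>\<^bsub>D\<^esub> comult M X) \<cdot>\<^bsub>D\<^esub>
          \<theta> (omap F X) \<cdot>\<^bsub>D\<^esub> comult M X"
      using X by (simp add: s D.assoc functor_Cmp[OF G])
    also have "\<dots> = amap G (comult N X) \<cdot>\<^bsub>D\<^esub> amap G (\<theta> X) \<cdot>\<^bsub>D\<^esub> \<theta> (omap F X) \<cdot>\<^bsub>D\<^esub> comult M X"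
      using X by (simp add: comult' s D.assoc functor_Cmp[OF G])
    finally show "?h \<cdot>\<^bsub>D\<^esub> comult M (omap F X) \<cdot>\<^bsub>D\<^esub> comult M X
        = ?h \<cdot>\<^bsub>D\<^esub> amap F (comult M X) \<cdot>\<^bsub>D\<^esub> comult M X"
      using X l by (simp add: comult')
  qed (use X in \<open>auto simp: s\<close>)
  have "is_comonad D M"
    using \<epsilon> \<delta> 1 2 3 by (simp add: is_comonad_def F_def)
  then show ?thesis
    using N \<theta> counit comult by (auto simp: comonad_iso_def)
qed

text \<open>It suffices to recognise the two structure maps of the canonical comonad on one particular
  Kan extension, since both are determined by universal properties.\<close>

lemma lan_comonad_iso:
  assumes t: "is_functor A A t"
    and \<eta>: "nat_trans A A id_functor t \<eta>" and \<mu>: "nat_trans A A (t \<circ>\<^sub>F t) t \<mu>"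
    and N: "is_comonad D N" and lanN: "is_lan A D D p (p \<circ>\<^sub>F t) (cfun N) \<kappa>"
    and counit: "\<And>X. X \<in> Obj A \<Longrightarrow> counit N (omap p (omap t X)) \<cdot>\<^bsub>D\<^esub> \<kappa> X = amap p (\<eta> X)"
    and comult: "\<And>X. X \<in> Obj A \<Longrightarrow> comult N (omap p (omap t X)) \<cdot>\<^bsub>D\<^esub> \<kappa> X =
      amap (cfun N) (amap (cfun N) (amap p (\<mu> X))) \<cdot>\<^bsub>D\<^esub> amap (cfun N) (\<kappa> (omap t X)) \<cdot>\<^bsub>D\<^esub> \<kappa> X"
    and lan: "is_lan A D D p (p \<circ>\<^sub>F t) L \<alpha>"
  shows "comonad_iso D (lan_comonad A D p t \<eta> \<mu> L \<alpha>) N"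
    and "\<exists>\<theta>. nat_iso D D L (cfun N) \<theta>"
proof -
  obtain \<theta> where \<theta>: "nat_iso D D L (cfun N) \<theta>"
    and \<theta>\<alpha>: "\<And>X. X \<in> Obj A \<Longrightarrow> \<theta> (omap p (omap t X)) \<cdot>\<^bsub>D\<^esub> \<alpha> X = \<kappa> X"
    using lan_iso[OF lan lanN] by (metis comp_functor_simps(1))
  show "\<exists>\<theta>. nat_iso D D L (cfun N) \<theta>" using \<theta> by blast
  have \<theta>t: "nat_trans D D L (cfun N) \<theta>" using \<theta> by (simp add: nat_iso_def)
  note p = is_lanD(1)[OF lan] and q = is_lanD(2)[OF lan] and L = is_lanD(3)[OF lan]
    and G = is_lanD(3)[OF lanN] and \<alpha> = is_lanD(4)[OF lan] and \<kappa> = is_lanD(4)[OF lanN]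
  interpret A: category A using functor_simps(1)[OF t] .
  interpret D: category D using functor_simps(2)[OF p] .
  have \<epsilon>N: "nat_trans D D (cfun N) id_functor (counit N)"
    and \<delta>N: "nat_trans D D (cfun N) (cfun N \<circ>\<^sub>F cfun N) (comult N)"
    using N by (auto simp: is_comonad_def)
  note s = functor_simps(3-)[OF p] functor_simps(3-)[OF t] functor_simps(3-)[OF L]
    functor_simps(3-)[OF G] nat_trans_simps(4-)[OF \<alpha>] nat_trans_simps(4-)[OF \<kappa>]
    nat_trans_simps(4-)[OF \<eta>] nat_trans_simps(4-)[OF \<mu>] nat_trans_simps(4-)[OF \<theta>t]
    nat_trans_simps(4-)[OF \<epsilon>N] nat_trans_simps(4-)[OF \<delta>N]
  let ?\<epsilon> = "counit (lan_comonad A D p t \<eta> \<mu> L \<alpha>)" and ?\<delta> = "comult (lan_comonad A D p t \<eta> \<mu> L \<alpha>)"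
  have [simp]: "cfun (lan_comonad A D p t \<eta> \<mu> L \<alpha>) = L" by (simp add: lan_comonad_def)
  have \<beta>\<epsilon>: "nat_trans A D p (id_functor \<circ>\<^sub>F (p \<circ>\<^sub>F t)) (restrict (\<lambda>X. amap p (\<eta> X)) (Obj A))"
    using nat_trans_whisker_left[OF \<eta> p] by simp
  let ?\<beta> = "\<lambda>X. amap L (amap L (amap p (\<mu> X))) \<cdot>\<^bsub>D\<^esub> amap L (\<alpha> (omap t X)) \<cdot>\<^bsub>D\<^esub> \<alpha> X"
  have \<alpha>t: "nat_trans A D (L \<circ>\<^sub>F (p \<circ>\<^sub>F t)) (L \<circ>\<^sub>F L \<circ>\<^sub>F (p \<circ>\<^sub>F t \<circ>\<^sub>F t)) (\<lambda>X\<in>Obj A. amap L (\<alpha> (omap t X)))"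
    using nat_trans_whisker_left[OF nat_trans_whisker_right[OF t \<alpha>] L]
    by (simp add: comp_functor_assoc cong: restrict_cong)
  have "nat_trans A D (L \<circ>\<^sub>F L \<circ>\<^sub>F p \<circ>\<^sub>F t \<circ>\<^sub>F t) (L \<circ>\<^sub>F L \<circ>\<^sub>F p \<circ>\<^sub>F t)
      (\<lambda>X\<in>Obj A. amap L (amap L (amap p (\<mu> X))))"
    using nat_trans_whisker_left[OF nat_trans_whisker_left[OF nat_trans_whisker_left[OF \<mu> p] L] L]
    by (simp cong: restrict_cong)
  from nat_trans_Cmp[OF nat_trans_Cmp[OF \<alpha> \<alpha>t] this]
  have \<beta>\<delta>: "nat_trans A D p ((L \<circ>\<^sub>F L) \<circ>\<^sub>F (p \<circ>\<^sub>F t)) (restrict ?\<beta> (Obj A))"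
    by (simp add: comp_functor_assoc cong: restrict_cong)
  have \<epsilon>: "nat_trans D D L id_functor ?\<epsilon>"
    and \<epsilon>\<alpha>: "\<And>X. X \<in> Obj A \<Longrightarrow> ?\<epsilon> (omap p (omap t X)) \<cdot>\<^bsub>D\<^esub> \<alpha> X = amap p (\<eta> X)"
    using lan_induced[OF lan \<beta>\<epsilon>] is_functor_id[OF D.category_axioms] by (auto simp: lan_comonad_def)
  have \<delta>: "nat_trans D D L (L \<circ>\<^sub>F L) ?\<delta>"
    and \<delta>\<alpha>: "\<And>X. X \<in> Obj A \<Longrightarrow> ?\<delta> (omap p (omap t X)) \<cdot>\<^bsub>D\<^esub> \<alpha> X = ?\<beta> X"
    using lan_induced[OF lan \<beta>\<delta>] is_functor_comp[OF L L] by (auto simp: lan_comonad_def)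
  note s = s nat_trans_simps(4-)[OF \<epsilon>] nat_trans_simps(4-)[OF \<delta>]
  \<comment> \<open>\<open>lan_unique\<close> compares both sides on \<open>\<alpha>\<close>: the
    left one becomes \<open>counit N\<close> after \<open>\<kappa>\<close>, evaluated by the
    assumption \<open>counit\<close>, and the right one is the defining equation of the canonical
    counit.\<close>
  have c1: "(\<lambda>X\<in>Obj D. counit N X \<cdot>\<^bsub>D\<^esub> \<theta> X) = ?\<epsilon>"
    by (rule lan_unique[OF lan nat_trans_Cmp[OF \<theta>t \<epsilon>N] \<epsilon>])
      (simp add: s D.assoc \<theta>\<alpha> \<epsilon>\<alpha> counit)
  let ?r = "\<lambda>X\<in>Obj D. (\<lambda>X\<in>Obj D. amap (cfun N) (\<theta> X) \<cdot>\<^bsub>D\<^esub> \<theta> (omap L X)) X \<cdot>\<^bsub>D\<^esub> ?\<delta> X"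
  have c2: "(\<lambda>X\<in>Obj D. comult N X \<cdot>\<^bsub>D\<^esub> \<theta> X) = ?r"
  proof (rule lan_unique[OF lan nat_trans_Cmp[OF \<theta>t \<delta>N] nat_trans_Cmp[OF \<delta> nat_trans_hcomp[OF \<theta>t \<theta>t]]])
    fix X assume X: "X \<in> Obj A"
    let ?q = "\<lambda>X. omap p (omap t X)" and ?G = "cfun N"
    \<comment> \<open>Naturality moves each \<open>\<theta>\<close> to the right until it meets an
      \<open>\<alpha>\<close>, where the pair becomes \<open>\<kappa>\<close>. Once \<open>L\<close>
      and \<open>\<alpha>\<close> have disappeared, the assumption \<open>comult\<close> identifies
      the two sides.\<close>
    have "?r (?q X) \<cdot>\<^bsub>D\<^esub> \<alpha> X = amap ?G (\<theta> (?q X)) \<cdot>\<^bsub>D\<^esub> \<theta> (omap L (?q X)) \<cdot>\<^bsub>D\<^esub>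
        amap L (amap L (amap p (\<mu> X))) \<cdot>\<^bsub>D\<^esub> amap L (\<alpha> (omap t X)) \<cdot>\<^bsub>D\<^esub> \<alpha> X"
      using X by (simp add: s D.assoc \<delta>\<alpha>)
    also have "\<dots> = amap ?G (\<theta> (?q X)) \<cdot>\<^bsub>D\<^esub> amap ?G (amap L (amap p (\<mu> X))) \<cdot>\<^bsub>D\<^esub>
        \<theta> (omap L (?q (omap t X))) \<cdot>\<^bsub>D\<^esub> amap L (\<alpha> (omap t X)) \<cdot>\<^bsub>D\<^esub> \<alpha> X"
      using X by (subst nat_trans_natural'[OF \<theta>t]) (auto simp: s)
    also have "\<dots> = amap ?G (\<theta> (?q X)) \<cdot>\<^bsub>D\<^esub> amap ?G (amap L (amap p (\<mu> X))) \<cdot>\<^bsub>D\<^esub>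
        amap ?G (\<alpha> (omap t X)) \<cdot>\<^bsub>D\<^esub> \<theta> (?q X) \<cdot>\<^bsub>D\<^esub> \<alpha> X"
      using X by (subst nat_trans_natural'[OF \<theta>t]) (auto simp: s)
    also have "\<dots> = amap ?G (\<theta> (?q X) \<cdot>\<^bsub>D\<^esub> amap L (amap p (\<mu> X)) \<cdot>\<^bsub>D\<^esub> \<alpha> (omap t X)) \<cdot>\<^bsub>D\<^esub> \<kappa> X"
      using X by (simp add: s D.assoc \<theta>\<alpha> functor_Cmp[OF G])
    also have "\<theta> (?q X) \<cdot>\<^bsub>D\<^esub> amap L (amap p (\<mu> X)) \<cdot>\<^bsub>D\<^esub> \<alpha> (omap t X)
        = amap ?G (amap p (\<mu> X)) \<cdot>\<^bsub>D\<^esub> \<theta> (?q (omap t X)) \<cdot>\<^bsub>D\<^esub> \<alpha> (omap t X)"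
      using X by (subst nat_trans_natural'[OF \<theta>t]) (auto simp: s)
    also have "\<dots> = amap ?G (amap p (\<mu> X)) \<cdot>\<^bsub>D\<^esub> \<kappa> (omap t X)"
      using X by (simp add: s \<theta>\<alpha>)
    finally have "?r (?q X) \<cdot>\<^bsub>D\<^esub> \<alpha> X
        = amap ?G (amap ?G (amap p (\<mu> X))) \<cdot>\<^bsub>D\<^esub> amap ?G (\<kappa> (omap t X)) \<cdot>\<^bsub>D\<^esub> \<kappa> X"
      using X by (simp add: s D.assoc functor_Cmp[OF G])
    moreover have "(\<lambda>X\<in>Obj D. comult N X \<cdot>\<^bsub>D\<^esub> \<theta> X) (?q X) \<cdot>\<^bsub>D\<^esub> \<alpha> X = comult N (?q X) \<cdot>\<^bsub>D\<^esub> \<kappa> X"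
      using X by (simp add: s D.assoc \<theta>\<alpha>)
    ultimately show "(\<lambda>X\<in>Obj D. comult N X \<cdot>\<^bsub>D\<^esub> \<theta> X) (omap (p \<circ>\<^sub>F t) X) \<cdot>\<^bsub>D\<^esub> \<alpha> X
        = ?r (omap (p \<circ>\<^sub>F t) X) \<cdot>\<^bsub>D\<^esub> \<alpha> X"
      using X by (simp add: comult)
  qed
  show "comonad_iso D (lan_comonad A D p t \<eta> \<mu> L \<alpha>) N"
  proof (rule comonad_transport[OF N, of _ \<theta>])
    fix X assume X: "X \<in> Obj D"
    show "counit N X \<cdot>\<^bsub>D\<^esub> \<theta> X = ?\<epsilon> X" using fun_cong[OF c1, of X] X by simp
    show "comult N X \<cdot>\<^bsub>D\<^esub> \<theta> X = (amap (cfun N) (\<theta> X) \<cdot>\<^bsub>D\<^esub>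
        \<theta> (omap (cfun (lan_comonad A D p t \<eta> \<mu> L \<alpha>)) X)) \<cdot>\<^bsub>D\<^esub> ?\<delta> X"
      using fun_cong[OF c2, of X] X by simp
  qed (use \<theta> \<epsilon> \<delta> in auto)
qed

section \<open>Polynomial functors and the comonad of a category\<close>

context
  fixes \<U> :: "'u set set" and S :: "'x set"
  assumes S: "small \<U> S" and \<U>: "set_universe \<U>"
begin

text \<open>The choice in \<open>code\<close> succeeds: an injection into a member of the universe
  has a small image, and \<open>set_universe\<close> makes every small set of elements of type
  \<open>'u\<close> a member.\<close>

lemma code_spec: "inj_on (code \<U> S) S \<and> code \<U> S ` S \<in> \<U>"
proof -
  obtain B f where B: "B \<in> \<U>" and f: "inj_on f S" "f ` S \<subseteq> B"
    using S by (auto simp: small_def lepoll_def)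
  then have "small \<U> (f ` S)"
    unfolding small_def by (meson subset_imp_lepoll)
  then have "f ` S \<in> \<U>" using \<U> by (auto simp: set_universe_def)
  with f(1) show ?thesis
    unfolding code_def by (intro someI[where P = "\<lambda>f. inj_on f S \<and> f ` S \<in> \<U>"]) simp
qed

lemma realize_in [simp]: "realize \<U> S \<in> \<U>"
  using code_spec by (simp add: realize_def)

lemma decode_code [simp]: "x \<in> S \<Longrightarrow> decode \<U> S (code \<U> S x) = x"
  using code_spec by (simp add: decode_def)

lemma code_eq_iff: "x \<in> S \<Longrightarrow> y \<in> S \<Longrightarrow> code \<U> S x = code \<U> S y \<longleftrightarrow> x = y"
  using code_spec by (auto dest: inj_onD)

end

lemma code_in [simp]: "x \<in> S \<Longrightarrow> code \<U> S x \<in> realize \<U> S"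
  by (simp add: realize_def)

lemma realizeE:
  assumes "u \<in> realize \<U> S"
  obtains x where "x \<in> S" "u = code \<U> S x"
  using assms by (auto simp: realize_def)

lemma decode_in [simp]: "u \<in> realize \<U> S \<Longrightarrow> decode \<U> S u \<in> S"
  by (simp add: decode_def realize_def inv_into_into)

lemma realize_map_code [simp]:
  assumes "small \<U> S" "set_universe \<U>" "x \<in> S"
  shows "realize_map \<U> S T \<phi> (code \<U> S x) = code \<U> T (\<phi> x)"
  using assms by (simp add: realize_map_def)

lemma realize_map_type:
  assumes "\<And>x. x \<in> S \<Longrightarrow> \<phi> x \<in> T"
  shows "realize_map \<U> S T \<phi> \<in> realize \<U> S \<rightarrow>\<^sub>E realize \<U> T"
  using assms by (auto simp: realize_map_def)

section \<open>Elementwise reasoning in the category of sets\<close>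

definition ap :: "'u set_arr \<Rightarrow> 'u \<Rightarrow> 'u" where
  "ap a = fst (snd a)"

lemma ap_simp [simp]: "ap (X, f, Y) = f"
  by (simp add: ap_def)

lemma set_cat_simps [simp]:
  "Obj (set_cat \<U>) = \<U>" "Dom (set_cat \<U>) (X, f, Y) = X" "Cod (set_cat \<U>) (X, f, Y) = Y"
  "Ide (set_cat \<U>) X = (X, (\<lambda>x\<in>X. x), X)"
  "(X, f, Y) \<in> Arr (set_cat \<U>) \<longleftrightarrow> X \<in> \<U> \<and> Y \<in> \<U> \<and> f \<in> X \<rightarrow>\<^sub>E Y"
  by (simp_all add: set_cat_def)

lemma set_cat_Cmp [simp]: "(Y', g, Z) \<cdot>\<^bsub>set_cat \<U>\<^esub> (X, f, Y) = (X, compose X g f, Z)"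
  by (simp add: set_cat_def)

lemma set_cat_HomE:
  assumes "a \<in> Hom (set_cat \<U>) X Y"
  obtains f where "a = (X, f, Y)" "f \<in> X \<rightarrow>\<^sub>E Y" "X \<in> \<U>" "Y \<in> \<U>"
  using assms by (cases a) (auto simp: Hom_def)

lemma Hom_set_cat_iff [simp]:
  "(X', f, Y') \<in> Hom (set_cat \<U>) X Y \<longleftrightarrow> X' = X \<and> Y' = Y \<and> X \<in> \<U> \<and> Y \<in> \<U> \<and> f \<in> X \<rightarrow>\<^sub>E Y"
  by (auto simp: Hom_def)

lemma ap_Cmp [simp]:
  assumes "a \<in> Hom (set_cat \<U>) X Y" "x \<in> X"
  shows "ap (b \<cdot>\<^bsub>set_cat \<U>\<^esub> a) x = ap b (ap a x)"
  using assms by (cases b) (auto elim!: set_cat_HomE simp: compose_def)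

lemma ap_in:
  assumes "a \<in> Hom (set_cat \<U>) X Y" "x \<in> X"
  shows "ap a x \<in> Y"
  using assms by (auto elim!: set_cat_HomE)

lemma set_cat_eqI:
  assumes "a \<in> Hom (set_cat \<U>) X Y" "b \<in> Hom (set_cat \<U>) X Y" "\<And>x. x \<in> X \<Longrightarrow> ap a x = ap b x"
  shows "a = b"
  using assms by (auto elim!: set_cat_HomE simp: fun_eq_iff PiE_def extensional_def) metis

lemma category_set_cat: "category (set_cat \<U>)"
proof
  fix f g h X Y Z W
  assume "f \<in> Hom (set_cat \<U>) X Y" "g \<in> Hom (set_cat \<U>) Y Z" "h \<in> Hom (set_cat \<U>) Z W"
  then show "(h \<cdot>\<^bsub>set_cat \<U>\<^esub> g) \<cdot>\<^bsub>set_cat \<U>\<^esub> f = h \<cdot>\<^bsub>set_cat \<U>\<^esub> g \<cdot>\<^bsub>set_cat \<U>\<^esub> f"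
    by (auto elim!: set_cat_HomE simp: compose_def fun_eq_iff)
qed (auto elim!: set_cat_HomE simp: Hom_def, auto simp: compose_def fun_eq_iff PiE_def extensional_def)

interpretation set_cat: category "set_cat \<U>" for \<U> :: "'u set set"
  by (rule category_set_cat)

lemma nat_trans_ap:
  assumes \<tau>: "nat_trans C (set_cat \<U>) F G \<tau>" and f: "f \<in> Hom C X Y" and x: "x \<in> omap F X"
  shows "ap (amap G f) (ap (\<tau> X) x) = ap (\<tau> Y) (ap (amap F f) x)"
proof -
  interpret C: category C
    using functor_simps(1)[OF nat_trans_simps(1)[OF \<tau>]] .
  have f': "f \<in> Arr C" "Dom C f = X" "Cod C f = Y" using f by (auto simp: Hom_def)
  then have XY: "X \<in> Obj C" "Y \<in> Obj C" by auto
  have "\<tau> X \<in> Hom (set_cat \<U>) (omap F X) (omap G X)"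
    "amap F f \<in> Hom (set_cat \<U>) (omap F X) (omap F Y)"
    using \<tau> f' XY by (auto simp: nat_trans_def is_functor_def)
  then show ?thesis
    using nat_trans_natural[OF \<tau> f'] x by (metis ap_Cmp)
qed

lemma functor_Hom:
  assumes "is_functor C D F" "f \<in> Hom C X Y"
  shows "amap F f \<in> Hom D (omap F X) (omap F Y)"
  using assms by (auto simp: is_functor_def Hom_def)

lemma nat_trans_Hom:
  assumes "nat_trans C D F G \<tau>" "X \<in> Obj C"
  shows "\<tau> X \<in> Hom D (omap F X) (omap G X)"
  using assms by (auto simp: nat_trans_def)

lemma functor_ap_Cmp:
  assumes F: "is_functor C (set_cat \<U>) F" and f: "f \<in> Hom C X Y" and g: "g \<in> Hom C Y Z"
    and x: "x \<in> omap F X"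
  shows "ap (amap F (g \<cdot>\<^bsub>C\<^esub> f)) x = ap (amap F g) (ap (amap F f) x)"
proof -
  have "amap F (g \<cdot>\<^bsub>C\<^esub> f) = amap F g \<cdot>\<^bsub>set_cat \<U>\<^esub> amap F f"
    using f g by (intro functor_Cmp[OF F]) (auto simp: Hom_def)
  with functor_Hom[OF F f] x show ?thesis by simp
qed

lemma functor_set_catI:
  assumes "category C"
    and "\<And>X. X \<in> Obj C \<Longrightarrow> omap F X \<in> \<U>"
    and hom: "\<And>f X Y. f \<in> Hom C X Y \<Longrightarrow> amap F f \<in> Hom (set_cat \<U>) (omap F X) (omap F Y)"
    and ide: "\<And>X x. X \<in> Obj C \<Longrightarrow> x \<in> omap F X \<Longrightarrow> ap (amap F (Ide C X)) x = x"
    and cmp: "\<And>f g X Y Z x. f \<in> Hom C X Y \<Longrightarrow> g \<in> Hom C Y Z \<Longrightarrow> x \<in> omap F X \<Longrightarrow>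
      ap (amap F (g \<cdot>\<^bsub>C\<^esub> f)) x = ap (amap F g) (ap (amap F f) x)"
  shows "is_functor C (set_cat \<U>) F"
proof -
  interpret C: category C by fact
  have "amap F (Ide C X) = Ide (set_cat \<U>) (omap F X)" if "X \<in> Obj C" for X
    using that assms(2) hom[OF C.Ide_Hom] ide
    by (intro set_cat_eqI[of _ \<U> "omap F X" "omap F X"]) auto
  moreover have "amap F (g \<cdot>\<^bsub>C\<^esub> f) = amap F g \<cdot>\<^bsub>set_cat \<U>\<^esub> amap F f"
    if "f \<in> Arr C" "g \<in> Arr C" "Cod C f = Dom C g" for f g
  proof -
    have f: "f \<in> Hom C (Dom C f) (Cod C f)" and g: "g \<in> Hom C (Cod C f) (Cod C g)"
      using that by (auto simp: Hom_def)
    show ?thesis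
      by (rule set_cat_eqI[OF hom[OF C.Cmp_Hom[OF f g]] set_cat.Cmp_Hom[OF hom[OF f] hom[OF g]]])
        (simp add: cmp[OF f g] ap_Cmp[OF hom[OF f]])
  qed
  ultimately show ?thesis
    using assms(1,2) hom set_cat.category_axioms by (auto simp: is_functor_def Hom_def)
qed

lemma nat_trans_set_catI:
  assumes F: "is_functor C (set_cat \<U>) F" and G: "is_functor C (set_cat \<U>) G"
    and "\<tau> \<in> extensional (Obj C)"
    and hom: "\<And>X. X \<in> Obj C \<Longrightarrow> \<tau> X \<in> Hom (set_cat \<U>) (omap F X) (omap G X)"
    and nat: "\<And>f X Y x. f \<in> Hom C X Y \<Longrightarrow> x \<in> omap F X \<Longrightarrow>
      ap (amap G f) (ap (\<tau> X) x) = ap (\<tau> Y) (ap (amap F f) x)"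
  shows "nat_trans C (set_cat \<U>) F G \<tau>"
proof -
  interpret C: category C using functor_simps(1)[OF F] .
  have "amap G f \<cdot>\<^bsub>set_cat \<U>\<^esub> \<tau> (Dom C f) = \<tau> (Cod C f) \<cdot>\<^bsub>set_cat \<U>\<^esub> amap F f" if "f \<in> Arr C" for f
  proof -
    have f: "f \<in> Hom C (Dom C f) (Cod C f)" and XY: "Dom C f \<in> Obj C" "Cod C f \<in> Obj C"
      using that by (auto simp: Hom_def)
    show ?thesis
      by (rule set_cat_eqI[OF set_cat.Cmp_Hom[OF hom[OF XY(1)] functor_Hom[OF G f]]
            set_cat.Cmp_Hom[OF functor_Hom[OF F f] hom[OF XY(2)]]])
        (simp add: nat[OF f] ap_Cmp[OF hom[OF XY(1)]] ap_Cmp[OF functor_Hom[OF F f]])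
  qed
  then show ?thesis using assms by (auto simp: nat_trans_def)
qed

text \<open>Smallness of the coproduct is an assumption because the function sets from
  \<open>A i\<close> to \<open>X\<close> need not be small in general. For countable
  \<open>A i\<close> and small \<open>I\<close> it follows from \<open>small_Sigma\<close> and
  \<open>small_PiE\<close>.\<close>

locale poly =
  fixes \<U> :: "'u set set" and I :: "'i set" and A :: "'i \<Rightarrow> 'x set"
  assumes \<U>: "set_universe \<U>" and small_poly: "\<And>X. X \<in> \<U> \<Longrightarrow> small \<U> (poly_set I A X)"
begin

abbreviation cd :: "'u set \<Rightarrow> 'i \<Rightarrow> ('x \<Rightarrow> 'u) \<Rightarrow> 'u" where
  "cd X i \<phi> \<equiv> code \<U> (poly_set I A X) (i, \<phi>)"

lemma omap_poly [simp]: "omap (poly_functor \<U> I A) X = realize \<U> (poly_set I A X)"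
  by (simp add: poly_functor_def)

lemma poly_in: "X \<in> \<U> \<Longrightarrow> realize \<U> (poly_set I A X) \<in> \<U>"
  by (rule realize_in[OF small_poly \<U>])

lemma cd_in: "i \<in> I \<Longrightarrow> \<phi> \<in> A i \<rightarrow>\<^sub>E X \<Longrightarrow> cd X i \<phi> \<in> realize \<U> (poly_set I A X)"
  by simp

lemma polyE:
  assumes "u \<in> realize \<U> (poly_set I A X)"
  obtains i \<phi> where "i \<in> I" "\<phi> \<in> A i \<rightarrow>\<^sub>E X" "u = cd X i \<phi>"
  using assms by (auto simp: realize_def)

lemma decode_cd:
  "X \<in> \<U> \<Longrightarrow> i \<in> I \<Longrightarrow> \<phi> \<in> A i \<rightarrow>\<^sub>E X \<Longrightarrow> decode \<U> (poly_set I A X) (cd X i \<phi>) = (i, \<phi>)"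
  by (rule decode_code[OF small_poly \<U>]) auto

lemma amap_poly:
  assumes "f \<in> Hom (set_cat \<U>) X Y" "i \<in> I" "\<phi> \<in> A i \<rightarrow>\<^sub>E X"
  shows "ap (amap (poly_functor \<U> I A) f) (cd X i \<phi>) = cd Y i (\<lambda>x\<in>A i. ap f (\<phi> x))"
  using assms by (auto elim!: set_cat_HomE simp: poly_functor_def small_poly \<U> compose_def)

lemma amap_poly_Hom:
  assumes "f \<in> Hom (set_cat \<U>) X Y"
  shows "amap (poly_functor \<U> I A) f \<in>
    Hom (set_cat \<U>) (realize \<U> (poly_set I A X)) (realize \<U> (poly_set I A Y))"
  using assms by (auto elim!: set_cat_HomE simp: poly_functor_def poly_in compose_def
      intro!: realize_map_type) blast

lemma is_functor_poly: "is_functor (set_cat \<U>) (set_cat \<U>) (poly_functor \<U> I A)"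
proof (rule functor_set_catI)
  fix X x assume "X \<in> Obj (set_cat \<U>)" "x \<in> omap (poly_functor \<U> I A) X"
  then obtain i \<phi> where x: "i \<in> I" "\<phi> \<in> A i \<rightarrow>\<^sub>E X" "x = cd X i \<phi>" and X: "X \<in> \<U>"
    by (auto elim: polyE)
  have "(\<lambda>a\<in>A i. (\<lambda>x\<in>X. x) (\<phi> a)) = \<phi>"
    using x(2) by (auto simp: fun_eq_iff PiE_def extensional_def)
  then show "ap (amap (poly_functor \<U> I A) (Ide (set_cat \<U>) X)) x = x"
    using x X by (simp add: amap_poly[of _ X X])
next
  fix f g X Y Z x
  assume f: "f \<in> Hom (set_cat \<U>) X Y" and g: "g \<in> Hom (set_cat \<U>) Y Z"
    and "x \<in> omap (poly_functor \<U> I A) X"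
  then obtain i \<phi> where x: "i \<in> I" "\<phi> \<in> A i \<rightarrow>\<^sub>E X" "x = cd X i \<phi>" by (auto elim: polyE)
  have \<phi>: "(\<lambda>a\<in>A i. ap f (\<phi> a)) \<in> A i \<rightarrow>\<^sub>E Y"
    using x(2) ap_in[OF f] by auto
  have "(\<lambda>a\<in>A i. ap (g \<cdot>\<^bsub>set_cat \<U>\<^esub> f) (\<phi> a)) = (\<lambda>a\<in>A i. ap g ((\<lambda>a\<in>A i. ap f (\<phi> a)) a))"
    using x(2) by (intro restrict_ext) (simp add: ap_Cmp[OF f] PiE_mem[OF x(2)])
  then show "ap (amap (poly_functor \<U> I A) (g \<cdot>\<^bsub>set_cat \<U>\<^esub> f)) x =
      ap (amap (poly_functor \<U> I A) g) (ap (amap (poly_functor \<U> I A) f) x)"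
    by (simp only: x(3) amap_poly[OF f x(1,2)] amap_poly[OF g x(1) \<phi>]
        amap_poly[OF set_cat.Cmp_Hom[OF f g] x(1,2)])
qed (auto simp: poly_in amap_poly_Hom set_cat.category_axioms)

end

section \<open>The comonad of a small category\<close>

locale category_comonad = category C + poly \<U> "Obj C" "out_arrs C"
  for C :: "('o, 'a) cat" and \<U> :: "'u set set"
begin

abbreviation K where "K \<equiv> poly_functor \<U> (Obj C) (out_arrs C)"
abbreviation Kob where "Kob X \<equiv> realize \<U> (k_set C X)"

lemma out_arrs_iff [simp]: "f \<in> out_arrs C c \<longleftrightarrow> f \<in> Arr C \<and> Dom C f = c"
  by (simp add: out_arrs_def)

lemma counit_k:
  assumes "X \<in> \<U>" "c \<in> Obj C" "x \<in> out_arrs C c \<rightarrow>\<^sub>E X"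
  shows "ap (counit (k_comonad \<U> C) X) (cd X c x) = x (Ide C c)"
  using assms by (simp add: k_comonad_def decode_cd)

lemma counit_k_Hom:
  assumes "X \<in> \<U>"
  shows "counit (k_comonad \<U> C) X \<in> Hom (set_cat \<U>) (Kob X) X"
  using assms by (auto simp: k_comonad_def poly_in decode_cd elim!: polyE) (erule PiE_mem, simp)

lemma inner_type:
  assumes "X \<in> \<U>" "x \<in> out_arrs C c \<rightarrow>\<^sub>E X" "f \<in> Arr C" "Dom C f = c"
  shows "(\<lambda>f'\<in>out_arrs C (Cod C f). x (f' \<cdot>\<^bsub>C\<^esub> f)) \<in> out_arrs C (Cod C f) \<rightarrow>\<^sub>E X"
  using assms by (auto intro!: PiE_mem[OF assms(2)])

lemma outer_type:
  assumes "X \<in> \<U>" "x \<in> out_arrs C c \<rightarrow>\<^sub>E X"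
  shows "(\<lambda>f\<in>out_arrs C c. cd X (Cod C f) (\<lambda>f'\<in>out_arrs C (Cod C f). x (f' \<cdot>\<^bsub>C\<^esub> f)))
    \<in> out_arrs C c \<rightarrow>\<^sub>E Kob X"
proof (rule restrict_PiE_iff[THEN iffD2], rule ballI)
  fix f assume "f \<in> out_arrs C c"
  then show "cd X (Cod C f) (\<lambda>f'\<in>out_arrs C (Cod C f). x (f' \<cdot>\<^bsub>C\<^esub> f)) \<in> Kob X"
    by (intro cd_in inner_type[OF assms]) auto
qed

lemma comult_k:
  assumes "X \<in> \<U>" "c \<in> Obj C" "x \<in> out_arrs C c \<rightarrow>\<^sub>E X"
  shows "ap (comult (k_comonad \<U> C) X) (cd X c x) = cd (Kob X) c
    (\<lambda>f\<in>out_arrs C c. cd X (Cod C f) (\<lambda>f'\<in>out_arrs C (Cod C f). x (f' \<cdot>\<^bsub>C\<^esub> f)))"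
  using assms by (simp add: k_comonad_def small_poly \<U>)

lemma comult_k_Hom:
  assumes "X \<in> \<U>"
  shows "comult (k_comonad \<U> C) X \<in> Hom (set_cat \<U>) (Kob X) (Kob (Kob X))"
  proof -
  have "realize_map \<U> (k_set C X) (k_set C (Kob X)) (\<lambda>(c, x). (c, \<lambda>f\<in>out_arrs C c.
      cd X (Cod C f) (\<lambda>f'\<in>out_arrs C (Cod C f). x (f' \<cdot>\<^bsub>C\<^esub> f)))) \<in> Kob X \<rightarrow>\<^sub>E Kob (Kob X)"
  proof (rule realize_map_type)
    fix a assume "a \<in> k_set C X"
    then obtain c x where "a = (c, x)" "c \<in> Obj C" "x \<in> out_arrs C c \<rightarrow>\<^sub>E X" by (rule SigmaE)
    then show "(case a of (c, x) \<Rightarrow> (c, \<lambda>f\<in>out_arrs C c.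
        cd X (Cod C f) (\<lambda>f'\<in>out_arrs C (Cod C f). x (f' \<cdot>\<^bsub>C\<^esub> f)))) \<in> k_set C (Kob X)"
      by (simp only: prod.case) (intro SigmaI outer_type[OF assms])
  qed
  then show ?thesis
    using assms by (simp add: k_comonad_def poly_in)
qed

lemma cfun_k [simp]: "cfun (k_comonad \<U> C) = K"
  by (simp add: k_comonad_def)

lemma nat_trans_counit_k: "nat_trans (set_cat \<U>) (set_cat \<U>) K id_functor (counit (k_comonad \<U> C))"
proof (rule nat_trans_set_catI)
  fix f X Y u assume f: "f \<in> Hom (set_cat \<U>) X Y" and "u \<in> omap K X"
  then obtain c x where x: "c \<in> Obj C" "x \<in> out_arrs C c \<rightarrow>\<^sub>E X" "u = cd X c x"
    and XY: "X \<in> \<U>" "Y \<in> \<U>" by (auto elim!: polyE elim: set_cat_HomE)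
  have "(\<lambda>g\<in>out_arrs C c. ap f (x g)) \<in> out_arrs C c \<rightarrow>\<^sub>E Y"
    using ap_in[OF f] x(2) by (auto simp: PiE_iff)
  then show "ap (amap id_functor f) (ap (counit (k_comonad \<U> C) X) u) =
      ap (counit (k_comonad \<U> C) Y) (ap (amap K f) u)"
    using x XY by (simp add: counit_k amap_poly[OF f])
qed (auto simp: is_functor_poly is_functor_id counit_k_Hom set_cat.category_axioms, simp add: k_comonad_def)

lemma nat_trans_comult_k: "nat_trans (set_cat \<U>) (set_cat \<U>) K (K \<circ>\<^sub>F K) (comult (k_comonad \<U> C))"
proof (rule nat_trans_set_catI)
  fix f X Y u assume f: "f \<in> Hom (set_cat \<U>) X Y" and "u \<in> omap K X"
  then obtain c x where x: "c \<in> Obj C" "x \<in> out_arrs C c \<rightarrow>\<^sub>E X" "u = cd X c x"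
    and XY: "X \<in> \<U>" "Y \<in> \<U>" by (auto elim!: polyE elim: set_cat_HomE)
  have y: "(\<lambda>g\<in>out_arrs C c. ap f (x g)) \<in> out_arrs C c \<rightarrow>\<^sub>E Y"
    using ap_in[OF f] x(2) by (auto simp: PiE_iff)
  show "ap (amap (K \<circ>\<^sub>F K) f) (ap (comult (k_comonad \<U> C) X) u) =
      ap (comult (k_comonad \<U> C) Y) (ap (amap K f) u)"
    using x(1) y
    by (simp add: x(3) comult_k[OF XY(1) x(1,2)] amap_poly[OF f x(1,2)] comult_k[OF XY(2) x(1)]
        amap_poly[OF amap_poly_Hom[OF f] x(1) outer_type[OF XY(1) x(2)]]
        amap_poly[OF f _ inner_type[OF XY(1) x(2)]] cong: restrict_cong)
qed (simp_all add: is_functor_poly is_functor_comp[OF is_functor_poly] comult_k_Hom,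
    simp add: k_comonad_def)

text \<open>Each comonad law is a category law. Evaluating the outer family at an identity uses the
  right unit law, evaluating the inner families there uses the left unit law, and coassociativity is
  associativity of composition.\<close>

lemma is_comonad_k: "is_comonad (set_cat \<U>) (k_comonad \<U> C)"
proof -
  let ?\<epsilon> = "counit (k_comonad \<U> C)" and ?\<delta> = "comult (k_comonad \<U> C)"
  have "?\<epsilon> (Kob X) \<cdot>\<^bsub>set_cat \<U>\<^esub> ?\<delta> X = Ide (set_cat \<U>) (Kob X) \<and>
      amap K (?\<epsilon> X) \<cdot>\<^bsub>set_cat \<U>\<^esub> ?\<delta> X = Ide (set_cat \<U>) (Kob X) \<and>
      ?\<delta> (Kob X) \<cdot>\<^bsub>set_cat \<U>\<^esub> ?\<delta> X = amap K (?\<delta> X) \<cdot>\<^bsub>set_cat \<U>\<^esub> ?\<delta> X" if X: "X \<in> \<U>" for X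
  proof (intro conjI)
    note \<delta> = comult_k_Hom[OF X]
    have ide: "Ide (set_cat \<U>) (Kob X) \<in> Hom (set_cat \<U>) (Kob X) (Kob X)"
      by (rule set_cat.Ide_Hom) (simp add: poly_in X)
    show "?\<epsilon> (Kob X) \<cdot>\<^bsub>set_cat \<U>\<^esub> ?\<delta> X = Ide (set_cat \<U>) (Kob X)"
    proof (rule set_cat_eqI[OF set_cat.Cmp_Hom[OF \<delta> counit_k_Hom[OF poly_in[OF X]]] ide])
      fix u assume u: "u \<in> Kob X"
      then obtain c x where x: "c \<in> Obj C" "x \<in> out_arrs C c \<rightarrow>\<^sub>E X" "u = cd X c x"
        by (auto elim: polyE)
      have "(\<lambda>f'\<in>out_arrs C c. x (f' \<cdot>\<^bsub>C\<^esub> Ide C c)) = x"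
        using x(2) by (auto simp: fun_eq_iff PiE_def extensional_def)
      then show "ap (?\<epsilon> (Kob X) \<cdot>\<^bsub>set_cat \<U>\<^esub> ?\<delta> X) u = ap (Ide (set_cat \<U>) (Kob X)) u"
        using u x(1) by (simp add: ap_Cmp[OF \<delta>] x(3) comult_k[OF X x(1,2)]
            counit_k[OF poly_in[OF X] x(1) outer_type[OF X x(2)]])
    qed
    show "amap K (?\<epsilon> X) \<cdot>\<^bsub>set_cat \<U>\<^esub> ?\<delta> X = Ide (set_cat \<U>) (Kob X)"
    proof (rule set_cat_eqI[OF set_cat.Cmp_Hom[OF \<delta> amap_poly_Hom[OF counit_k_Hom[OF X]]] ide])
      fix u assume u: "u \<in> Kob X"
      then obtain c x where x: "c \<in> Obj C" "x \<in> out_arrs C c \<rightarrow>\<^sub>E X" "u = cd X c x"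
        by (auto elim: polyE)
      have "(\<lambda>f\<in>out_arrs C c. ap (?\<epsilon> X) (cd X (Cod C f) (\<lambda>f'\<in>out_arrs C (Cod C f). x (f' \<cdot>\<^bsub>C\<^esub> f)))) = x"
        (is "?l = x")
      proof
        show "?l f = x f" for f
          using PiE_arb[OF x(2), of f]
          by (cases "f \<in> out_arrs C c") (auto simp: counit_k[OF X _ inner_type[OF X x(2)]])
      qed
      then show "ap (amap K (?\<epsilon> X) \<cdot>\<^bsub>set_cat \<U>\<^esub> ?\<delta> X) u = ap (Ide (set_cat \<U>) (Kob X)) u"
        using u x(1) by (simp add: ap_Cmp[OF \<delta>] x(3) comult_k[OF X x(1,2)]
            amap_poly[OF counit_k_Hom[OF X] x(1) outer_type[OF X x(2)]] cong: restrict_cong)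
    qed
    show "?\<delta> (Kob X) \<cdot>\<^bsub>set_cat \<U>\<^esub> ?\<delta> X = amap K (?\<delta> X) \<cdot>\<^bsub>set_cat \<U>\<^esub> ?\<delta> X"
    proof (rule set_cat_eqI[OF set_cat.Cmp_Hom[OF \<delta> comult_k_Hom[OF poly_in[OF X]]]
            set_cat.Cmp_Hom[OF \<delta> amap_poly_Hom[OF \<delta>]]])
      fix u assume u: "u \<in> Kob X"
      then obtain c x where x: "c \<in> Obj C" "x \<in> out_arrs C c \<rightarrow>\<^sub>E X" "u = cd X c x"
        by (auto elim: polyE)
      then show "ap (?\<delta> (Kob X) \<cdot>\<^bsub>set_cat \<U>\<^esub> ?\<delta> X) u = ap (amap K (?\<delta> X) \<cdot>\<^bsub>set_cat \<U>\<^esub> ?\<delta> X) u"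
        using u by (simp add: ap_Cmp[OF \<delta>] comult_k[OF X x(1,2)]
            comult_k[OF poly_in[OF X] x(1) outer_type[OF X x(2)]]
            amap_poly[OF \<delta> x(1) outer_type[OF X x(2)]]
            comult_k[OF X _ inner_type[OF X x(2)]] assoc cong: restrict_cong)
    qed
  qed
  then show ?thesis
    by (simp add: is_comonad_def nat_trans_counit_k nat_trans_comult_k)
qed

end

section \<open>Kan extensions of coproducts of representables\<close>

text \<open>The functor \<open>p\<close> is the coproduct of the representables \<open>A(a c, -)\<close> with universal elements
  \<open>u c\<close>, and \<open>H\<close> identifies \<open>C\<close> with the opposite of the full subcategory of the Kleisli category
  of \<open>t\<close> on the objects \<open>a c\<close>.\<close>

locale kleisli_comonad = category_comonad C \<U>
  for C :: "('o, 'a) cat" and \<U> :: "'u set set" +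
  fixes A :: "('g, 'b) cat" and p :: "('g, 'b, 'u set, 'u set_arr) fctr"
    and t :: "('g, 'b, 'g, 'b) fctr" and \<eta> \<mu> :: "'g \<Rightarrow> 'b"
    and a :: "'o \<Rightarrow> 'g" and u :: "'o \<Rightarrow> 'u" and H :: "'a \<Rightarrow> 'b"
  assumes p: "is_functor A (set_cat \<U>) p" and t: "is_functor A A t"
    and \<eta>: "nat_trans A A id_functor t \<eta>" and \<mu>: "nat_trans A A (t \<circ>\<^sub>F t) t \<mu>"
    and a_Obj: "c \<in> Obj C \<Longrightarrow> a c \<in> Obj A" and u_in: "c \<in> Obj C \<Longrightarrow> u c \<in> omap p (a c)"
    and generic: "X \<in> Obj A \<Longrightarrow> z \<in> omap p X \<Longrightarrow>
      \<exists>c\<in>Obj C. \<exists>f\<in>Hom A (a c) X. ap (amap p f) (u c) = z"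
    and generic_unique: "c \<in> Obj C \<Longrightarrow> d \<in> Obj C \<Longrightarrow> f \<in> Hom A (a c) X \<Longrightarrow> g \<in> Hom A (a d) X \<Longrightarrow>
      ap (amap p f) (u c) = ap (amap p g) (u d) \<Longrightarrow> c = d \<and> f = g"
    and H_bij: "c \<in> Obj C \<Longrightarrow> d \<in> Obj C \<Longrightarrow> bij_betw H (Hom C c d) (Hom A (a d) (omap t (a c)))"
    and H_Ide: "c \<in> Obj C \<Longrightarrow> H (Ide C c) = \<eta> (a c)"
    and H_Cmp: "k \<in> Hom C b c \<Longrightarrow> l \<in> Hom C c d \<Longrightarrow>
      H (l \<cdot>\<^bsub>C\<^esub> k) = \<mu> (a b) \<cdot>\<^bsub>A\<^esub> (amap t (H k) \<cdot>\<^bsub>A\<^esub> H l)"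
begin

sublocale A: category A using functor_simps(1)[OF t] .

abbreviation q where "q \<equiv> p \<circ>\<^sub>F t"

lemma q: "is_functor A (set_cat \<U>) q"
  by (rule is_functor_comp[OF t p])

lemma H_Hom: "g \<in> Hom C c d \<Longrightarrow> H g \<in> Hom A (a d) (omap t (a c))"
  using bij_betwE[OF H_bij] Dom_Obj Cod_Obj by (fastforce simp: Hom_def)

text \<open>Yoneda read through \<open>H\<close>: the Kleisli map of \<open>g\<close> is applied to
  the universal element of its source, which is the line object of the codomain of \<open>g\<close>
  in the intended instance.\<close>

definition \<psi> :: "'a \<Rightarrow> 'u" where
  "\<psi> g = ap (amap p (H g)) (u (Cod C g))"

text \<open>An element of p (t (a c)) is the image of the universal element of exactly one a d under
  exactly one map, and \<open>H\<close> turns that map into exactly one arrow from c to d. This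
  replaces the representing set p (t (a c)) of the Kan extension by the set of arrows out of
  c.\<close>

lemma \<psi>_bij: assumes c: "c \<in> Obj C" shows "bij_betw \<psi> (out_arrs C c) (omap q (a c))"
proof (rule bij_betw_imageI)
  have *: "g \<in> Hom C c (Cod C g)" "Cod C g \<in> Obj C" if "g \<in> out_arrs C c" for g
    using that by (auto simp: Hom_def)
  show "inj_on \<psi> (out_arrs C c)"
  proof (rule inj_onI)
    fix f g assume fg: "f \<in> out_arrs C c" "g \<in> out_arrs C c" "\<psi> f = \<psi> g"
    then have "Cod C f = Cod C g \<and> H f = H g"
      using generic_unique[OF *(2)[OF fg(1)] *(2)[OF fg(2)] H_Hom[OF *(1)] H_Hom[OF *(1)]]
      by (simp add: \<psi>_def)
    then show "f = g"
      using bij_betw_imp_inj_on[OF H_bij[OF c *(2)[OF fg(1)]]] *[OF fg(1)] *[OF fg(2)]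
      by (auto dest: inj_onD)
  qed
  show "\<psi> ` out_arrs C c = omap q (a c)"
  proof (intro equalityI subsetI)
    fix z assume "z \<in> \<psi> ` out_arrs C c"
    then obtain g where "g \<in> out_arrs C c" "z = \<psi> g" by auto
    then show "z \<in> omap q (a c)"
      using ap_in[OF functor_Hom[OF p H_Hom[OF *(1)]] u_in[OF *(2)]] by (simp add: \<psi>_def)
  next
    fix z assume "z \<in> omap q (a c)"
    then obtain d h where d: "d \<in> Obj C" and h: "h \<in> Hom A (a d) (omap t (a c))"
      and z: "ap (amap p h) (u d) = z"
      using generic[of "omap t (a c)" z] functor_simps(3)[OF t] a_Obj[OF c] by auto
    from h obtain g where "g \<in> Hom C c d" "h = H g"
      using bij_betw_imp_surj_on[OF H_bij[OF c d]] by blast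
    with z show "z \<in> \<psi> ` out_arrs C c"
      by (auto simp: \<psi>_def Hom_def)
  qed
qed

definition \<chi> :: "'o \<Rightarrow> 'u \<Rightarrow> 'a" where
  "\<chi> c = inv_into (out_arrs C c) \<psi>"

lemma \<chi>_\<psi>: "g \<in> Arr C \<Longrightarrow> \<chi> (Dom C g) (\<psi> g) = g"
  using bij_betw_inv_into_left[OF \<psi>_bij, of "Dom C g" g] by (simp add: \<chi>_def)

lemma \<psi>_in: "g \<in> Arr C \<Longrightarrow> \<psi> g \<in> omap p (omap t (a (Dom C g)))"
  using bij_betwE[OF \<psi>_bij, of "Dom C g"] by simp

lemma \<chi>_in: "c \<in> Obj C \<Longrightarrow> y \<in> omap q (a c) \<Longrightarrow> \<chi> c y \<in> out_arrs C c"
  using bij_betwE[OF bij_betw_inv_into[OF \<psi>_bij]] by (simp add: \<chi>_def del: out_arrs_iff)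

lemma \<psi>_\<chi>: "c \<in> Obj C \<Longrightarrow> y \<in> omap q (a c) \<Longrightarrow> \<psi> (\<chi> c y) = y"
  using bij_betw_inv_into_right[OF \<psi>_bij] by (simp add: \<chi>_def)

text \<open>Inverse of the isomorphism from the coproduct of representables to p: it recovers the
  summand and the map of an element. \<open>gen_eq\<close> shows that the choice is forced.\<close>

definition gen :: "'g \<Rightarrow> 'u \<Rightarrow> 'o \<times> 'b" where
  "gen X z = (SOME (c, f). c \<in> Obj C \<and> f \<in> Hom A (a c) X \<and> ap (amap p f) (u c) = z)"

lemma gen_eq:
  assumes "c \<in> Obj C" "f \<in> Hom A (a c) X"
  shows "gen X (ap (amap p f) (u c)) = (c, f)"
  unfolding gen_def using assms
  by (intro some_equality) (auto dest: generic_unique)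

text \<open>On the summand A(a c, -) the unit of the Kan extension sends f to q f, as for any
  representable. Here q f is a function on q (a c), and \<open>\<psi>\<close> turns it into a
  function on the arrows out of c.\<close>

definition \<kappa> :: "'g \<Rightarrow> 'u set_arr" where
  "\<kappa> = (\<lambda>X\<in>Obj A. (omap p X,
     \<lambda>z\<in>omap p X. case gen X z of (c, f) \<Rightarrow>
       cd (omap q X) c (\<lambda>g\<in>out_arrs C c. ap (amap q f) (\<psi> g)),
     Kob (omap q X)))"

lemma \<kappa>_ap:
  assumes "c \<in> Obj C" "f \<in> Hom A (a c) X"
  shows "ap (\<kappa> X) (ap (amap p f) (u c)) = cd (omap q X) c (\<lambda>g\<in>out_arrs C c. ap (amap q f) (\<psi> g))"
proof -
  have "X \<in> Obj A" "ap (amap p f) (u c) \<in> omap p X"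
    using assms(2) ap_in[OF functor_Hom[OF p assms(2)] u_in[OF assms(1)]] by (auto simp: Hom_def)
  then show ?thesis by (simp add: \<kappa>_def gen_eq[OF assms])
qed

lemma \<kappa>_type:
  assumes "c \<in> Obj C" "f \<in> Hom A (a c) X"
  shows "(\<lambda>g\<in>out_arrs C c. ap (amap q f) (\<psi> g)) \<in> out_arrs C c \<rightarrow>\<^sub>E omap q X"
proof (rule restrict_PiE_iff[THEN iffD2], rule ballI)
  fix g assume "g \<in> out_arrs C c"
  then show "ap (amap q f) (\<psi> g) \<in> omap q X"
    using \<psi>_in ap_in[OF functor_Hom[OF q assms(2)]] by auto
qed

lemma \<kappa>_Hom:
  assumes X: "X \<in> Obj A"
  shows "\<kappa> X \<in> Hom (set_cat \<U>) (omap p X) (Kob (omap q X))"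
proof -
  have "ap (\<kappa> X) z \<in> Kob (omap q X)" if z: "z \<in> omap p X" for z
  proof -
    obtain c f where c: "c \<in> Obj C" "f \<in> Hom A (a c) X" "z = ap (amap p f) (u c)"
      using generic[OF X z] by blast
    show ?thesis
      unfolding c(3) \<kappa>_ap[OF c(1,2)] by (rule cd_in[OF c(1) \<kappa>_type[OF c(1,2)]])
  qed
  then show ?thesis
    using X functor_simps(3)[OF q X] functor_simps(3)[OF p X] by (simp add: \<kappa>_def poly_in)
qed

lemma nat_trans_\<kappa>: "nat_trans A (set_cat \<U>) p (K \<circ>\<^sub>F q) \<kappa>"
proof (rule nat_trans_set_catI[OF p is_functor_comp[OF q is_functor_poly]])
  show "\<kappa> \<in> extensional (Obj A)" by (simp add: \<kappa>_def)
next
  fix X assume "X \<in> Obj A"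
  then show "\<kappa> X \<in> Hom (set_cat \<U>) (omap p X) (omap (K \<circ>\<^sub>F q) X)"
    using \<kappa>_Hom by simp
next
  fix h X Y z assume h: "h \<in> Hom A X Y" and z: "z \<in> omap p X"
  have X: "X \<in> Obj A" using h by (auto simp: Hom_def)
  obtain c f where c: "c \<in> Obj C" "f \<in> Hom A (a c) X" "z = ap (amap p f) (u c)"
    using generic[OF X z] by blast
  note hf = A.Cmp_Hom[OF c(2) h]
  have "ap (amap (K \<circ>\<^sub>F q) h) (ap (\<kappa> X) z) = cd (omap q Y) c
      (\<lambda>g\<in>out_arrs C c. ap (amap q h) (ap (amap q f) (\<psi> g)))"
    unfolding c(3) \<kappa>_ap[OF c(1,2)]
    using amap_poly[OF functor_Hom[OF q h] c(1) \<kappa>_type[OF c(1,2)]]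
    by (simp cong: restrict_cong)
  also have "\<dots> = cd (omap q Y) c (\<lambda>g\<in>out_arrs C c. ap (amap q (h \<cdot>\<^bsub>A\<^esub> f)) (\<psi> g))"
    using functor_ap_Cmp[OF q c(2) h] \<psi>_in by (intro arg_cong[where f = "cd _ _"] restrict_ext) auto
  also have "\<dots> = ap (\<kappa> Y) (ap (amap p h) z)"
    unfolding c(3) using \<kappa>_ap[OF c(1) hf] functor_ap_Cmp[OF p c(2) h u_in[OF c(1)]] by simp
  finally show "ap (amap (K \<circ>\<^sub>F q) h) (ap (\<kappa> X) z) = ap (\<kappa> Y) (ap (amap p h) z)" .
qed

text \<open>A function on the arrows out of c is moved back along \<open>\<psi>\<close> to an arrow
  of sets out of q (a c), along which functors and naturality can be applied.\<close>

definition ev :: "'o \<Rightarrow> ('a \<Rightarrow> 'u) \<Rightarrow> 'u set \<Rightarrow> 'u set_arr" where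
  "ev c \<phi> X = (omap q (a c), \<lambda>y\<in>omap q (a c). \<phi> (\<chi> c y), X)"

lemma ev_Hom:
  assumes "c \<in> Obj C" "X \<in> \<U>" "\<phi> \<in> out_arrs C c \<rightarrow>\<^sub>E X"
  shows "ev c \<phi> X \<in> Hom (set_cat \<U>) (omap q (a c)) X"
  using assms PiE_mem[OF assms(3) \<chi>_in[OF assms(1)]] functor_simps(3)[OF q a_Obj[OF assms(1)]]
  by (simp add: ev_def)

lemma u_Ide: "c \<in> Obj C \<Longrightarrow> ap (amap p (Ide A (a c))) (u c) = u c"
  using functor_simps(7)[OF p a_Obj] u_in by simp

text \<open>Yoneda: an element of \<open>K X\<close> is the image of the universal element \<open>\<kappa> (u c)\<close>.\<close>

lemma cd_universal:
  assumes "c \<in> Obj C" "X \<in> \<U>" "\<phi> \<in> out_arrs C c \<rightarrow>\<^sub>E X"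
  shows "cd X c \<phi> = ap (amap K (ev c \<phi> X)) (ap (\<kappa> (a c)) (u c))"
proof -
  let ?i = "\<lambda>g\<in>out_arrs C c. ap (amap q (Ide A (a c))) (\<psi> g)"
  have i: "Ide A (a c) \<in> Hom A (a c) (a c)" by (rule A.Ide_Hom[OF a_Obj[OF assms(1)]])
  have eq: "ap (ev c \<phi> X) (?i g) = \<phi> g" if "g \<in> out_arrs C c" for g
  proof -
    have "?i g = \<psi> g"
      using that functor_simps(7)[OF q a_Obj[OF assms(1)]] \<psi>_in[of g] by auto
    then show ?thesis
      using that \<psi>_in[of g] \<chi>_\<psi>[of g] by (simp add: ev_def)
  qed
  have "(\<lambda>g\<in>out_arrs C c. ap (ev c \<phi> X) (?i g)) = \<phi>"
    using eq by (intro extensionalityI[of _ "out_arrs C c"]) (use assms(3) in \<open>auto simp: PiE_def\<close>)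
  then show ?thesis
    using \<kappa>_ap[OF assms(1) i] u_Ide[OF assms(1)]
      amap_poly[OF ev_Hom[OF assms] assms(1) \<kappa>_type[OF assms(1) i]] by simp
qed

text \<open>By \<open>cd_universal\<close> the elements \<open>\<kappa>\<close> (u c) generate K, so
  a transformation out of K is fixed by its values there. The condition on the unit prescribes these
  values, and any prescription coming from \<open>\<beta>\<close> extends naturally.\<close>

lemma is_lan_K: "is_lan A (set_cat \<U>) (set_cat \<U>) p q K \<kappa>"
proof -
  have "\<exists>!\<gamma>. nat_trans (set_cat \<U>) (set_cat \<U>) K r \<gamma> \<and>
      (\<forall>X\<in>Obj A. \<gamma> (omap q X) \<cdot>\<^bsub>set_cat \<U>\<^esub> \<kappa> X = \<beta> X)"
    if r: "is_functor (set_cat \<U>) (set_cat \<U>) r" and \<beta>: "nat_trans A (set_cat \<U>) p (r \<circ>\<^sub>F q) \<beta>" for r \<beta>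
  proof -
    \<comment> \<open>There is no other candidate: (c, \<open>\<phi>\<close>) is the image of the
      universal element along \<open>ev c \<phi> X\<close>, so naturality and the value at that
      element force this formula.\<close>
    define \<gamma> where "\<gamma> = (\<lambda>X\<in>\<U>. (Kob X, \<lambda>w\<in>Kob X. case decode \<U> (k_set C X) w of (c, \<phi>) \<Rightarrow>
      ap (amap r (ev c \<phi> X)) (ap (\<beta> (a c)) (u c)), omap r X))"
    have \<gamma>_ap: "ap (\<gamma> X) (cd X c \<phi>) = ap (amap r (ev c \<phi> X)) (ap (\<beta> (a c)) (u c))"
      if "X \<in> \<U>" "c \<in> Obj C" "\<phi> \<in> out_arrs C c \<rightarrow>\<^sub>E X" for X c \<phi>
      using that cd_in[OF that(2,3)] decode_cd[OF that] by (simp add: \<gamma>_def)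
    have \<beta>_in: "ap (\<beta> (a c)) (u c) \<in> omap r (omap q (a c))" if "c \<in> Obj C" for c
      using ap_in[OF nat_trans_Hom[OF \<beta> a_Obj] u_in] that by simp
    have \<gamma>_Hom: "\<gamma> X \<in> Hom (set_cat \<U>) (omap K X) (omap r X)" if X: "X \<in> \<U>" for X
    proof -
      have "ap (\<gamma> X) w \<in> omap r X" if "w \<in> Kob X" for w
        using that
      proof (rule polyE)
        fix c \<phi> assume c: "c \<in> Obj C" "\<phi> \<in> out_arrs C c \<rightarrow>\<^sub>E X" "w = cd X c \<phi>"
        show ?thesis
          unfolding c(3) \<gamma>_ap[OF X c(1,2)]
          by (rule ap_in[OF functor_Hom[OF r ev_Hom[OF c(1) X c(2)]] \<beta>_in[OF c(1)]])
      qed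
      then show ?thesis
        using X functor_simps(3)[OF r, of X] by (simp add: \<gamma>_def poly_in)
    qed
    have \<gamma>: "nat_trans (set_cat \<U>) (set_cat \<U>) K r \<gamma>"
    proof (rule nat_trans_set_catI[OF is_functor_poly r])
      fix f X Y w assume f: "f \<in> Hom (set_cat \<U>) X Y" and "w \<in> omap K X"
      then obtain c \<phi> where c: "c \<in> Obj C" "\<phi> \<in> out_arrs C c \<rightarrow>\<^sub>E X" "w = cd X c \<phi>"
        and XY: "X \<in> \<U>" "Y \<in> \<U>" by (auto elim!: polyE elim: set_cat_HomE)
      let ?\<phi> = "\<lambda>g\<in>out_arrs C c. ap f (\<phi> g)"
      have \<phi>: "?\<phi> \<in> out_arrs C c \<rightarrow>\<^sub>E Y"
        using PiE_mem[OF c(2)] ap_in[OF f] by auto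
      \<comment> \<open>Evaluation is natural in its target, which reduces naturality of
        \<open>\<gamma>\<close> to functoriality of \<open>r\<close>.\<close>
      have "f \<cdot>\<^bsub>set_cat \<U>\<^esub> ev c \<phi> X = ev c ?\<phi> Y"
        by (rule set_cat_eqI[OF set_cat.Cmp_Hom[OF ev_Hom[OF c(1) XY(1) c(2)] f] ev_Hom[OF c(1) XY(2) \<phi>]])
          (use \<chi>_in[OF c(1)] in \<open>simp add: ap_Cmp[OF ev_Hom[OF c(1) XY(1) c(2)]], simp add: ev_def\<close>)
      then show "ap (amap r f) (ap (\<gamma> X) w) = ap (\<gamma> Y) (ap (amap K f) w)"
        unfolding c(3) \<gamma>_ap[OF XY(1) c(1,2)] amap_poly[OF f c(1,2)] \<gamma>_ap[OF XY(2) c(1) \<phi>]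
        using functor_ap_Cmp[OF r ev_Hom[OF c(1) XY(1) c(2)] f \<beta>_in[OF c(1)]] by simp
    qed (use \<gamma>_Hom in \<open>auto simp: \<gamma>_def\<close>)
    have \<gamma>_eq: "\<gamma> (omap q X) \<cdot>\<^bsub>set_cat \<U>\<^esub> \<kappa> X = \<beta> X" if X: "X \<in> Obj A" for X
    proof (rule set_cat_eqI)
      have qX: "omap q X \<in> \<U>" using functor_simps(3)[OF q X] by simp
      show "\<gamma> (omap q X) \<cdot>\<^bsub>set_cat \<U>\<^esub> \<kappa> X \<in> Hom (set_cat \<U>) (omap p X) (omap r (omap q X))"
        using set_cat.Cmp_Hom[OF \<kappa>_Hom[OF X]] \<gamma>_Hom[OF qX] by simp
      show "\<beta> X \<in> Hom (set_cat \<U>) (omap p X) (omap r (omap q X))"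
        using nat_trans_Hom[OF \<beta> X] by simp
      fix z assume z: "z \<in> omap p X"
      obtain c f where c: "c \<in> Obj C" "f \<in> Hom A (a c) X" "z = ap (amap p f) (u c)"
        using generic[OF X z] by blast
      let ?\<phi> = "\<lambda>g\<in>out_arrs C c. ap (amap q f) (\<psi> g)"
      \<comment> \<open>\<open>\<kappa>\<close> stores q f through \<open>\<psi>\<close> and
        \<open>ev\<close> reads it back through \<open>\<chi>\<close>. With q f restored, naturality
        of \<open>\<beta>\<close> along f gives the required value.\<close>
      have "ev c ?\<phi> (omap q X) = amap q f"
      proof (rule set_cat_eqI[OF ev_Hom[OF c(1) qX \<kappa>_type[OF c(1,2)]] functor_Hom[OF q c(2)]])
        fix y assume y: "y \<in> omap q (a c)"
        then show "ap (ev c ?\<phi> (omap q X)) y = ap (amap q f) y"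
          using \<chi>_in[OF c(1) y] \<psi>_\<chi>[OF c(1) y] by (simp add: ev_def)
      qed
      then have "ap (\<gamma> (omap q X)) (ap (\<kappa> X) z) = ap (amap (r \<circ>\<^sub>F q) f) (ap (\<beta> (a c)) (u c))"
        unfolding c(3) \<kappa>_ap[OF c(1,2)] \<gamma>_ap[OF qX c(1) \<kappa>_type[OF c(1,2)]] by simp
      also have "\<dots> = ap (\<beta> X) z"
        unfolding c(3) by (rule nat_trans_ap[OF \<beta> c(2) u_in[OF c(1)]])
      finally show "ap (\<gamma> (omap q X) \<cdot>\<^bsub>set_cat \<U>\<^esub> \<kappa> X) z = ap (\<beta> X) z"
        using ap_Cmp[OF \<kappa>_Hom[OF X] z] by simp
    qed
    have "\<gamma>' = \<gamma>" if \<gamma>': "nat_trans (set_cat \<U>) (set_cat \<U>) K r \<gamma>'"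
      and eq: "\<forall>X\<in>Obj A. \<gamma>' (omap q X) \<cdot>\<^bsub>set_cat \<U>\<^esub> \<kappa> X = \<beta> X" for \<gamma>'
    proof (rule nat_trans_eqI[OF \<gamma>' \<gamma>])
      fix X assume "X \<in> Obj (set_cat \<U>)"
      then have X: "X \<in> \<U>" by simp
      show "\<gamma>' X = \<gamma> X"
      proof (rule set_cat_eqI[of _ \<U> "omap K X" "omap r X"])
        fix w assume "w \<in> omap K X"
        then obtain c \<phi> where c: "c \<in> Obj C" "\<phi> \<in> out_arrs C c \<rightarrow>\<^sub>E X" "w = cd X c \<phi>"
          by (auto elim: polyE)
        have \<kappa>u: "ap (\<kappa> (a c)) (u c) \<in> omap K (omap q (a c))"
          using ap_in[OF \<kappa>_Hom[OF a_Obj[OF c(1)]] u_in[OF c(1)]] by simp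
        have "ap (\<gamma>' (omap q (a c))) (ap (\<kappa> (a c)) (u c)) = ap (\<beta> (a c)) (u c)"
          using bspec[OF eq a_Obj[OF c(1)]] ap_Cmp[OF \<kappa>_Hom[OF a_Obj[OF c(1)]] u_in[OF c(1)]] by metis
        moreover have "ap (amap r (ev c \<phi> X)) (ap (\<gamma>' (omap q (a c))) (ap (\<kappa> (a c)) (u c))) = ap (\<gamma>' X) w"
          unfolding c(3) cd_universal[OF c(1) X c(2)]
          by (rule nat_trans_ap[OF \<gamma>' ev_Hom[OF c(1) X c(2)] \<kappa>u])
        ultimately show "ap (\<gamma>' X) w = ap (\<gamma> X) w"
          by (simp add: c(3) \<gamma>_ap[OF X c(1,2)])
      qed (use nat_trans_Hom[OF \<gamma>', of X] nat_trans_Hom[OF \<gamma>, of X] X in simp_all)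
    qed
    with \<gamma> \<gamma>_eq show ?thesis by blast
  qed
  then show ?thesis
    by (simp add: is_lan_def p q is_functor_poly nat_trans_\<kappa>)
qed

text \<open>The counit evaluates the family stored by \<open>\<kappa>\<close> at the identity of c.
  By \<open>H_Ide\<close> this is t f after \<open>\<eta>\<close>, applied to the universal element,
  and naturality of \<open>\<eta>\<close> moves f to the front.\<close>

lemma counit_\<kappa>:
  assumes X: "X \<in> Obj A"
  shows "counit (k_comonad \<U> C) (omap p (omap t X)) \<cdot>\<^bsub>set_cat \<U>\<^esub> \<kappa> X = amap p (\<eta> X)"
proof (rule set_cat_eqI)
  have qX: "omap q X \<in> \<U>" using functor_simps(3)[OF q X] by simp
  have \<eta>X: "\<eta> X \<in> Hom A X (omap t X)" using nat_trans_Hom[OF \<eta> X] by simp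
  show "amap p (\<eta> X) \<in> Hom (set_cat \<U>) (omap p X) (omap q X)"
    using functor_Hom[OF p \<eta>X] by simp
  show "counit (k_comonad \<U> C) (omap p (omap t X)) \<cdot>\<^bsub>set_cat \<U>\<^esub> \<kappa> X
      \<in> Hom (set_cat \<U>) (omap p X) (omap q X)"
    using set_cat.Cmp_Hom[OF \<kappa>_Hom[OF X] counit_k_Hom[OF qX]] by simp
  fix z assume z: "z \<in> omap p X"
  obtain c f where c: "c \<in> Obj C" "f \<in> Hom A (a c) X" "z = ap (amap p f) (u c)"
    using generic[OF X z] by blast
  have \<eta>c: "\<eta> (a c) \<in> Hom A (a c) (omap t (a c))" using nat_trans_Hom[OF \<eta> a_Obj[OF c(1)]] by simp
  have "ap (counit (k_comonad \<U> C) (omap q X)) (ap (\<kappa> X) z)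
      = ap (amap p (amap t f)) (ap (amap p (\<eta> (a c))) (u c))"
    unfolding c(3) \<kappa>_ap[OF c(1,2)] counit_k[OF qX c(1) \<kappa>_type[OF c(1,2)]]
    using c(1) by (simp add: \<psi>_def H_Ide)
  also have "\<dots> = ap (amap p (amap t f \<cdot>\<^bsub>A\<^esub> \<eta> (a c))) (u c)"
    by (rule functor_ap_Cmp[OF p \<eta>c functor_Hom[OF t c(2)] u_in[OF c(1)], symmetric])
  also have "amap t f \<cdot>\<^bsub>A\<^esub> \<eta> (a c) = \<eta> X \<cdot>\<^bsub>A\<^esub> f"
    using nat_trans_natural[OF \<eta>, of f] c(2) by (simp add: Hom_def)
  also have "ap (amap p (\<eta> X \<cdot>\<^bsub>A\<^esub> f)) (u c) = ap (amap p (\<eta> X)) z"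
    unfolding c(3) by (rule functor_ap_Cmp[OF p c(2) \<eta>X u_in[OF c(1)]])
  finally show "ap (counit (k_comonad \<U> C) (omap p (omap t X)) \<cdot>\<^bsub>set_cat \<U>\<^esub> \<kappa> X) z = ap (amap p (\<eta> X)) z"
    using ap_Cmp[OF \<kappa>_Hom[OF X] z] by simp
qed

text \<open>Both sides are families indexed by an arrow g out of c and an arrow g' out of the
  codomain of g. At such a pair the left side holds the composite of g and g' in the category, the
  right side the Kleisli composite formed with \<open>\<mu>\<close>; \<open>H_Cmp\<close> says that
  these agree.\<close>

lemma comult_\<kappa>:
  assumes X: "X \<in> Obj A"
  shows "comult (k_comonad \<U> C) (omap p (omap t X)) \<cdot>\<^bsub>set_cat \<U>\<^esub> \<kappa> X =
    amap K (amap K (amap p (\<mu> X))) \<cdot>\<^bsub>set_cat \<U>\<^esub> amap K (\<kappa> (omap t X)) \<cdot>\<^bsub>set_cat \<U>\<^esub> \<kappa> X"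
proof (rule set_cat_eqI)
  have tX: "omap t X \<in> Obj A" and qX: "omap q X \<in> \<U>"
    using functor_simps(3)[OF t X] functor_simps(3)[OF q X] by auto
  have \<mu>X: "\<mu> X \<in> Hom A (omap t (omap t X)) (omap t X)" using nat_trans_Hom[OF \<mu> X] by simp
  note p\<mu> = functor_Hom[OF p \<mu>X] note K\<mu> = amap_poly_Hom[OF p\<mu>]
  have \<kappa>t: "\<kappa> (omap t X) \<in> Hom (set_cat \<U>) (omap q X) (Kob (omap p (omap t (omap t X))))"
    using \<kappa>_Hom[OF tX] by simp
  note K\<kappa> = amap_poly_Hom[OF \<kappa>t]
  show "comult (k_comonad \<U> C) (omap p (omap t X)) \<cdot>\<^bsub>set_cat \<U>\<^esub> \<kappa> X
      \<in> Hom (set_cat \<U>) (omap p X) (Kob (Kob (omap q X)))"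
    using set_cat.Cmp_Hom[OF \<kappa>_Hom[OF X] comult_k_Hom[OF qX]] by simp
  show "amap K (amap K (amap p (\<mu> X))) \<cdot>\<^bsub>set_cat \<U>\<^esub> amap K (\<kappa> (omap t X)) \<cdot>\<^bsub>set_cat \<U>\<^esub> \<kappa> X
      \<in> Hom (set_cat \<U>) (omap p X) (Kob (Kob (omap q X)))"
    using set_cat.Cmp_Hom[OF set_cat.Cmp_Hom[OF \<kappa>_Hom[OF X] K\<kappa>] amap_poly_Hom[OF K\<mu>]] by simp
  fix z assume z: "z \<in> omap p X"
  obtain c f where c: "c \<in> Obj C" "f \<in> Hom A (a c) X" "z = ap (amap p f) (u c)"
    using generic[OF X z] by blast
  note tf = functor_Hom[OF t c(2)] note ttf = functor_Hom[OF t tf]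
  let ?\<phi> = "\<lambda>g\<in>out_arrs C c. ap (amap q f) (\<psi> g)"
  note \<phi> = \<kappa>_type[OF c(1,2)]
  have step: "ap (amap K (amap p (\<mu> X))) (ap (\<kappa> (omap t X)) (ap (amap q f) (\<psi> g)))
      = cd (omap q X) (Cod C g) (\<lambda>g'\<in>out_arrs C (Cod C g). ap (amap q f) (\<psi> (g' \<cdot>\<^bsub>C\<^esub> g)))"
    if "g \<in> out_arrs C c" for g
  proof -
    let ?d = "Cod C g"
    have g: "g \<in> Hom C c ?d" and d: "?d \<in> Obj C" using that by (auto simp: Hom_def)
    note Hg = H_Hom[OF g] note h = A.Cmp_Hom[OF Hg tf]
    let ?h = "amap t f \<cdot>\<^bsub>A\<^esub> H g"
    \<comment> \<open>\<open>\<kappa>_ap\<close> evaluates \<open>\<kappa>\<close> only at an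
      element presented by a map out of some a d. Here the map is \<open>?h\<close>, that is t f
      after the Kleisli map of \<open>g\<close>.\<close>
    have "ap (amap q f) (\<psi> g) = ap (amap p ?h) (u ?d)"
      using functor_ap_Cmp[OF p Hg tf u_in[OF d]] by (simp add: \<psi>_def)
    then have "ap (\<kappa> (omap t X)) (ap (amap q f) (\<psi> g))
        = cd (omap q (omap t X)) ?d (\<lambda>g'\<in>out_arrs C ?d. ap (amap q ?h) (\<psi> g'))"
      using \<kappa>_ap[OF d h] by simp
    then have "ap (amap K (amap p (\<mu> X))) (ap (\<kappa> (omap t X)) (ap (amap q f) (\<psi> g)))
        = cd (omap q X) ?d (\<lambda>g'\<in>out_arrs C ?d. ap (amap p (\<mu> X)) (ap (amap q ?h) (\<psi> g')))"
      using amap_poly[OF p\<mu> d, of "\<lambda>g'\<in>out_arrs C ?d. ap (amap q ?h) (\<psi> g')"] \<kappa>_type[OF d h]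
      by (simp cong: restrict_cong)
    also have "\<dots> = cd (omap q X) ?d (\<lambda>g'\<in>out_arrs C ?d. ap (amap q f) (\<psi> (g' \<cdot>\<^bsub>C\<^esub> g)))"
    proof (intro arg_cong[where f = "cd _ _"] restrict_ext)
      fix g' assume "g' \<in> out_arrs C ?d"
      then have g': "g' \<in> Hom C ?d (Cod C g')" and e: "Cod C g' \<in> Obj C"
        and cod: "Cod C (g' \<cdot>\<^bsub>C\<^esub> g) = Cod C g'" using that by (auto simp: Hom_def)
      note Hg' = H_Hom[OF g'] note th = functor_Hom[OF t h] note tHg = functor_Hom[OF t Hg]
      have \<mu>c: "\<mu> (a c) \<in> Hom A (omap t (omap t (a c))) (omap t (a c))"
        using nat_trans_Hom[OF \<mu> a_Obj[OF c(1)]] by simp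
      note comp = A.Cmp_Hom[OF A.Cmp_Hom[OF Hg' tHg] \<mu>c]
      have nat: "amap t f \<cdot>\<^bsub>A\<^esub> \<mu> (a c) = \<mu> X \<cdot>\<^bsub>A\<^esub> amap t (amap t f)"
        using nat_trans_natural[OF \<mu>, of f] c(2) by (simp add: Hom_def)
      \<comment> \<open>\<open>H_Cmp\<close> introduces \<open>\<mu>\<close> at a c. Naturality
        exchanges it for \<open>\<mu>\<close> at X, after which the images of f and of
        \<open>H g\<close> fuse into t applied to \<open>?h\<close>.\<close>
      have "ap (amap q f) (\<psi> (g' \<cdot>\<^bsub>C\<^esub> g))
          = ap (amap p (amap t f)) (ap (amap p (\<mu> (a c) \<cdot>\<^bsub>A\<^esub> (amap t (H g) \<cdot>\<^bsub>A\<^esub> H g'))) (u (Cod C g')))"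
        by (simp add: \<psi>_def H_Cmp[OF g g'] cod)
      also have "\<dots> = ap (amap p (amap t f \<cdot>\<^bsub>A\<^esub> (\<mu> (a c) \<cdot>\<^bsub>A\<^esub> (amap t (H g) \<cdot>\<^bsub>A\<^esub> H g')))) (u (Cod C g'))"
        by (rule functor_ap_Cmp[OF p comp tf u_in[OF e], symmetric])
      also have "amap t f \<cdot>\<^bsub>A\<^esub> (\<mu> (a c) \<cdot>\<^bsub>A\<^esub> (amap t (H g) \<cdot>\<^bsub>A\<^esub> H g'))
          = (amap t f \<cdot>\<^bsub>A\<^esub> \<mu> (a c)) \<cdot>\<^bsub>A\<^esub> (amap t (H g) \<cdot>\<^bsub>A\<^esub> H g')"
        by (rule A.Cmp_assoc[OF A.Cmp_Hom[OF Hg' tHg] \<mu>c tf, symmetric])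
      also have "\<dots> = \<mu> X \<cdot>\<^bsub>A\<^esub> (amap t (amap t f) \<cdot>\<^bsub>A\<^esub> (amap t (H g) \<cdot>\<^bsub>A\<^esub> H g'))"
        unfolding nat by (rule A.Cmp_assoc[OF A.Cmp_Hom[OF Hg' tHg] ttf \<mu>X])
      also have "amap t (amap t f) \<cdot>\<^bsub>A\<^esub> (amap t (H g) \<cdot>\<^bsub>A\<^esub> H g')
          = (amap t (amap t f) \<cdot>\<^bsub>A\<^esub> amap t (H g)) \<cdot>\<^bsub>A\<^esub> H g'"
        by (rule A.Cmp_assoc[OF Hg' tHg ttf, symmetric])
      also have "amap t (amap t f) \<cdot>\<^bsub>A\<^esub> amap t (H g) = amap t ?h"
        using functor_Cmp[OF t, of "H g" "amap t f"] Hg tf by (simp add: Hom_def)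
      also have "ap (amap p (\<mu> X \<cdot>\<^bsub>A\<^esub> (amap t ?h \<cdot>\<^bsub>A\<^esub> H g'))) (u (Cod C g'))
          = ap (amap p (\<mu> X)) (ap (amap p (amap t ?h \<cdot>\<^bsub>A\<^esub> H g')) (u (Cod C g')))"
        by (rule functor_ap_Cmp[OF p A.Cmp_Hom[OF Hg' th] \<mu>X u_in[OF e]])
      also have "ap (amap p (amap t ?h \<cdot>\<^bsub>A\<^esub> H g')) (u (Cod C g'))
          = ap (amap p (amap t ?h)) (ap (amap p (H g')) (u (Cod C g')))"
        by (rule functor_ap_Cmp[OF p Hg' th u_in[OF e]])
      finally show "ap (amap p (\<mu> X)) (ap (amap q ?h) (\<psi> g')) = ap (amap q f) (\<psi> (g' \<cdot>\<^bsub>C\<^esub> g))"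
        by (simp add: \<psi>_def)
    qed
    finally show ?thesis .
  qed
  have zz: "ap (\<kappa> X) z = cd (omap q X) c ?\<phi>" "cd (omap q X) c ?\<phi> \<in> Kob (omap q X)"
    unfolding c(3) \<kappa>_ap[OF c(1,2)] by (simp, rule cd_in[OF c(1) \<phi>])
  have t1: "(\<lambda>g\<in>out_arrs C c. ap (\<kappa> (omap t X)) (?\<phi> g))
      \<in> out_arrs C c \<rightarrow>\<^sub>E Kob (omap p (omap t (omap t X)))"
  proof (rule restrict_PiE_iff[THEN iffD2], rule ballI)
    fix g assume "g \<in> out_arrs C c"
    then show "ap (\<kappa> (omap t X)) (?\<phi> g) \<in> Kob (omap p (omap t (omap t X)))"
      by (intro ap_in[OF \<kappa>t] PiE_mem[OF \<phi>])
  qed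
  have "ap (amap K (amap K (amap p (\<mu> X)))) (ap (amap K (\<kappa> (omap t X))) (cd (omap q X) c ?\<phi>))
      = ap (amap K (amap K (amap p (\<mu> X))))
        (cd (Kob (omap p (omap t (omap t X)))) c (\<lambda>g\<in>out_arrs C c. ap (\<kappa> (omap t X)) (?\<phi> g)))"
    unfolding amap_poly[OF \<kappa>t c(1) \<phi>] ..
  also have "\<dots> = cd (Kob (omap q X)) c
      (\<lambda>g\<in>out_arrs C c. ap (amap K (amap p (\<mu> X))) ((\<lambda>g\<in>out_arrs C c. ap (\<kappa> (omap t X)) (?\<phi> g)) g))"
    using amap_poly[OF K\<mu> c(1) t1] by simp
  also have "\<dots> = cd (Kob (omap q X)) c (\<lambda>g\<in>out_arrs C c. cd (omap q X) (Cod C g)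
      (\<lambda>g'\<in>out_arrs C (Cod C g). ?\<phi> (g' \<cdot>\<^bsub>C\<^esub> g)))"
  proof (intro arg_cong[where f = "cd _ _"] restrict_ext)
    fix g assume g: "g \<in> out_arrs C c"
    have "(\<lambda>g'\<in>out_arrs C (Cod C g). ?\<phi> (g' \<cdot>\<^bsub>C\<^esub> g))
        = (\<lambda>g'\<in>out_arrs C (Cod C g). ap (amap q f) (\<psi> (g' \<cdot>\<^bsub>C\<^esub> g)))"
      using g by (intro restrict_ext) simp
    then show "ap (amap K (amap p (\<mu> X))) ((\<lambda>g\<in>out_arrs C c. ap (\<kappa> (omap t X)) (?\<phi> g)) g)
        = cd (omap q X) (Cod C g) (\<lambda>g'\<in>out_arrs C (Cod C g). ?\<phi> (g' \<cdot>\<^bsub>C\<^esub> g))"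
      using step[OF g] g by simp
  qed
  also have "\<dots> = ap (comult (k_comonad \<U> C) (omap q X)) (cd (omap q X) c ?\<phi>)"
    using comult_k[OF qX c(1) \<phi>] by simp
  finally show "ap (comult (k_comonad \<U> C) (omap p (omap t X)) \<cdot>\<^bsub>set_cat \<U>\<^esub> \<kappa> X) z =
    ap (amap K (amap K (amap p (\<mu> X))) \<cdot>\<^bsub>set_cat \<U>\<^esub> amap K (\<kappa> (omap t X)) \<cdot>\<^bsub>set_cat \<U>\<^esub> \<kappa> X) z"
    using ap_Cmp[OF \<kappa>_Hom[OF X] z] zz ap_Cmp[OF K\<kappa>, of _ ] set_cat.Cmp_Hom[OF \<kappa>_Hom[OF X] K\<kappa>]
    by (simp add: ap_Cmp[OF set_cat.Cmp_Hom[OF \<kappa>_Hom[OF X]]] z)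
qed

lemma lan_comonad_k:
  assumes "is_lan A (set_cat \<U>) (set_cat \<U>) p (p \<circ>\<^sub>F t) L \<alpha>"
  shows "comonad_iso (set_cat \<U>) (lan_comonad A (set_cat \<U>) p t \<eta> \<mu> L \<alpha>) (k_comonad \<U> C)"
    and "\<exists>\<theta>. nat_iso (set_cat \<U>) (set_cat \<U>) L K \<theta>"
  using lan_comonad_iso[OF t \<eta> \<mu> is_comonad_k, of p \<kappa> L \<alpha>] is_lan_K assms
    counit_\<kappa> comult_\<kappa> by simp_all

end

section \<open>Small sets\<close>

context
  fixes \<U> :: "'u set set"
  assumes \<U>: "set_universe \<U>"
begin

lemma small_lepoll:
  assumes "small \<U> S" "T \<lesssim> S"
  shows "small \<U> T"
  using assms lepoll_trans unfolding small_def by blast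

lemma small_mem: "small \<U> S \<Longrightarrow> S \<in> \<U>" for S :: "'u set"
  using \<U> by (simp add: set_universe_def)

lemma mem_small: "S \<in> \<U> \<Longrightarrow> small \<U> S"
  unfolding small_def by (meson lepoll_refl)

lemma smallE:
  assumes "small \<U> S"
  obtains B f where "B \<in> \<U>" "inj_on f S" "f ` S \<subseteq> B"
  using assms by (auto simp: small_def lepoll_def)

lemma small_inj_on:
  assumes "small \<U> T" "inj_on f S" "f ` S \<subseteq> T"
  shows "small \<U> S"
  using assms small_lepoll unfolding lepoll_def by blast

lemma small_subset: "small \<U> T \<Longrightarrow> S \<subseteq> T \<Longrightarrow> small \<U> S"
  by (rule small_inj_on[of T "\<lambda>x. x"]) auto

lemma small_countable: "countable S \<Longrightarrow> small \<U> S"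
  using \<U> by (intro small_inj_on[of "UNIV :: nat set" "to_nat_on S"]) (auto simp: set_universe_def)

lemma small_nat_fun:
  assumes "small \<U> S"
  shows "small \<U> ((UNIV :: nat set) \<rightarrow> S)"
proof -
  obtain B f where B: "B \<in> \<U>" and f: "inj_on f S" "f ` S \<subseteq> B"
    by (rule smallE[OF assms])
  show ?thesis
  proof (rule small_inj_on[of "UNIV \<rightarrow> B" "\<lambda>g. f \<circ> g"])
    show "small \<U> ((UNIV :: nat set) \<rightarrow> B)" using B \<U> by (simp add: set_universe_def)
    show "inj_on ((\<circ>) f) ((UNIV :: nat set) \<rightarrow> S)"
      using f(1) by (auto simp: inj_on_def fun_eq_iff Pi_iff)
    show "(\<circ>) f ` ((UNIV :: nat set) \<rightarrow> S) \<subseteq> UNIV \<rightarrow> B" using f(2) by (auto simp: Pi_iff)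
  qed
qed

lemma Union_mem:
  assumes "S \<in> \<U>" "T \<in> \<U>"
  shows "S \<union> T \<in> \<U>"
proof -
  \<comment> \<open>The available closure is under unions indexed by a member of the universe. An
    injection of the natural numbers supplies two distinct elements for a two-element index
    set.\<close>
  obtain f :: "nat \<Rightarrow> 'u" where "inj f"
    by (rule smallE[OF small_countable[of "UNIV :: nat set"]]) auto
  then have ne: "f 0 \<noteq> f 1" by (auto dest: injD)
  have U: "\<forall>I\<in>\<U>. \<forall>F. (\<forall>i\<in>I. F i \<in> \<U>) \<longrightarrow> (\<Union>i\<in>I. F i) \<in> \<U>"
    using \<U> by (simp add: set_universe_def)
  have "{f 0, f 1} \<in> \<U>" by (rule small_mem[OF small_countable]) auto
  from U[rule_format, OF this, of "\<lambda>i. if i = f 0 then S else T"] assms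
  have "(\<Union>i\<in>{f 0, f 1}. if i = f 0 then S else T) \<in> \<U>"
    by simp
  then show ?thesis using ne by simp
qed

lemma small_Times:
  assumes "small \<U> S" "small \<U> T"
  shows "small \<U> (S \<times> T)"
proof -
  obtain B f where B: "B \<in> \<U>" and f: "inj_on f S" "f ` S \<subseteq> B"
    by (rule smallE[OF assms(1)])
  obtain D g where D: "D \<in> \<U>" and g: "inj_on g T" "g ` T \<subseteq> D"
    by (rule smallE[OF assms(2)])
  \<comment> \<open>A pair is stored as a sequence, entry 0 holding one component and all other
    entries the other, so closure under sequences gives products.\<close>
  let ?h = "\<lambda>(s, t) n :: nat. if n = 0 then f s else g t"
  show ?thesis
  proof (rule small_inj_on[OF small_nat_fun[OF mem_small[OF Union_mem[OF B D]]]])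
    show "inj_on ?h (S \<times> T)"
    proof (rule inj_onI)
      fix x y assume *: "x \<in> S \<times> T" "y \<in> S \<times> T" "?h x = ?h y"
      from fun_cong[OF *(3), of 0] fun_cong[OF *(3), of 1] *(1,2) f(1) g(1)
      show "x = y" by (auto dest: inj_onD)
    qed
    show "?h ` (S \<times> T) \<subseteq> UNIV \<rightarrow> B \<union> D" using f(2) g(2) by (auto simp: image_subset_iff)
  qed
qed

text \<open>Choosing an injection for each fibre embeds the sum into the product of \<open>I\<close>
  with a single union of members of the universe.\<close>

lemma small_Sigma:
  assumes "small \<U> I" "\<And>i. i \<in> I \<Longrightarrow> small \<U> (A i)"
  shows "small \<U> (Sigma I A)"
proof -
  have "\<forall>i\<in>I. \<exists>B f. B \<in> \<U> \<and> inj_on f (A i) \<and> f ` A i \<subseteq> B"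
    using assms(2) unfolding small_def lepoll_def by blast
  then obtain B f where B: "\<And>i. i \<in> I \<Longrightarrow> B i \<in> \<U>"
    and f: "\<And>i. i \<in> I \<Longrightarrow> inj_on (f i) (A i)" "\<And>i. i \<in> I \<Longrightarrow> f i ` A i \<subseteq> B i"
    by metis
  obtain J e where J: "J \<in> \<U>" and e: "inj_on e I" "e ` I \<subseteq> J"
    by (rule smallE[OF assms(1)])
  \<comment> \<open>Unions may only be indexed by sets of elements of type \<open>'u\<close>, so
    \<open>I\<close> is replaced by its image before the union is formed.\<close>
  have "e ` I \<in> \<U>" by (rule small_mem[OF small_subset[OF mem_small[OF J] e(2)]])
  have U: "\<forall>I\<in>\<U>. \<forall>F. (\<forall>i\<in>I. F i \<in> \<U>) \<longrightarrow> (\<Union>i\<in>I. F i) \<in> \<U>"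
    using \<U> by (simp add: set_universe_def)
  from U[rule_format, OF \<open>e ` I \<in> \<U>\<close>, of "\<lambda>j. B (inv_into I e j)"]
  have "(\<Union>j\<in>e ` I. B (inv_into I e j)) \<in> \<U>"
    using B e(1) by fastforce
  moreover have "(\<Union>j\<in>e ` I. B (inv_into I e j)) = (\<Union>i\<in>I. B i)" using e(1) by auto
  ultimately have "small \<U> (I \<times> (\<Union>i\<in>I. B i))"
    using small_Times[OF assms(1) mem_small] by simp
  then show ?thesis
    by (rule small_inj_on[where f = "\<lambda>(i, x). (i, f i x)"])
      (use f in \<open>fastforce simp: inj_on_def\<close>)+
qed

text \<open>A function on \<open>A\<close> is determined by its composite with an enumeration of
  \<open>A\<close>, which is a sequence in \<open>X\<close>. The empty set has no enumeration and is
  treated apart: there is one function on it.\<close>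

lemma small_PiE:
  assumes "countable A" "small \<U> X"
  shows "small \<U> (A \<rightarrow>\<^sub>E X)"
proof (cases "A = {}")
  case True
  then show ?thesis by (simp add: small_countable)
next
  case False
  then have range: "range (from_nat_into A) = A" using assms(1) by (rule range_from_nat_into)
  show ?thesis
  proof (rule small_inj_on[OF small_nat_fun[OF assms(2)]])
    show "inj_on (\<lambda>g. g \<circ> from_nat_into A) (A \<rightarrow>\<^sub>E X)"
    proof (rule inj_onI)
      fix g h assume "g \<in> A \<rightarrow>\<^sub>E X" "h \<in> A \<rightarrow>\<^sub>E X" "g \<circ> from_nat_into A = h \<circ> from_nat_into A"
      then show "g = h"
        using range by (intro PiE_ext) (auto simp: fun_eq_iff, metis imageE)
    qed
    show "(\<lambda>g. g \<circ> from_nat_into A) ` (A \<rightarrow>\<^sub>E X) \<subseteq> UNIV \<rightarrow> X"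
      by (auto simp: PiE_iff from_nat_into[OF False])
  qed
qed

end

section \<open>Graphs, paths and the free-category monad\<close>

definition vm :: "'u graph_arr \<Rightarrow> 'u \<Rightarrow> 'u" where
  "vm f = fst (fst (snd f))"

definition em :: "'u graph_arr \<Rightarrow> 'u \<Rightarrow> 'u" where
  "em f = snd (fst (snd f))"

lemma vm_em [simp]: "vm (G, f, H) = fst f" "em (G, f, H) = snd f"
  by (simp_all add: vm_def em_def)

lemma graph_cat_simps [simp]:
  "Obj (graph_cat \<U>) = small_graphs \<U>"
  "Dom (graph_cat \<U>) (G, f, H) = G" "Cod (graph_cat \<U>) (G, f, H) = H"
  "Ide (graph_cat \<U>) G = (G, (\<lambda>v\<in>verts G. v, \<lambda>e\<in>arcs G. e), G)"
  "(G, f, H) \<in> Arr (graph_cat \<U>) \<longleftrightarrow>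
    G \<in> small_graphs \<U> \<and> H \<in> small_graphs \<U> \<and> f \<in> graph_homs G H"
  "(H', g, K) \<cdot>\<^bsub>graph_cat \<U>\<^esub> (G, f, H) = (G, graph_comp G g f, K)"
  by (simp_all add: graph_cat_def)

lemma graph_HomE:
  assumes "f \<in> Hom (graph_cat \<U>) G H"
  obtains h k where "f = (G, (h, k), H)" "G \<in> small_graphs \<U>" "H \<in> small_graphs \<U>"
    "h \<in> verts G \<rightarrow>\<^sub>E verts H" "k \<in> arcs G \<rightarrow>\<^sub>E arcs H"
    "\<And>e. e \<in> arcs G \<Longrightarrow> tail H (k e) = h (tail G e)"
    "\<And>e. e \<in> arcs G \<Longrightarrow> head H (k e) = h (head G e)"
  using assms by (cases f) (auto simp: Hom_def graph_homs_def)

lemma graph_HomI: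
  assumes "G \<in> small_graphs \<U>" "H \<in> small_graphs \<U>"
    and "h \<in> verts G \<rightarrow>\<^sub>E verts H" "k \<in> arcs G \<rightarrow>\<^sub>E arcs H"
    and "\<And>e. e \<in> arcs G \<Longrightarrow> tail H (k e) = h (tail G e)"
    and "\<And>e. e \<in> arcs G \<Longrightarrow> head H (k e) = h (head G e)"
  shows "(G, (h, k), H) \<in> Hom (graph_cat \<U>) G H"
  using assms by (auto simp: Hom_def graph_homs_def)

lemma graph_HomD:
  assumes "f \<in> Hom (graph_cat \<U>) G H"
  shows "G \<in> small_graphs \<U>" "H \<in> small_graphs \<U>" "v \<in> verts G \<Longrightarrow> vm f v \<in> verts H"
    "e \<in> arcs G \<Longrightarrow> em f e \<in> arcs H"
    "e \<in> arcs G \<Longrightarrow> tail H (em f e) = vm f (tail G e)"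
    "e \<in> arcs G \<Longrightarrow> head H (em f e) = vm f (head G e)"
    "vm f \<in> verts G \<rightarrow>\<^sub>E verts H" "em f \<in> arcs G \<rightarrow>\<^sub>E arcs H"
  using assms by (auto elim!: graph_HomE)

lemma graph_Hom_eq: "f \<in> Hom (graph_cat \<U>) G H \<Longrightarrow> f = (G, (vm f, em f), H)"
  by (auto elim!: graph_HomE)

lemma small_graphsD:
  assumes "G \<in> small_graphs \<U>"
  shows "wf_digraph G" "verts G \<in> \<U>" "arcs G \<in> \<U>"
    "e \<in> arcs G \<Longrightarrow> tail G e \<in> verts G" "e \<in> arcs G \<Longrightarrow> head G e \<in> verts G"
  using assms wf_digraph.tail_in_verts wf_digraph.head_in_verts by (auto simp: small_graphs_def)

lemma graph_eqI:
  assumes "f \<in> Hom (graph_cat \<U>) G H" "g \<in> Hom (graph_cat \<U>) G H"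
    and "\<And>v. v \<in> verts G \<Longrightarrow> vm f v = vm g v" "\<And>e. e \<in> arcs G \<Longrightarrow> em f e = em g e"
  shows "f = g"
proof -
  have "vm f = vm g" "em f = em g"
    using assms graph_HomD(7,8)[OF assms(1)] graph_HomD(7,8)[OF assms(2)] by (auto intro: PiE_ext)
  then show ?thesis using graph_Hom_eq[OF assms(1)] graph_Hom_eq[OF assms(2)] by metis
qed

lemma graph_Cmp_ap:
  assumes "f \<in> Hom (graph_cat \<U>) G H"
  shows "v \<in> verts G \<Longrightarrow> vm (g \<cdot>\<^bsub>graph_cat \<U>\<^esub> f) v = vm g (vm f v)"
    and "e \<in> arcs G \<Longrightarrow> em (g \<cdot>\<^bsub>graph_cat \<U>\<^esub> f) e = em g (em f e)"
  using assms by (cases g; auto elim!: graph_HomE simp: graph_comp_def compose_def)+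

lemma graph_Ide_ap:
  "v \<in> verts G \<Longrightarrow> vm (Ide (graph_cat \<U>) G) v = v" "e \<in> arcs G \<Longrightarrow> em (Ide (graph_cat \<U>) G) e = e"
  by auto

lemma category_graph_cat: "category (graph_cat \<U>)"
proof -
  have ide: "Ide (graph_cat \<U>) G \<in> Hom (graph_cat \<U>) G G" if "G \<in> small_graphs \<U>" for G
    using that small_graphsD[OF that] by (simp, intro graph_HomI) auto
  have cmp: "g \<cdot>\<^bsub>graph_cat \<U>\<^esub> f \<in> Hom (graph_cat \<U>) G K"
    if f: "f \<in> Hom (graph_cat \<U>) G H" and g: "g \<in> Hom (graph_cat \<U>) H K" for f g G H K
  proof -
    have "g \<cdot>\<^bsub>graph_cat \<U>\<^esub> f =
        (G, (\<lambda>v\<in>verts G. vm g (vm f v), \<lambda>e\<in>arcs G. em g (em f e)), K)"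
      by (subst graph_Hom_eq[OF f], subst graph_Hom_eq[OF g]) (simp add: graph_comp_def compose_def)
    also have "\<dots> \<in> Hom (graph_cat \<U>) G K"
      using graph_HomD[OF f] graph_HomD[OF g] small_graphsD(4,5)[OF graph_HomD(1)[OF f]]
      by (intro graph_HomI) simp_all
    finally show ?thesis .
  qed
  show ?thesis
  proof
    fix f G H assume f: "f \<in> Hom (graph_cat \<U>) G H"
    note GH = graph_HomD(1,2)[OF f]
    show "f \<cdot>\<^bsub>graph_cat \<U>\<^esub> Ide (graph_cat \<U>) G = f"
      by (rule graph_eqI[OF cmp[OF ide[OF GH(1)] f] f])
        (simp_all add: graph_Cmp_ap[OF ide[OF GH(1)]] del: graph_cat_simps, simp_all)
    show "Ide (graph_cat \<U>) H \<cdot>\<^bsub>graph_cat \<U>\<^esub> f = f"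
      by (rule graph_eqI[OF cmp[OF f ide[OF GH(2)]] f])
        (simp_all add: graph_Cmp_ap[OF f] graph_HomD[OF f] graph_Ide_ap del: graph_cat_simps)
  next
    fix f g h G H K L
    assume f: "f \<in> Hom (graph_cat \<U>) G H" and g: "g \<in> Hom (graph_cat \<U>) H K"
      and h: "h \<in> Hom (graph_cat \<U>) K L"
    show "(h \<cdot>\<^bsub>graph_cat \<U>\<^esub> g) \<cdot>\<^bsub>graph_cat \<U>\<^esub> f = h \<cdot>\<^bsub>graph_cat \<U>\<^esub> g \<cdot>\<^bsub>graph_cat \<U>\<^esub> f"
      by (rule graph_eqI[OF cmp[OF f cmp[OF g h]] cmp[OF cmp[OF f g] h]])
        (simp_all add: graph_Cmp_ap[OF f] graph_Cmp_ap[OF g] graph_Cmp_ap[OF cmp[OF f g]] graph_HomD[OF f])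
  next
    fix f assume "f \<in> Arr (graph_cat \<U>)"
    then show "Dom (graph_cat \<U>) f \<in> Obj (graph_cat \<U>)" "Cod (graph_cat \<U>) f \<in> Obj (graph_cat \<U>)"
      by (cases f; simp)+
  next
    fix G assume "G \<in> Obj (graph_cat \<U>)"
    then show "Ide (graph_cat \<U>) G \<in> Hom (graph_cat \<U>) G G"
      by (intro ide) simp
  qed (rule cmp)
qed

interpretation graph_cat: category "graph_cat \<U>" for \<U> :: "'u set set"
  by (rule category_graph_cat)

section \<open>Paths as arc walks\<close>

definition path_vertex :: "'u graph \<Rightarrow> 'u \<Rightarrow> 'u list \<Rightarrow> nat \<Rightarrow> 'u" where
  "path_vertex G v es i = (if i = 0 then v else head G (es ! (i - 1)))"

text \<open>\<open>cas\<close> consumes the edge list recursively, whereas a map out of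
  \<open>line n\<close> is indexed by position. This lemma connects the two, with
  \<open>path_vertex\<close> giving the vertices that \<open>mk_path\<close> stores.\<close>

lemma cas_iff:
  "pre_digraph.cas G u p v \<longleftrightarrow>
    (\<forall>i<length p. tail G (p ! i) = path_vertex G u p i) \<and> v = path_vertex G u p (length p)"
proof (induction p arbitrary: u)
  case Nil
  then show ?case by (auto simp: pre_digraph.cas.simps path_vertex_def)
next
  case (Cons e p)
  have "path_vertex G u (e # p) 0 = u" and "path_vertex G u (e # p) (Suc i) = path_vertex G (head G e) p i" for i
    by (cases i, simp_all add: path_vertex_def)
  then show ?case
    by (simp add: pre_digraph.cas.simps Cons.IH All_less_Suc2)
qed

lemma mk_path_source [simp]: "path_source (mk_path G u p) = u"
  by (simp add: mk_path_def)

lemma mk_path_edges [simp]: "path_edges (mk_path G u p) = p"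
  by (auto simp: mk_path_def simp del: upt_Suc intro!: nth_equalityI)

lemma mk_path_target: "pre_digraph.awalk G u p v \<Longrightarrow> path_target (mk_path G u p) = v"
  by (auto simp: pre_digraph.awalk_def mk_path_def cas_iff path_vertex_def)

lemma mk_path_in:
  assumes "wf_digraph G" "pre_digraph.awalk G u p v"
  shows "mk_path G u p \<in> path_set G"
proof -
  have "u \<in> verts G" "set p \<subseteq> arcs G" "\<And>i. i < length p \<Longrightarrow> tail G (p ! i) = path_vertex G u p i"
    using assms(2) by (auto simp: pre_digraph.awalk_def cas_iff)
  moreover from this have "i < length p \<Longrightarrow> head G (p ! i) \<in> verts G" for i
    using wf_digraph.head_in_verts[OF assms(1)] by (meson nth_mem subsetD)
  moreover from calculation(3)[of 0] have "Suc 0 \<le> length p \<Longrightarrow> tail G (p ! 0) = u"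
    by (simp add: path_vertex_def Suc_le_eq)
  ultimately show ?thesis
    by (auto simp: path_set_def mk_path_def graph_homs_def line_def path_vertex_def subset_iff)
qed

text \<open>With \<open>mk_path_in\<close> this identifies graph maps out of lines with walks, so
  that later arguments about paths become arguments about edge lists.\<close>

lemma path_set_walk:
  assumes "P \<in> path_set G"
  shows "pre_digraph.awalk G (path_source P) (path_edges P) (path_target P)"
    and "mk_path G (path_source P) (path_edges P) = P"
proof -
  obtain n h k where P: "P = (n, h, k)" and h: "h \<in> {0..n} \<rightarrow>\<^sub>E verts G" and k: "k \<in> {1..n} \<rightarrow>\<^sub>E arcs G"
    and e: "\<And>i. i \<in> {1..n} \<Longrightarrow> tail G (k i) = h (i - 1)" "\<And>i. i \<in> {1..n} \<Longrightarrow> head G (k i) = h i"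
    using assms by (auto simp: path_set_def graph_homs_def line_def)
  have nth: "map k [1..<Suc n] ! i = k (Suc i)" if "i < n" for i
    using that by (simp del: upt_Suc)
  \<comment> \<open>The vertices recomputed from the edge list are the original ones: position 0 is
    the given source, and a later position i is the head of edge i.\<close>
  have v: "path_vertex G (h 0) (map k [1..<Suc n]) i = h i" if "i \<le> n" for i
    using that by (auto simp: path_vertex_def nth e simp del: upt_Suc)
  show "pre_digraph.awalk G (path_source P) (path_edges P) (path_target P)"
    using h k by (auto simp: P pre_digraph.awalk_def cas_iff nth v e simp del: upt_Suc One_nat_def)
  show "mk_path G (path_source P) (path_edges P) = P"
  proof -
    have "(\<lambda>i\<in>{0..n}. path_vertex G (h 0) (map k [1..<Suc n]) i) = h"
      using h by (intro extensionalityI[of _ "{0..n}"]) (simp_all add: PiE_def v del: upt_Suc One_nat_def)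
    moreover have "(\<lambda>i\<in>{1..n}. map k [1..<Suc n] ! (i - 1)) = k"
      using k by (intro extensionalityI[of _ "{1..n}"]) (use nth[of "_ - 1"] in \<open>auto simp: PiE_def simp del: upt_Suc\<close>)
    ultimately show ?thesis
      by (simp add: P mk_path_def path_vertex_def[abs_def] del: upt_Suc)
  qed
qed

lemma path_setE:
  assumes "P \<in> path_set G"
  obtains u p v where "P = mk_path G u p" "pre_digraph.awalk G u p v"
  using path_set_walk[OF assms] by metis

lemma awalk_map:
  assumes f: "f \<in> Hom (graph_cat \<U>) G H" and p: "pre_digraph.awalk G u p v"
  shows "pre_digraph.awalk H (vm f u) (map (em f) p) (vm f v)"
proof -
  have "path_vertex H (vm f u) (map (em f) p) i = vm f (path_vertex G u p i)" if "i \<le> length p" for i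
    using that p graph_HomD(6)[OF f] by (auto simp: path_vertex_def pre_digraph.awalk_def subset_iff)
  then show ?thesis
    using p graph_HomD[OF f] by (auto simp: pre_digraph.awalk_def cas_iff subset_iff)
qed

lemma map_path_mk:
  assumes f: "f \<in> Hom (graph_cat \<U>) G H" and p: "pre_digraph.awalk G u p v"
  shows "map_path (vm f, em f) (mk_path G u p) = mk_path H (vm f u) (map (em f) p)"
proof -
  have "head H (em f (p ! i)) = vm f (head G (p ! i))" if "i < length p" for i
    using that p graph_HomD(6)[OF f] by (auto simp: pre_digraph.awalk_def subset_iff)
  then show ?thesis
    by (auto simp: map_path_def mk_path_def graph_comp_def line_def compose_def fun_eq_iff restrict_def)
qed

lemma map_path_in:
  assumes f: "f \<in> Hom (graph_cat \<U>) G H" and P: "P \<in> path_set G"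
  shows "map_path (vm f, em f) P \<in> path_set H"
proof -
  obtain u p v where p: "P = mk_path G u p" "pre_digraph.awalk G u p v" by (rule path_setE[OF P])
  show ?thesis
    unfolding p(1) map_path_mk[OF f p(2)]
    by (rule mk_path_in[OF small_graphsD(1)[OF graph_HomD(2)[OF f]] awalk_map[OF f p(2)]])
qed

lemma awalk_Cmp:
  assumes "f \<in> Hom (graph_cat \<U>) G H" "pre_digraph.awalk G u p v"
  shows "map (em (g \<cdot>\<^bsub>graph_cat \<U>\<^esub> f)) p = map (em g) (map (em f) p)"
    and "vm (g \<cdot>\<^bsub>graph_cat \<U>\<^esub> f) u = vm g (vm f u)"
  using assms graph_Cmp_ap[OF assms(1), where g = g] by (auto simp: pre_digraph.awalk_def subset_iff)

lemma awalk_Ide: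
  assumes "pre_digraph.awalk G u p v"
  shows "map (em (Ide (graph_cat \<U>) G)) p = p" "vm (Ide (graph_cat \<U>) G) u = u"
  using assms by (auto simp: pre_digraph.awalk_def intro!: map_idI)

section \<open>The functor of paths\<close>

locale universe =
  fixes \<U> :: "'u set set"
  assumes \<U>: "set_universe \<U>"
begin

abbreviation \<G> where "\<G> \<equiv> graph_cat \<U>"
abbreviation pc :: "'u graph \<Rightarrow> 'u \<Rightarrow> 'u list \<Rightarrow> 'u" where
  "pc G u p \<equiv> code \<U> (path_set G) (mk_path G u p)"

text \<open>Lines are finite, so paths embed into a countable sum of small function sets.\<close>

lemma small_path_set:
  assumes "G \<in> small_graphs \<U>"
  shows "small \<U> (path_set G)"
proof (rule small_subset[OF \<U>])
  show "small \<U> (SIGMA n:(UNIV :: nat set). ({0..n} \<rightarrow>\<^sub>E verts G) \<times> ({1..n} \<rightarrow>\<^sub>E arcs G))"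
    by (intro small_Sigma small_Times small_PiE small_countable[of _ "UNIV :: nat set"] \<U>
        mem_small[OF \<U>] small_graphsD[OF assms]) auto
  show "path_set G \<subseteq> (SIGMA n:UNIV. ({0..n} \<rightarrow>\<^sub>E verts G) \<times> ({1..n} \<rightarrow>\<^sub>E arcs G))"
    by (auto simp: path_set_def graph_homs_def line_def)
qed

lemma pc_in:
  "G \<in> small_graphs \<U> \<Longrightarrow> pre_digraph.awalk G u p v \<Longrightarrow> pc G u p \<in> realize \<U> (path_set G)"
  by (rule code_in[OF mk_path_in[OF small_graphsD(1)]])

lemma decode_pc:
  "G \<in> small_graphs \<U> \<Longrightarrow> pre_digraph.awalk G u p v \<Longrightarrow> decode \<U> (path_set G) (pc G u p) = mk_path G u p"
  by (rule decode_code[OF small_path_set \<U> mk_path_in[OF small_graphsD(1)]])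

lemma pcE:
  assumes "w \<in> realize \<U> (path_set G)"
  obtains u p v where "w = pc G u p" "pre_digraph.awalk G u p v"
  using assms by (auto elim!: realizeE path_setE)

lemma realize_map_pc:
  assumes "f \<in> Hom \<G> G H" "pre_digraph.awalk G u p v"
  shows "realize_map \<U> (path_set G) (path_set H) (map_path (vm f, em f)) (pc G u p)
    = pc H (vm f u) (map (em f) p)"
  using graph_HomD(1)[OF assms(1)]
  by (simp add: small_path_set \<U> mk_path_in[OF small_graphsD(1) assms(2)] map_path_mk[OF assms])

lemma paths_simps [simp]: "omap (paths \<U>) G = realize \<U> (path_set G)"
  by (simp add: paths_def)

lemma amap_paths:
  assumes f: "f \<in> Hom \<G> G H"
  shows "amap (paths \<U>) f = (realize \<U> (path_set G),
    realize_map \<U> (path_set G) (path_set H) (map_path (vm f, em f)), realize \<U> (path_set H))"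
  by (subst graph_Hom_eq[OF f]) (simp add: paths_def)

lemma ap_paths:
  assumes "f \<in> Hom \<G> G H" "pre_digraph.awalk G u p v"
  shows "ap (amap (paths \<U>) f) (pc G u p) = pc H (vm f u) (map (em f) p)"
  by (simp add: amap_paths[OF assms(1)] realize_map_pc[OF assms])

lemma is_functor_paths: "is_functor \<G> (set_cat \<U>) (paths \<U>)"
proof (rule functor_set_catI[OF category_graph_cat])
  fix G assume "G \<in> Obj \<G>"
  then show "omap (paths \<U>) G \<in> \<U>" by (simp add: small_path_set \<U>)
next
  fix f G H assume f: "f \<in> Hom \<G> G H"
  then show "amap (paths \<U>) f \<in> Hom (set_cat \<U>) (omap (paths \<U>) G) (omap (paths \<U>) H)"
    using graph_HomD(1,2)[OF f] map_path_in[OF f]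
    by (simp add: amap_paths small_path_set \<U> realize_map_type)
next
  fix G w assume G: "G \<in> Obj \<G>" and "w \<in> omap (paths \<U>) G"
  then obtain u p v where w: "w = pc G u p" "pre_digraph.awalk G u p v" by (auto elim: pcE)
  show "ap (amap (paths \<U>) (Ide \<G> G)) w = w"
    unfolding w(1) ap_paths[OF graph_cat.Ide_Hom[OF G] w(2)] awalk_Ide[OF w(2)] ..
next
  fix f g G H K w
  assume f: "f \<in> Hom \<G> G H" and g: "g \<in> Hom \<G> H K" and "w \<in> omap (paths \<U>) G"
  then obtain u p v where w: "w = pc G u p" "pre_digraph.awalk G u p v" by (auto elim: pcE)
  show "ap (amap (paths \<U>) (g \<cdot>\<^bsub>\<G>\<^esub> f)) w = ap (amap (paths \<U>) g) (ap (amap (paths \<U>) f) w)"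
    unfolding w(1) ap_paths[OF graph_cat.Cmp_Hom[OF f g] w(2)] ap_paths[OF f w(2)]
      ap_paths[OF g awalk_map[OF f w(2)]] awalk_Cmp[OF f w(2)] ..
qed

section \<open>The free-category functor\<close>

abbreviation F where "F \<equiv> frcat_graph \<U>"

lemma F_simps [simp]: "verts (F G) = verts G" "arcs (F G) = realize \<U> (path_set G)"
  by (simp_all add: frcat_graph_def)

lemma F_ends:
  assumes "G \<in> small_graphs \<U>" "pre_digraph.awalk G u p v"
  shows "tail (F G) (pc G u p) = u" "head (F G) (pc G u p) = v"
  using pc_in[OF assms] decode_pc[OF assms] mk_path_target[OF assms(2)]
  by (simp_all add: frcat_graph_def)

lemma F_small:
  assumes G: "G \<in> small_graphs \<U>"
  shows "F G \<in> small_graphs \<U>"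
proof -
  have "wf_digraph (F G)"
  proof
    fix w assume "w \<in> arcs (F G)"
    then obtain u p v where w: "w = pc G u p" "pre_digraph.awalk G u p v" by (auto elim: pcE)
    have "u \<in> verts G" "v \<in> verts G"
      using w(2) wf_digraph.awalk_hd_in_verts[OF small_graphsD(1)[OF G]]
        wf_digraph.awalk_last_in_verts[OF small_graphsD(1)[OF G]] by blast+
    then show "tail (F G) w \<in> verts (F G)" "head (F G) w \<in> verts (F G)"
      using F_ends[OF G w(2)] w(1) by auto
  qed
  then show ?thesis
    using G by (simp add: small_graphs_def small_path_set[OF G] \<U>) (simp add: frcat_graph_def)
qed

lemma omap_frcat [simp]: "omap (frcat \<U>) G = F G"
  by (simp add: frcat_def)

lemma amap_frcat:
  assumes f: "f \<in> Hom \<G> G H"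
  shows "amap (frcat \<U>) f =
    (F G, (vm f, realize_map \<U> (path_set G) (path_set H) (map_path (vm f, em f))), F H)"
  by (subst graph_Hom_eq[OF f]) (simp add: frcat_def)

lemma vm_frcat: "f \<in> Hom \<G> G H \<Longrightarrow> vm (amap (frcat \<U>) f) v = vm f v"
  by (simp add: amap_frcat)

lemma em_frcat:
  assumes "f \<in> Hom \<G> G H" "pre_digraph.awalk G u p v"
  shows "em (amap (frcat \<U>) f) (pc G u p) = pc H (vm f u) (map (em f) p)"
  by (simp add: amap_frcat[OF assms(1)] realize_map_pc[OF assms])

lemma frcat_Hom:
  assumes f: "f \<in> Hom \<G> G H"
  shows "amap (frcat \<U>) f \<in> Hom \<G> (F G) (F H)"
  unfolding amap_frcat[OF f]
proof (rule graph_HomI)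
  let ?r = "realize_map \<U> (path_set G) (path_set H) (map_path (vm f, em f))"
  show "?r \<in> arcs (F G) \<rightarrow>\<^sub>E arcs (F H)"
    using map_path_in[OF f] by (simp add: realize_map_type)
  fix w assume "w \<in> arcs (F G)"
  then obtain u p v where w: "w = pc G u p" "pre_digraph.awalk G u p v" by (auto elim: pcE)
  show "tail (F H) (?r w) = vm f (tail (F G) w)" "head (F H) (?r w) = vm f (head (F G) w)"
    using F_ends[OF graph_HomD(1)[OF f] w(2)] F_ends[OF graph_HomD(2)[OF f] awalk_map[OF f w(2)]]
    unfolding w(1) realize_map_pc[OF f w(2)] by simp_all
qed (use graph_HomD[OF f] F_small in auto)

lemma is_functor_frcat: "is_functor \<G> \<G> (frcat \<U>)"
proof -
  have hom: "amap (frcat \<U>) f \<in> Hom \<G> (F (Dom \<G> f)) (F (Cod \<G> f))" if "f \<in> Arr \<G>" for f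
    using that frcat_Hom[of f "Dom \<G> f" "Cod \<G> f"] by (simp add: Hom_def)
  have ide: "amap (frcat \<U>) (Ide \<G> G) = Ide \<G> (F G)" if G: "G \<in> Obj \<G>" for G
  proof -
    note i = graph_cat.Ide_Hom[OF G]
    have FG: "F G \<in> Obj \<G>" using G F_small by simp
    show ?thesis
    proof (rule graph_eqI[OF frcat_Hom[OF i] graph_cat.Ide_Hom[OF FG]])
      show "vm (amap (frcat \<U>) (Ide \<G> G)) v = vm (Ide \<G> (F G)) v" if "v \<in> verts (F G)" for v
        using that by (simp only: vm_frcat[OF i]) simp
      fix w assume w: "w \<in> arcs (F G)"
      then obtain u p v where p: "w = pc G u p" "pre_digraph.awalk G u p v" by (auto elim: pcE)
      have "em (amap (frcat \<U>) (Ide \<G> G)) w = w"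
        unfolding p(1) em_frcat[OF i p(2)] awalk_Ide[OF p(2)] ..
      with w show "em (amap (frcat \<U>) (Ide \<G> G)) w = em (Ide \<G> (F G)) w"
        by (simp only: graph_Ide_ap)
    qed
  qed
  have cmp: "amap (frcat \<U>) (g \<cdot>\<^bsub>\<G>\<^esub> f) = amap (frcat \<U>) g \<cdot>\<^bsub>\<G>\<^esub> amap (frcat \<U>) f"
    if f: "f \<in> Hom \<G> G H" and g: "g \<in> Hom \<G> H K" for f g G H K
  proof -
    note gf = graph_cat.Cmp_Hom[OF f g]
    show ?thesis
    proof (rule graph_eqI[OF frcat_Hom[OF gf] graph_cat.Cmp_Hom[OF frcat_Hom[OF f] frcat_Hom[OF g]]])
      fix v assume "v \<in> verts (F G)"
      then show "vm (amap (frcat \<U>) (g \<cdot>\<^bsub>\<G>\<^esub> f)) v = vm (amap (frcat \<U>) g \<cdot>\<^bsub>\<G>\<^esub> amap (frcat \<U>) f) v"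
        using graph_Cmp_ap(1)[OF f] graph_Cmp_ap(1)[OF frcat_Hom[OF f]]
        by (simp add: vm_frcat[OF f] vm_frcat[OF g] vm_frcat[OF gf])
    next
      fix w assume w: "w \<in> arcs (F G)"
      then obtain u p v where p: "w = pc G u p" "pre_digraph.awalk G u p v" by (auto elim: pcE)
      show "em (amap (frcat \<U>) (g \<cdot>\<^bsub>\<G>\<^esub> f)) w = em (amap (frcat \<U>) g \<cdot>\<^bsub>\<G>\<^esub> amap (frcat \<U>) f) w"
        unfolding graph_Cmp_ap(2)[OF frcat_Hom[OF f] w]
        unfolding p(1) em_frcat[OF gf p(2)] em_frcat[OF f p(2)] em_frcat[OF g awalk_map[OF f p(2)]]
          awalk_Cmp[OF f p(2)] ..
    qed
  qed
  show ?thesis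
    unfolding is_functor_def
  proof (intro conjI ballI impI)
    fix f g assume "f \<in> Arr \<G>" "g \<in> Arr \<G>" "Cod \<G> f = Dom \<G> g"
    then show "amap (frcat \<U>) (g \<cdot>\<^bsub>\<G>\<^esub> f) = amap (frcat \<U>) g \<cdot>\<^bsub>\<G>\<^esub> amap (frcat \<U>) f"
      by (intro cmp[of f "Dom \<G> f" "Cod \<G> f" g "Cod \<G> g"]) (simp_all add: Hom_def)
  qed (simp_all only: omap_frcat hom ide category_graph_cat graph_cat_simps(1) F_small)
qed

section \<open>Unit and multiplication of the free-category monad\<close>

lemma nat_trans_graphI:
  assumes S: "is_functor \<G> \<G> S" and T: "is_functor \<G> \<G> T"
    and "\<tau> \<in> extensional (small_graphs \<U>)"
    and hom: "\<And>G. G \<in> small_graphs \<U> \<Longrightarrow> \<tau> G \<in> Hom \<G> (omap S G) (omap T G)"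
    and nat: "\<And>f G H v. f \<in> Hom \<G> G H \<Longrightarrow> v \<in> verts (omap S G) \<Longrightarrow>
      vm (amap T f) (vm (\<tau> G) v) = vm (\<tau> H) (vm (amap S f) v)"
      "\<And>f G H e. f \<in> Hom \<G> G H \<Longrightarrow> e \<in> arcs (omap S G) \<Longrightarrow>
      em (amap T f) (em (\<tau> G) e) = em (\<tau> H) (em (amap S f) e)"
  shows "nat_trans \<G> \<G> S T \<tau>"
proof -
  have "amap T f \<cdot>\<^bsub>\<G>\<^esub> \<tau> (Dom \<G> f) = \<tau> (Cod \<G> f) \<cdot>\<^bsub>\<G>\<^esub> amap S f" if "f \<in> Arr \<G>" for f
  proof -
    have f: "f \<in> Hom \<G> (Dom \<G> f) (Cod \<G> f)" using that by (simp add: Hom_def)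
    note \<tau> = hom[OF graph_HomD(1)[OF f]] hom[OF graph_HomD(2)[OF f]]
    show ?thesis
      by (rule graph_eqI[OF graph_cat.Cmp_Hom[OF \<tau>(1) functor_Hom[OF T f]]
            graph_cat.Cmp_Hom[OF functor_Hom[OF S f] \<tau>(2)]])
        (simp_all add: graph_Cmp_ap[OF \<tau>(1)] graph_Cmp_ap[OF functor_Hom[OF S f]] nat[OF f])
  qed
  then show ?thesis using assms(1-4) by (auto simp: nat_trans_def)
qed

lemma awalk_singleton:
  "G \<in> small_graphs \<U> \<Longrightarrow> e \<in> arcs G \<Longrightarrow> pre_digraph.awalk G (tail G e) [e] (head G e)"
  by (auto simp: pre_digraph.awalk_def pre_digraph.cas.simps small_graphsD)

lemma nat_trans_unit: "nat_trans \<G> \<G> id_functor (frcat \<U>) (frcat_unit \<U>)"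
proof (rule nat_trans_graphI[OF is_functor_id[OF category_graph_cat] is_functor_frcat])
  show "frcat_unit \<U> \<in> extensional (small_graphs \<U>)" by (simp add: frcat_unit_def)
next
  fix G assume G: "G \<in> small_graphs \<U>"
  have "(G, (\<lambda>v\<in>verts G. v, \<lambda>e\<in>arcs G. pc G (tail G e) [e]), F G) \<in> Hom \<G> G (F G)"
    using G F_small pc_in[OF G awalk_singleton[OF G]] F_ends[OF G awalk_singleton[OF G]]
    by (intro graph_HomI) (auto simp: small_graphsD[OF G])
  with G show "frcat_unit \<U> G \<in> Hom \<G> (omap id_functor G) (omap (frcat \<U>) G)"
    by (simp add: frcat_unit_def)
next
  fix f G H e assume f: "f \<in> Hom \<G> G H" and "e \<in> arcs (omap id_functor G)"
  note GH = graph_HomD(1,2)[OF f]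
  from \<open>e \<in> _\<close> have e: "e \<in> arcs G" "em f e \<in> arcs H" using graph_HomD(4)[OF f] by auto
  then show "em (amap (frcat \<U>) f) (em (frcat_unit \<U> G) e) =
      em (frcat_unit \<U> H) (em (amap id_functor f) e)"
    using GH em_frcat[OF f awalk_singleton[OF GH(1) e(1)]] graph_HomD(5)[OF f e(1)]
    by (simp add: frcat_unit_def)
next
  fix f G H v assume f: "f \<in> Hom \<G> G H" and "v \<in> verts (omap id_functor G)"
  then show "vm (amap (frcat \<U>) f) (vm (frcat_unit \<U> G) v) =
      vm (frcat_unit \<U> H) (vm (amap id_functor f) v)"
    using graph_HomD[OF f] by (simp add: frcat_unit_def vm_frcat[OF f])
qed

text \<open>This is the edge list of \<open>concat_path\<close>, separated from the path encoding so
  that induction over lists is possible.\<close>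

definition flat :: "'u graph \<Rightarrow> 'u list \<Rightarrow> 'u list" where
  "flat G ps = concat (map (\<lambda>w. path_edges (decode \<U> (path_set G) w)) ps)"

text \<open>Induction along the outer walk: its first arc codes a walk in \<open>G\<close> that ends
  where the rest begins, so the two can be appended.\<close>

lemma awalk_flat:
  assumes G: "G \<in> small_graphs \<U>" and "pre_digraph.awalk (F G) u ps v"
  shows "pre_digraph.awalk G u (flat G ps) v"
  using assms(2)
proof (induction ps arbitrary: u)
  case Nil
  then show ?case by (auto simp: pre_digraph.awalk_def pre_digraph.cas.simps flat_def)
next
  case (Cons w ps)
  from Cons.prems have "w \<in> arcs (F G)"
    by (auto simp: wf_digraph.awalk_Cons_iff[OF small_graphsD(1)[OF F_small[OF G]]])
  then obtain x p y where w: "w = pc G x p" "pre_digraph.awalk G x p y" by (auto elim: pcE)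
  from Cons.prems have "u = x" "pre_digraph.awalk (F G) y ps v"
    using F_ends[OF G w(2)] w(1)
    by (auto simp: wf_digraph.awalk_Cons_iff[OF small_graphsD(1)[OF F_small[OF G]]])
  then show ?case
    using wf_digraph.awalk_appendI[OF small_graphsD(1)[OF G] w(2), of "flat G ps" v] Cons.IH[of y]
      decode_pc[OF G w(2)] w(1) by (simp add: flat_def)
qed

text \<open>Naturality of the multiplication on edge lists: a graph map acts on the path coded by an
  arc edge by edge, hence commutes with concatenation.\<close>

lemma map_flat:
  assumes f: "f \<in> Hom \<G> G H" and ps: "set ps \<subseteq> arcs (F G)"
  shows "map (em f) (flat G ps) = flat H (map (em (amap (frcat \<U>) f)) ps)"
  using ps
proof (induction ps)
  case Nil
  then show ?case by (simp add: flat_def)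
next
  case (Cons w ps)
  then obtain u p v where w: "w = pc G u p" "pre_digraph.awalk G u p v" by (auto elim: pcE)
  show ?case
    using Cons decode_pc[OF graph_HomD(1)[OF f] w(2)]
      decode_pc[OF graph_HomD(2)[OF f] awalk_map[OF f w(2)]] em_frcat[OF f w(2)] w(1)
    by (simp add: flat_def)
qed

lemma vm_mult: "G \<in> small_graphs \<U> \<Longrightarrow> v \<in> verts G \<Longrightarrow> vm (frcat_mult \<U> G) v = v"
  by (simp add: frcat_mult_def)

lemma em_mult:
  assumes G: "G \<in> small_graphs \<U>" and ps: "pre_digraph.awalk (F G) u ps v"
  shows "em (frcat_mult \<U> G) (pc (F G) u ps) = pc G u (flat G ps)"
  using G mk_path_in[OF small_graphsD(1)[OF F_small[OF G]] ps]
  by (simp add: frcat_mult_def small_path_set F_small \<U> concat_path_def flat_def)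

lemma mult_Hom:
  assumes G: "G \<in> small_graphs \<U>"
  shows "frcat_mult \<U> G \<in> Hom \<G> (F (F G)) (F G)"
proof -
  let ?r = "realize_map \<U> (path_set (F G)) (path_set G) (concat_path \<U> G)"
  have r: "?r (pc (F G) u ps) = pc G u (flat G ps)" if "pre_digraph.awalk (F G) u ps v" for u ps v
    using em_mult[OF G that] G by (simp add: frcat_mult_def)
  have "(F (F G), (\<lambda>v\<in>verts G. v, ?r), F G) \<in> Hom \<G> (F (F G)) (F G)"
  proof (rule graph_HomI)
    have "concat_path \<U> G P \<in> path_set G" if P: "P \<in> path_set (F G)" for P
    proof -
      obtain u p v where p: "P = mk_path (F G) u p" "pre_digraph.awalk (F G) u p v"
        by (rule path_setE[OF P])
      show ?thesis
        using mk_path_in[OF small_graphsD(1)[OF G] awalk_flat[OF G p(2)]] p(1)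
        by (simp add: concat_path_def flat_def)
    qed
    then show "?r \<in> arcs (F (F G)) \<rightarrow>\<^sub>E arcs (F G)" by (simp add: realize_map_type)
    fix w assume "w \<in> arcs (F (F G))"
    then obtain u p v where w: "w = pc (F G) u p" "pre_digraph.awalk (F G) u p v" by (auto elim: pcE)
    have "u \<in> verts G" "v \<in> verts G"
      using w(2) wf_digraph.awalk_hd_in_verts[OF small_graphsD(1)[OF F_small[OF G]]]
        wf_digraph.awalk_last_in_verts[OF small_graphsD(1)[OF F_small[OF G]]] by auto
    then show "tail (F G) (?r w) = (\<lambda>v\<in>verts G. v) (tail (F (F G)) w)"
      "head (F G) (?r w) = (\<lambda>v\<in>verts G. v) (head (F (F G)) w)"
      using F_ends[OF G awalk_flat[OF G w(2)]] F_ends[OF F_small[OF G] w(2)] r[OF w(2)] w(1) by auto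
  qed (use F_small G in auto)
  then show ?thesis using G by (simp add: frcat_mult_def)
qed

lemma nat_trans_mult: "nat_trans \<G> \<G> (frcat \<U> \<circ>\<^sub>F frcat \<U>) (frcat \<U>) (frcat_mult \<U>)"
proof (rule nat_trans_graphI[OF is_functor_comp[OF is_functor_frcat is_functor_frcat] is_functor_frcat])
  show "frcat_mult \<U> \<in> extensional (small_graphs \<U>)" by (simp add: frcat_mult_def)
next
  fix G assume "G \<in> small_graphs \<U>"
  then show "frcat_mult \<U> G \<in> Hom \<G> (omap (frcat \<U> \<circ>\<^sub>F frcat \<U>) G) (omap (frcat \<U>) G)"
    using mult_Hom by simp
next
  fix f G H v assume f: "f \<in> Hom \<G> G H" and "v \<in> verts (omap (frcat \<U> \<circ>\<^sub>F frcat \<U>) G)"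
  then show "vm (amap (frcat \<U>) f) (vm (frcat_mult \<U> G) v) =
      vm (frcat_mult \<U> H) (vm (amap (frcat \<U> \<circ>\<^sub>F frcat \<U>) f) v)"
    using graph_HomD[OF f] by (simp add: vm_mult vm_frcat[OF f] vm_frcat[OF frcat_Hom[OF f]])
next
  fix f G H w assume f: "f \<in> Hom \<G> G H" and "w \<in> arcs (omap (frcat \<U> \<circ>\<^sub>F frcat \<U>) G)"
  then obtain u p v where w: "w = pc (F G) u p" "pre_digraph.awalk (F G) u p v" by (auto elim: pcE)
  note GH = graph_HomD(1,2)[OF f] note Ff = frcat_Hom[OF f]
  have "set p \<subseteq> arcs (F G)" using w(2) by (auto simp: pre_digraph.awalk_def)
  then show "em (amap (frcat \<U>) f) (em (frcat_mult \<U> G) w) =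
      em (frcat_mult \<U> H) (em (amap (frcat \<U> \<circ>\<^sub>F frcat \<U>) f) w)"
    unfolding w(1) em_mult[OF GH(1) w(2)] em_frcat[OF f awalk_flat[OF GH(1) w(2)]]
      comp_functor_simps em_frcat[OF Ff w(2)] em_mult[OF GH(2) awalk_map[OF Ff w(2)]]
    by (simp add: map_flat[OF f] vm_frcat[OF f])
qed

end

section \<open>Transport of categories along injections\<close>

text \<open>Delta lives on numbers and triples, while \<open>corresponding_category\<close> asks for
  objects and arrows of type \<open>'u\<close>. The structure is therefore copied along injections,
  with operations computed on preimages.\<close>

definition transport_cat :: "('o \<Rightarrow> 'p) \<Rightarrow> ('a \<Rightarrow> 'b) \<Rightarrow> ('o, 'a) cat \<Rightarrow> ('p, 'b) cat" where
  "transport_cat \<phi> \<xi> C = \<lparr>Obj = \<phi> ` Obj C, Arr = \<xi> ` Arr C,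
     Dom = (\<lambda>f. \<phi> (Dom C (inv_into (Arr C) \<xi> f))),
     Cod = (\<lambda>f. \<phi> (Cod C (inv_into (Arr C) \<xi> f))),
     Ide = (\<lambda>X. \<xi> (Ide C (inv_into (Obj C) \<phi> X))),
     Cmp = (\<lambda>g f. \<xi> (inv_into (Arr C) \<xi> g \<cdot>\<^bsub>C\<^esub> inv_into (Arr C) \<xi> f))\<rparr>"

context category
begin

context
  fixes \<phi> :: "'o \<Rightarrow> 'p" and \<xi> :: "'a \<Rightarrow> 'b"
  assumes \<phi>: "inj_on \<phi> (Obj C)" and \<xi>: "inj_on \<xi> (Arr C)"
begin

lemma transport_simps:
  "Obj (transport_cat \<phi> \<xi> C) = \<phi> ` Obj C" "Arr (transport_cat \<phi> \<xi> C) = \<xi> ` Arr C"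
  "f \<in> Arr C \<Longrightarrow> Dom (transport_cat \<phi> \<xi> C) (\<xi> f) = \<phi> (Dom C f)"
  "f \<in> Arr C \<Longrightarrow> Cod (transport_cat \<phi> \<xi> C) (\<xi> f) = \<phi> (Cod C f)"
  "X \<in> Obj C \<Longrightarrow> Ide (transport_cat \<phi> \<xi> C) (\<phi> X) = \<xi> (Ide C X)"
  "f \<in> Arr C \<Longrightarrow> g \<in> Arr C \<Longrightarrow> \<xi> g \<cdot>\<^bsub>transport_cat \<phi> \<xi> C\<^esub> \<xi> f = \<xi> (g \<cdot> f)"
  using \<phi> \<xi> by (simp_all add: transport_cat_def)

lemma transport_HomE:
  assumes "h \<in> Hom (transport_cat \<phi> \<xi> C) A B"
  obtains f where "f \<in> Arr C" "h = \<xi> f" "A = \<phi> (Dom C f)" "B = \<phi> (Cod C f)"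
  using assms by (auto simp: Hom_def transport_simps)

lemma \<phi>_eq: "X \<in> Obj C \<Longrightarrow> Y \<in> Obj C \<Longrightarrow> \<phi> X = \<phi> Y \<longleftrightarrow> X = Y"
  using \<phi> by (auto dest: inj_onD)

lemma category_transport: "category (transport_cat \<phi> \<xi> C)"
proof
  fix f g X Y Z
  assume "f \<in> Hom (transport_cat \<phi> \<xi> C) X Y" "g \<in> Hom (transport_cat \<phi> \<xi> C) Y Z"
  then show "g \<cdot>\<^bsub>transport_cat \<phi> \<xi> C\<^esub> f \<in> Hom (transport_cat \<phi> \<xi> C) X Z"
    by (elim transport_HomE) (simp add: \<phi>_eq transport_simps Hom_def)
next
  fix f g h X Y Z W
  assume "f \<in> Hom (transport_cat \<phi> \<xi> C) X Y" "g \<in> Hom (transport_cat \<phi> \<xi> C) Y Z"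
    "h \<in> Hom (transport_cat \<phi> \<xi> C) Z W"
  then show "(h \<cdot>\<^bsub>transport_cat \<phi> \<xi> C\<^esub> g) \<cdot>\<^bsub>transport_cat \<phi> \<xi> C\<^esub> f =
      h \<cdot>\<^bsub>transport_cat \<phi> \<xi> C\<^esub> g \<cdot>\<^bsub>transport_cat \<phi> \<xi> C\<^esub> f"
    by (elim transport_HomE) (simp add: \<phi>_eq transport_simps assoc)
next
  fix f X Y assume "f \<in> Hom (transport_cat \<phi> \<xi> C) X Y"
  then show "f \<cdot>\<^bsub>transport_cat \<phi> \<xi> C\<^esub> Ide (transport_cat \<phi> \<xi> C) X = f"
    "Ide (transport_cat \<phi> \<xi> C) Y \<cdot>\<^bsub>transport_cat \<phi> \<xi> C\<^esub> f = f"
    by (auto elim!: transport_HomE simp: transport_simps)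
qed (auto simp: transport_simps Hom_def)

lemma iso_cat_transport: "iso_cat (transport_cat \<phi> \<xi> C) C"
proof -
  let ?F = "\<lparr>omap = inv_into (Obj C) \<phi>, amap = inv_into (Arr C) \<xi>\<rparr>"
  have "is_functor (transport_cat \<phi> \<xi> C) C ?F"
    using category_transport category_axioms
    by (auto simp: is_functor_def transport_simps Hom_def \<phi> \<xi> \<phi>_eq)
  moreover have "bij_betw (inv_into (Obj C) \<phi>) (\<phi> ` Obj C) (Obj C)"
    "bij_betw (inv_into (Arr C) \<xi>) (\<xi> ` Arr C) (Arr C)"
    using bij_betw_inv_into[OF inj_on_imp_bij_betw[OF \<phi>]] bij_betw_inv_into[OF inj_on_imp_bij_betw[OF \<xi>]]
    by auto
  ultimately show ?thesis
    unfolding iso_cat_def by (intro exI[of _ ?F]) (simp add: transport_simps)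
qed

end

end

section \<open>Kleisli maps between lines\<close>

lemma Delta_simps [simp]:
  "Obj Delta = UNIV" "Dom Delta (m, f, n) = m" "Cod Delta (m, f, n) = n"
  "Ide Delta n = (n, (\<lambda>i\<in>{0..n}. i), n)"
  "(m, f, n) \<in> Arr Delta \<longleftrightarrow> f \<in> {0..m} \<rightarrow>\<^sub>E {0..n} \<and> mono_on {0..m} f"
  "(n', g, k) \<cdot>\<^bsub>Delta\<^esub> (m, f, n) = (m, compose {0..m} g f, k)"
  by (simp_all add: Delta_def)

lemma Delta_HomE:
  assumes "a \<in> Hom Delta m n"
  obtains f where "a = (m, f, n)" "f \<in> {0..m} \<rightarrow>\<^sub>E {0..n}" "mono_on {0..m} f"
  using assms by (cases a) (auto simp: Hom_def)

lemma category_Delta: "category Delta"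
proof
  fix f g l m n
  assume "f \<in> Hom Delta l m" "g \<in> Hom Delta m n"
  then show "g \<cdot>\<^bsub>Delta\<^esub> f \<in> Hom Delta l n"
    by (elim Delta_HomE) (simp add: Hom_def compose_def, auto simp: mono_on_def PiE_iff)
next
  fix f m n assume "f \<in> Hom Delta m n"
  then show "f \<cdot>\<^bsub>Delta\<^esub> Ide Delta m = f" "Ide Delta n \<cdot>\<^bsub>Delta\<^esub> f = f"
    by (elim Delta_HomE, auto simp: compose_def fun_eq_iff PiE_iff extensional_def)+
next
  fix f g h k l m n
  assume "f \<in> Hom Delta k l" "g \<in> Hom Delta l m" "h \<in> Hom Delta m n"
  then show "(h \<cdot>\<^bsub>Delta\<^esub> g) \<cdot>\<^bsub>Delta\<^esub> f = h \<cdot>\<^bsub>Delta\<^esub> g \<cdot>\<^bsub>Delta\<^esub> f"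
    by (elim Delta_HomE) (auto simp: compose_def fun_eq_iff PiE_iff)
qed (auto simp: Hom_def mono_on_def)

text \<open>There are finitely many maps between two given finite ordinals. Countability makes the
  set of arrows small and, through \<open>small_PiE\<close>, also the function sets out of
  it.\<close>

lemma countable_Arr_Delta: "countable (Arr Delta)"
proof (rule countable_subset)
  show "Arr Delta \<subseteq> UNIV \<times> (\<Union>m. \<Union>n. {0..m} \<rightarrow>\<^sub>E {0..n}) \<times> UNIV"
    by clarsimp blast
  show "countable ((UNIV :: nat set) \<times> (\<Union>m. \<Union>n. {0..m::nat} \<rightarrow>\<^sub>E {0..n::nat}) \<times> (UNIV :: nat set))"
    by (intro countable_SIGMA countable_UN countableI_type countable_finite finite_PiE
        finite_atLeastAtMost)
qed

section \<open>Lines as graphs in the universe, and their walks\<close>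

context universe
begin

abbreviation nv :: "nat \<Rightarrow> 'u" where
  "nv \<equiv> code \<U> (UNIV :: nat set)"

abbreviation dn :: "'u \<Rightarrow> nat" where
  "dn \<equiv> decode \<U> (UNIV :: nat set)"

lemma small_nat: "small \<U> (UNIV :: nat set)"
  by (rule small_countable[OF \<U>]) auto

lemma dn_nv [simp]: "dn (nv i) = i"
  by (rule decode_code[OF small_nat \<U>]) simp

lemma nv_eq [simp]: "nv i = nv j \<longleftrightarrow> i = j"
  by (metis dn_nv)

text \<open>\<open>line n\<close> has natural numbers as vertices and edges and so is not an object
  of \<open>graph_cat\<close>. This is its copy along \<open>nv\<close>, with extensional incidence
  functions as \<open>small_graphs\<close> requires.\<close>

definition line_graph :: "nat \<Rightarrow> 'u graph" where
  "line_graph n = \<lparr>verts = nv ` {0..n}, arcs = nv ` {1..n},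
     tail = (\<lambda>e\<in>nv ` {1..n}. nv (dn e - 1)), head = (\<lambda>e\<in>nv ` {1..n}. e)\<rparr>"

lemma line_graph_simps [simp]:
  "verts (line_graph n) = nv ` {0..n}" "arcs (line_graph n) = nv ` {1..n}"
  "i \<in> {1..n} \<Longrightarrow> tail (line_graph n) (nv i) = nv (i - 1)" "i \<in> {1..n} \<Longrightarrow> head (line_graph n) (nv i) = nv i"
  by (simp_all add: line_graph_def)

lemma line_graph_small: "line_graph n \<in> small_graphs \<U>"
proof -
  have "wf_digraph (line_graph n)"
    by (unfold_locales) auto
  moreover have "nv ` {0..n} \<in> \<U>" "nv ` {1..n} \<in> \<U>"
    by (rule small_mem[OF \<U> small_countable[OF \<U>]], simp)+
  ultimately show ?thesis
    by (simp add: small_graphs_def) (simp add: line_graph_def)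
qed

text \<open>The full path through the line, which is the identity map up to the renaming
  \<open>nv\<close>. It gives the universal element of the representable functor on
  \<open>line_graph n\<close>.\<close>

definition line_path :: "nat \<Rightarrow> 'u gpath" where
  "line_path n = (n, (\<lambda>i\<in>{0..n}. nv i), (\<lambda>i\<in>{1..n}. nv i))"

definition line_elem :: "nat \<Rightarrow> 'u" where
  "line_elem n = code \<U> (path_set (line_graph n)) (line_path n)"

lemma line_path_in: "line_path n \<in> path_set (line_graph n)"
  by (auto simp: line_path_def path_set_def graph_homs_def line_def)

lemma ap_line_elem:
  assumes f: "f \<in> Hom \<G> (line_graph n) X"
  shows "ap (amap (paths \<U>) f) (line_elem n) = code \<U> (path_set X)
    (n, (\<lambda>i\<in>{0..n}. vm f (nv i)), (\<lambda>i\<in>{1..n}. em f (nv i)))"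
  using small_path_set[OF line_graph_small] line_path_in[of n]
  by (simp add: amap_paths[OF f] line_elem_def \<U>)
    (simp add: map_path_def line_path_def graph_comp_def line_def compose_def cong: restrict_cong)

text \<open>A path of length n already is a graph map out of \<open>line n\<close>; precomposing
  with the decoding \<open>dn\<close> makes it a map out of \<open>line_graph n\<close>.\<close>

lemma path_generic:
  assumes X: "X \<in> small_graphs \<U>" and "z \<in> omap (paths \<U>) X"
  shows "\<exists>n. \<exists>f\<in>Hom \<G> (line_graph n) X. ap (amap (paths \<U>) f) (line_elem n) = z"
proof -
  obtain n h k where z: "z = code \<U> (path_set X) (n, h, k)"
    and h: "h \<in> {0..n} \<rightarrow>\<^sub>E verts X" and k: "k \<in> {1..n} \<rightarrow>\<^sub>E arcs X"
    and e: "\<And>i. i \<in> {1..n} \<Longrightarrow> tail X (k i) = h (i - 1)" "\<And>i. i \<in> {1..n} \<Longrightarrow> head X (k i) = h i"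
    using assms(2) by (auto elim!: realizeE simp: path_set_def graph_homs_def line_def)
  let ?f = "(line_graph n, (\<lambda>v\<in>verts (line_graph n). h (dn v), \<lambda>e\<in>arcs (line_graph n). k (dn e)), X)"
  have f: "?f \<in> Hom \<G> (line_graph n) X"
    using h k e by (intro graph_HomI[OF line_graph_small X]) auto
  have "(\<lambda>i\<in>{0..n}. vm ?f (nv i)) = h" "(\<lambda>i\<in>{1..n}. em ?f (nv i)) = k"
    using h k by (auto simp: fun_eq_iff PiE_iff extensional_def)
  with ap_line_elem[OF f] z f show ?thesis by metis
qed

text \<open>The coded path contains its length and its vertex and edge functions. The length
  recovers the summand, the functions recover the map.\<close>

lemma path_generic_unique:
  assumes f: "f \<in> Hom \<G> (line_graph m) X" and g: "g \<in> Hom \<G> (line_graph n) X"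
    and eq: "ap (amap (paths \<U>) f) (line_elem m) = ap (amap (paths \<U>) g) (line_elem n)"
  shows "m = n \<and> f = g"
proof -
  have in_path: "(n, (\<lambda>i\<in>{0..n}. vm f (nv i)), (\<lambda>i\<in>{1..n}. em f (nv i))) \<in> path_set X"
    if "f \<in> Hom \<G> (line_graph n) X" for f n
    using graph_HomD(3-6)[OF that] by (auto simp: path_set_def graph_homs_def line_def)
  have *: "m = n" "(\<lambda>i\<in>{0..m}. vm f (nv i)) = (\<lambda>i\<in>{0..n}. vm g (nv i))"
    "(\<lambda>i\<in>{1..m}. em f (nv i)) = (\<lambda>i\<in>{1..n}. em g (nv i))"
    using eq code_eq_iff[OF small_path_set[OF graph_HomD(2)[OF f]] \<U> in_path[OF f] in_path[OF g]]
    unfolding ap_line_elem[OF f] ap_line_elem[OF g] by auto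
  have "vm f (nv i) = vm g (nv i)" if "i \<in> {0..m}" for i
    using fun_cong[OF *(2), of i] *(1) that by simp
  moreover have "em f (nv i) = em g (nv i)" if "i \<in> {1..m}" for i
    using fun_cong[OF *(3), of i] *(1) that by simp
  ultimately have "f = g"
    using g *(1) by (intro graph_eqI[OF f]) auto
  with * show ?thesis by simp
qed

text \<open>Edge i runs from i - 1 to i, so the edges between j and k are j + 1 up to k; the list is
  empty when j = k.\<close>

lemma awalk_line_graph:
  assumes "j \<le> k" "k \<le> n"
  shows "pre_digraph.awalk (line_graph n) (nv j) (map nv [Suc j..<Suc k]) (nv k)"
proof -
  have "path_vertex (line_graph n) (nv j) (map nv [Suc j..<Suc k]) i = nv (j + i)" if "i \<le> k - j" for i
    using that assms by (cases i) (auto simp: path_vertex_def simp del: upt_Suc)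
  then show ?thesis
    using assms by (auto simp: pre_digraph.awalk_def cas_iff simp del: upt_Suc)
qed

text \<open>A vertex j has at most one outgoing edge, and that edge leads to j + 1, so a walk is
  forced at each step and can only climb. The bound \<open>j \<le> k\<close> is the source of
  monotonicity in \<open>kleisli_map_bij\<close>.\<close>

lemma awalk_line_graphD:
  assumes "pre_digraph.awalk (line_graph n) (nv j) p v"
  shows "\<exists>k. j \<le> k \<and> k \<le> n \<and> v = nv k \<and> p = map nv [Suc j..<Suc k]"
  using assms
proof (induction p arbitrary: j)
  case Nil
  then have "j \<le> n \<and> v = nv j"
    by (auto simp: pre_digraph.awalk_def pre_digraph.cas.simps)
  then show ?case by (intro exI[of _ j]) simp
next
  case (Cons e p)
  note wf = small_graphsD(1)[OF line_graph_small]
  from Cons.prems have e: "e \<in> arcs (line_graph n)" "tail (line_graph n) e = nv j"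
    "pre_digraph.awalk (line_graph n) (head (line_graph n) e) p v"
    by (auto simp: wf_digraph.awalk_Cons_iff[OF wf])
  then obtain i where "e = nv i" "i \<in> {1..n}" by auto
  \<comment> \<open>The tail of edge i is i - 1. Since edges are numbered from 1, the truncated
    subtraction loses nothing and i must be \<open>Suc j\<close>.\<close>
  with e have i: "e = nv (Suc j)" "Suc j \<le> n" by auto
  with e have "pre_digraph.awalk (line_graph n) (nv (Suc j)) p v" by simp
  from Cons.IH[OF this] obtain k where k: "Suc j \<le> k" "k \<le> n" "v = nv k" "p = map nv [Suc (Suc j)..<Suc k]"
    by auto
  have "[Suc j..<Suc k] = Suc j # [Suc (Suc j)..<Suc k]"
    using k(1) by (simp add: upt_conv_Cons del: upt_Suc)
  with k i show ?case by (intro exI[of _ k]) simp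
qed

text \<open>The free category on a line is a poset. This lets all equations between Kleisli maps
  into lines be checked on vertices alone.\<close>

lemma awalk_line_graph_unique:
  assumes "pre_digraph.awalk (line_graph n) u p v" "pre_digraph.awalk (line_graph n) u p' v"
  shows "p = p'"
proof -
  obtain j where j: "u = nv j"
    using assms(1) by (auto simp: pre_digraph.awalk_def)
  show ?thesis
    using awalk_line_graphD[OF assms(1)[unfolded j]] awalk_line_graphD[OF assms(2)[unfolded j]] by auto
qed

text \<open>The image of an arc is a path of \<open>line_graph n\<close>, hence determined by its endpoints.\<close>

lemma Hom_F_line_graph_eqI:
  assumes f: "f \<in> Hom \<G> X (F (line_graph n))" and g: "g \<in> Hom \<G> X (F (line_graph n))"
    and v: "\<And>v. v \<in> verts X \<Longrightarrow> vm f v = vm g v"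
  shows "f = g"
proof (rule graph_eqI[OF f g v])
  fix e assume e: "e \<in> arcs X"
  obtain u p w where p: "em f e = pc (line_graph n) u p" "pre_digraph.awalk (line_graph n) u p w"
    using graph_HomD(4)[OF f e] by (auto elim: pcE)
  obtain u' p' w' where p': "em g e = pc (line_graph n) u' p'" "pre_digraph.awalk (line_graph n) u' p' w'"
    using graph_HomD(4)[OF g e] by (auto elim: pcE)
  have "tail X e \<in> verts X" "head X e \<in> verts X"
    using small_graphsD(4,5)[OF graph_HomD(1)[OF f] e] by auto
  then have "u = u'" "w = w'"
    using F_ends[OF line_graph_small p(2)] F_ends[OF line_graph_small p'(2)] p(1) p'(1) v
      graph_HomD(5,6)[OF f e] graph_HomD(5,6)[OF g e] by auto
  then show "em f e = em g e"
    using awalk_line_graph_unique[of n u p w p'] p p' by simp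
qed

text \<open>Edge i goes to the walk from f (i - 1) to f i, the only one available. It is empty where
  f is constant and longer than one edge where f skips values, so degeneracies and faces are both
  covered.\<close>

definition kleisli_map :: "nat \<times> (nat \<Rightarrow> nat) \<times> nat \<Rightarrow> 'u graph_arr" where
  "kleisli_map = (\<lambda>(m, f, n). (line_graph m,
     (\<lambda>v\<in>verts (line_graph m). nv (f (dn v)),
      \<lambda>e\<in>arcs (line_graph m). pc (line_graph n) (nv (f (dn e - 1))) (map nv [Suc (f (dn e - 1))..<Suc (f (dn e))])),
     F (line_graph n)))"

lemma vm_kleisli_map: "i \<le> m \<Longrightarrow> vm (kleisli_map (m, f, n)) (nv i) = nv (f i)"
  by (simp add: kleisli_map_def)

lemma kleisli_map_Hom:
  assumes "(m, f, n) \<in> Arr Delta"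
  shows "kleisli_map (m, f, n) \<in> Hom \<G> (line_graph m) (F (line_graph n))"
proof -
  have f: "f i \<le> n" if "i \<le> m" for i using assms that by (auto simp: PiE_iff)
  have w: "pre_digraph.awalk (line_graph n) (nv (f (i - 1))) (map nv [Suc (f (i - 1))..<Suc (f i)]) (nv (f i))"
    if "i \<in> {1..m}" for i
    using assms that by (intro awalk_line_graph) (auto simp: PiE_iff monotone_on_def)
  show ?thesis
    unfolding kleisli_map_def prod.case
    using f pc_in[OF line_graph_small w] F_ends[OF line_graph_small w]
    by (intro graph_HomI[OF line_graph_small F_small[OF line_graph_small]]) (auto simp del: upt_Suc)
qed

text \<open>The monotone map is read off from the vertices. Conversely, a graph map sends each edge
  to a walk in a line, which cannot descend, so its vertex function is monotone; agreement on
  vertices then forces agreement on edges.\<close>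

lemma kleisli_map_bij: "bij_betw kleisli_map (Hom Delta m n) (Hom \<G> (line_graph m) (F (line_graph n)))"
proof (rule bij_betw_imageI)
  show "inj_on kleisli_map (Hom Delta m n)"
  proof (rule inj_onI)
    fix a b assume "a \<in> Hom Delta m n" "b \<in> Hom Delta m n" and eq: "kleisli_map a = kleisli_map b"
    then obtain f g where fg: "a = (m, f, n)" "b = (m, g, n)" "f \<in> {0..m} \<rightarrow>\<^sub>E {0..n}" "g \<in> {0..m} \<rightarrow>\<^sub>E {0..n}"
      by (auto elim!: Delta_HomE)
    have "f i = g i" if "i \<in> {0..m}" for i
      using vm_kleisli_map[of i m f n] vm_kleisli_map[of i m g n] that eq fg(1,2) by simp
    then have "f = g" using fg(3,4) by (rule PiE_ext[rotated 2])
    with fg show "a = b" by simp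
  qed
  show "kleisli_map ` Hom Delta m n = Hom \<G> (line_graph m) (F (line_graph n))"
  proof (intro equalityI subsetI)
    fix h assume "h \<in> kleisli_map ` Hom Delta m n"
    then show "h \<in> Hom \<G> (line_graph m) (F (line_graph n))"
      using kleisli_map_Hom by (auto simp: Hom_def elim!: Delta_HomE)
  next
    fix h assume h: "h \<in> Hom \<G> (line_graph m) (F (line_graph n))"
    define f where "f = (\<lambda>i\<in>{0..m}. dn (vm h (nv i)))"
    have f: "vm h (nv i) = nv (f i)" "f i \<le> n" if "i \<le> m" for i
    proof -
      have "vm h (nv i) \<in> nv ` {0..n}" using graph_HomD(3)[OF h, of "nv i"] that by simp
      then show "vm h (nv i) = nv (f i)" "f i \<le> n" using that by (auto simp: f_def)
    qed
    \<comment> \<open>Edge i + 1 joins vertex i to vertex i + 1, and its image is a walk between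
      their images.\<close>
    have step: "f i \<le> f (Suc i)" if "Suc i \<le> m" for i
    proof -
      have e: "nv (Suc i) \<in> arcs (line_graph m)" using that by simp
      obtain u p v where p: "em h (nv (Suc i)) = pc (line_graph n) u p" "pre_digraph.awalk (line_graph n) u p v"
        using graph_HomD(4)[OF h e] by (auto elim: pcE)
      have "u = nv (f i)" "v = nv (f (Suc i))"
        using F_ends[OF line_graph_small p(2)] graph_HomD(5,6)[OF h e] p(1) f that by auto
      then show ?thesis using awalk_line_graphD[of n "f i" p v] p(2) by auto
    qed
    \<comment> \<open>The bound for consecutive vertices is iterated from i up to j.\<close>
    have mono: "j \<le> m \<Longrightarrow> f i \<le> f j" if "i \<le> j" for i j
      using that
    proof (induction rule: dec_induct)
      case (step k)
      then show ?case using \<open>\<And>i. Suc i \<le> m \<Longrightarrow> f i \<le> f (Suc i)\<close>[of k] by linarith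
    qed simp
    have "f \<in> {0..m} \<rightarrow>\<^sub>E {0..n}"
      using f(2) by (intro PiE_I) (simp_all, simp add: f_def)
    with mono have a: "(m, f, n) \<in> Hom Delta m n"
      by (simp add: Hom_def monotone_on_def)
    have "kleisli_map (m, f, n) = h"
    proof (rule Hom_F_line_graph_eqI[OF kleisli_map_Hom h])
      show "(m, f, n) \<in> Arr Delta" using a by (simp only: Hom_def) simp
      show "vm (kleisli_map (m, f, n)) v = vm h v" if "v \<in> verts (line_graph m)" for v
        using that by (auto simp: vm_kleisli_map f(1))
    qed
    with a show "h \<in> kleisli_map ` Hom Delta m n" by blast
  qed
qed

lemma kleisli_map_Ide: "kleisli_map (Ide Delta n) = frcat_unit \<U> (line_graph n)"
proof (rule Hom_F_line_graph_eqI)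
  show "kleisli_map (Ide Delta n) \<in> Hom \<G> (line_graph n) (F (line_graph n))"
    using category.Ide_arr(1)[OF category_Delta, of n] by (simp add: kleisli_map_Hom)
  show "frcat_unit \<U> (line_graph n) \<in> Hom \<G> (line_graph n) (F (line_graph n))"
    using nat_trans_Hom[OF nat_trans_unit, of "line_graph n"] line_graph_small by simp
  show "vm (kleisli_map (Ide Delta n)) v = vm (frcat_unit \<U> (line_graph n)) v" if "v \<in> verts (line_graph n)" for v
    using that by (auto simp: vm_kleisli_map frcat_unit_def line_graph_small)
qed

text \<open>Only vertices have to be compared, by \<open>Hom_F_line_graph_eqI\<close>. There
  \<open>frcat_mult\<close> is the identity and \<open>frcat\<close> keeps the vertex function, so
  what remains is composition of monotone maps, and no concatenated path is computed.\<close>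

lemma kleisli_map_Cmp:
  assumes "a \<in> Hom Delta l m" "b \<in> Hom Delta m n"
  shows "kleisli_map (b \<cdot>\<^bsub>Delta\<^esub> a) = frcat_mult \<U> (line_graph n) \<cdot>\<^bsub>\<G>\<^esub> (amap (frcat \<U>) (kleisli_map b) \<cdot>\<^bsub>\<G>\<^esub> kleisli_map a)"
proof -
  note ba = category.Cmp_Hom[OF category_Delta assms]
  obtain f g where fg: "a = (l, f, m)" "b = (m, g, n)" and f: "f \<in> {0..l} \<rightarrow>\<^sub>E {0..m}"
    using assms by (auto elim!: Delta_HomE)
  have hom: "kleisli_map c \<in> Hom \<G> (line_graph j) (F (line_graph k))" if "c \<in> Hom Delta j k" for c j k
    using bij_betwE[OF kleisli_map_bij] that by blast
  note ka = hom[OF assms(1)] and kb = hom[OF assms(2)]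
  note tb = graph_cat.Cmp_Hom[OF ka frcat_Hom[OF kb]]
  show ?thesis
  proof (rule Hom_F_line_graph_eqI[OF hom[OF ba] graph_cat.Cmp_Hom[OF tb mult_Hom[OF line_graph_small]]])
    fix v assume v: "v \<in> verts (line_graph l)"
    then obtain i where i: "v = nv i" "i \<le> l" by auto
    have fi: "f i \<le> m" using f i(2) by (auto simp: PiE_iff)
    have gi: "nv (g (f i)) \<in> verts (line_graph n)"
      using graph_HomD(3)[OF kb, of "nv (f i)"] fi vm_kleisli_map[OF fi, of g n] fg(2) by simp
    show "vm (kleisli_map (b \<cdot>\<^bsub>Delta\<^esub> a)) v =
        vm (frcat_mult \<U> (line_graph n) \<cdot>\<^bsub>\<G>\<^esub> (amap (frcat \<U>) (kleisli_map b) \<cdot>\<^bsub>\<G>\<^esub> kleisli_map a)) v"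
      using i fi vm_mult[OF line_graph_small gi] graph_Cmp_ap(1)[OF tb v] graph_Cmp_ap(1)[OF ka v]
      by (simp add: fg vm_kleisli_map compose_def vm_frcat[OF kb, unfolded fg])
  qed
qed

section \<open>A copy of the opposite of Delta inside the universe\<close>

abbreviation ca where "ca \<equiv> code \<U> (Arr Delta)"
abbreviation da where "da \<equiv> decode \<U> (Arr Delta)"

definition Delta_op :: "('u, 'u) cat" where
  "Delta_op = transport_cat nv ca (op_cat Delta)"

lemma op_Delta_simps:
  "Obj (op_cat Delta) = UNIV" "Arr (op_cat Delta) = Arr Delta"
  "Dom (op_cat Delta) = Cod Delta" "Cod (op_cat Delta) = Dom Delta" "Ide (op_cat Delta) = Ide Delta"
  "g \<cdot>\<^bsub>op_cat Delta\<^esub> f = f \<cdot>\<^bsub>Delta\<^esub> g"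
  by (simp_all add: op_cat_def)

lemma small_Arr_Delta: "small \<U> (Arr Delta)"
  by (rule small_countable[OF \<U> countable_Arr_Delta])

lemma da_ca [simp]: "a \<in> Arr Delta \<Longrightarrow> da (ca a) = a"
  by (rule decode_code[OF small_Arr_Delta \<U>])

lemma inj_nv: "inj_on nv (Obj (op_cat Delta))" and inj_ca: "inj_on ca (Arr (op_cat Delta))"
  using code_spec[OF small_Arr_Delta \<U>] by (auto simp: inj_on_def op_Delta_simps)

interpretation op_Delta: category "op_cat Delta"
  by (rule category.category_op[OF category_Delta])

lemmas Delta_op_simps = op_Delta.transport_simps[OF inj_nv inj_ca, folded Delta_op_def, unfolded op_Delta_simps]
lemmas category_Delta_op = op_Delta.category_transport[OF inj_nv inj_ca, folded Delta_op_def]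
lemmas iso_Delta_op = op_Delta.iso_cat_transport[OF inj_nv inj_ca, folded Delta_op_def]

lemma Delta_op_mem: "Obj Delta_op \<in> \<U>" "Arr Delta_op \<in> \<U>" "out_arrs Delta_op c \<in> \<U>"
  using realize_in[OF small_nat \<U>] realize_in[OF small_Arr_Delta \<U>]
    small_mem[OF \<U> small_subset[OF \<U> mem_small[OF \<U>], of "Arr Delta_op" "out_arrs Delta_op c"]]
  by (auto simp: Delta_op_simps(1,2) realize_def out_arrs_def)

lemma countable_out: "countable (out_arrs Delta_op c)"
  by (rule countable_subset[of _ "Arr Delta_op"]) (auto simp: out_arrs_def Delta_op_simps(2) countable_Arr_Delta)

text \<open>Countably many arrows leave each object, so the function sets embed into sets of
  sequences.\<close>

lemma small_k_set: "X \<in> \<U> \<Longrightarrow> small \<U> (k_set Delta_op X)"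
  by (intro small_Sigma[OF \<U>] small_PiE[OF \<U>] countable_out mem_small[OF \<U>] Delta_op_mem)

lemma Delta_op_HomE:
  assumes "g \<in> Hom Delta_op (nv n) (nv m)"
  obtains a where "a \<in> Hom Delta m n" "g = ca a"
  using assms by (auto simp: Hom_def Delta_op_simps(2) Delta_op_simps(3,4))

lemma ca_Hom: "a \<in> Hom Delta m n \<Longrightarrow> ca a \<in> Hom Delta_op (nv n) (nv m)"
  by (auto simp: Hom_def Delta_op_simps(2) Delta_op_simps(3,4))

text \<open>The coproduct decomposition of \<open>paths\<close> is indexed by the lengths n, coded
  as objects of \<open>Delta_op\<close>: the representing object is the line with n edges and the
  universal element its full path.\<close>

sublocale kleisli_comonad Delta_op \<U> \<G> "paths \<U>" "frcat \<U>" "frcat_unit \<U>" "frcat_mult \<U>"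
  "\<lambda>c. line_graph (dn c)" "\<lambda>c. line_elem (dn c)" "\<lambda>g. kleisli_map (da g)"
proof (intro kleisli_comonad.intro category_comonad.intro kleisli_comonad_axioms.intro poly.intro)
  show "category Delta_op" by (rule category_Delta_op)
  show "set_universe \<U>" by (rule \<U>)
  show "small \<U> (k_set Delta_op X)" if "X \<in> \<U>" for X by (rule small_k_set[OF that])
  show "is_functor \<G> (set_cat \<U>) (paths \<U>)" by (rule is_functor_paths)
  show "is_functor \<G> \<G> (frcat \<U>)" by (rule is_functor_frcat)
  show "nat_trans \<G> \<G> id_functor (frcat \<U>) (frcat_unit \<U>)" by (rule nat_trans_unit)
  show "nat_trans \<G> \<G> (frcat \<U> \<circ>\<^sub>F frcat \<U>) (frcat \<U>) (frcat_mult \<U>)" by (rule nat_trans_mult)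
  show "line_graph (dn c) \<in> Obj \<G>" for c by (simp add: line_graph_small)
  show "line_elem (dn c) \<in> omap (paths \<U>) (line_graph (dn c))" for c
    by (simp add: line_elem_def line_path_in)
  show "\<exists>c\<in>Obj Delta_op. \<exists>f\<in>Hom \<G> (line_graph (dn c)) X. ap (amap (paths \<U>) f) (line_elem (dn c)) = z"
    if "X \<in> Obj \<G>" "z \<in> omap (paths \<U>) X" for X z
    using path_generic[of X z] that by (auto simp: Delta_op_simps(1))
  show "c = d \<and> f = g"
    if "c \<in> Obj Delta_op" "d \<in> Obj Delta_op" "f \<in> Hom \<G> (line_graph (dn c)) X" "g \<in> Hom \<G> (line_graph (dn d)) X"
      "ap (amap (paths \<U>) f) (line_elem (dn c)) = ap (amap (paths \<U>) g) (line_elem (dn d))" for c d X f g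
    using path_generic_unique[OF that(3-5)] that(1,2) by (auto simp: Delta_op_simps(1))
  show "bij_betw (\<lambda>g. kleisli_map (da g)) (Hom Delta_op c d) (Hom \<G> (line_graph (dn d)) (omap (frcat \<U>) (line_graph (dn c))))"
    if "c \<in> Obj Delta_op" "d \<in> Obj Delta_op" for c d
  proof -
    obtain n m where cd: "c = nv n" "d = nv m" using \<open>c \<in> _\<close> \<open>d \<in> _\<close> by (auto simp: Delta_op_simps(1))
    \<comment> \<open>An arrow from n to m in the opposite category is a monotone map from m to n,
      which matches the Kleisli maps from line m to line n demanded by the locale.\<close>
    have "bij_betw da (Hom Delta_op (nv n) (nv m)) (Hom Delta m n)"
      by (rule bij_betw_byWitness[where f' = ca])
        (auto elim!: Delta_op_HomE simp: ca_Hom Hom_def[of Delta])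
    from bij_betw_trans[OF this kleisli_map_bij] show ?thesis by (simp add: cd comp_def)
  qed
  show "kleisli_map (da (Ide Delta_op c)) = frcat_unit \<U> (line_graph (dn c))" if c: "c \<in> Obj Delta_op" for c
  proof -
    obtain n where c: "c = nv n" using c by (auto simp: Delta_op_simps(1))
    have "Ide Delta n \<in> Arr Delta" by (rule category.Ide_arr(1)[OF category_Delta]) simp
    then show ?thesis
      using Delta_op_simps(5)[of n] kleisli_map_Ide[of n] by (simp add: c del: Delta_simps)
  qed
  show "kleisli_map (da (l \<cdot>\<^bsub>Delta_op\<^esub> k)) = frcat_mult \<U> (line_graph (dn b)) \<cdot>\<^bsub>\<G>\<^esub> (amap (frcat \<U>) (kleisli_map (da k)) \<cdot>\<^bsub>\<G>\<^esub> kleisli_map (da l))"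
    if k: "k \<in> Hom Delta_op b c" and l: "l \<in> Hom Delta_op c d" for k l b c d
  proof -
    have "b \<in> Obj Delta_op" "c \<in> Obj Delta_op" "d \<in> Obj Delta_op"
      using k l category.Dom_Obj[OF category_Delta_op] category.Cod_Obj[OF category_Delta_op]
      by (auto simp: Hom_def)
    then obtain n m j where bcd: "b = nv n" "c = nv m" "d = nv j" by (auto simp: Delta_op_simps(1))
    obtain a where a: "a \<in> Hom Delta m n" "k = ca a" by (rule Delta_op_HomE[OF k[unfolded bcd]])
    obtain e where e: "e \<in> Hom Delta j m" "l = ca e" by (rule Delta_op_HomE[OF l[unfolded bcd]])
    \<comment> \<open>In the opposite category \<open>l\<close> after \<open>k\<close> is coded by
      \<open>a\<close> after \<open>e\<close>, so \<open>kleisli_map_Cmp\<close> produces the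
      factors in the order of \<open>H_Cmp\<close>.\<close>
    have "a \<in> Arr Delta" "e \<in> Arr Delta" "a \<cdot>\<^bsub>Delta\<^esub> e \<in> Arr Delta"
      using a(1) e(1) category.Cmp_Hom[OF category_Delta e(1) a(1)] by (auto simp: Hom_def)
    then show ?thesis
      using kleisli_map_Cmp[OF e(1) a(1)] Delta_op_simps(6)[of a e] by (simp add: a(2) e(2) bcd)
  qed
qed

end

theorem proposition5p10:
  fixes \<U> :: "'u set set"
  assumes "set_universe \<U>"
  shows "(\<exists>L \<alpha>. is_lan (graph_cat \<U>) (set_cat \<U>) (set_cat \<U>)
            (paths \<U>) (paths \<U> \<circ>\<^sub>F frcat \<U>) L \<alpha>) \<and>
    (\<forall>L \<alpha>. is_lan (graph_cat \<U>) (set_cat \<U>) (set_cat \<U>)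
            (paths \<U>) (paths \<U> \<circ>\<^sub>F frcat \<U>) L \<alpha> \<longrightarrow>
       polynomial_comonad \<U>
         (lan_comonad (graph_cat \<U>) (set_cat \<U>) (paths \<U>)
            (frcat \<U>) (frcat_unit \<U>) (frcat_mult \<U>) L \<alpha>) \<and>
       (\<exists>C. corresponding_category \<U>
              (lan_comonad (graph_cat \<U>) (set_cat \<U>) (paths \<U>)
                 (frcat \<U>) (frcat_unit \<U>) (frcat_mult \<U>) L \<alpha>) C \<and>
            iso_cat C (op_cat Delta)))"
proof -
  interpret universe \<U> by unfold_locales (rule assms)
  have "polynomial_comonad \<U> M \<and> corresponding_category \<U> M Delta_op"
    if lan: "is_lan \<G> (set_cat \<U>) (set_cat \<U>) (paths \<U>) (paths \<U> \<circ>\<^sub>F frcat \<U>) L \<alpha>"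
      and M: "M = lan_comonad \<G> (set_cat \<U>) (paths \<U>) (frcat \<U>) (frcat_unit \<U>) (frcat_mult \<U>) L \<alpha>"
    for L \<alpha> M
  proof -
    have iso: "comonad_iso (set_cat \<U>) M (k_comonad \<U> Delta_op)" and cfun: "cfun M = L"
      using lan_comonad_k(1)[OF lan] M by (simp_all add: lan_comonad_def)
    \<comment> \<open>The index set and the exponents must be members of the universe, which holds
      for the copy \<open>Delta_op\<close>; the isomorphism is the comparison of \<open>L\<close>
      with the explicit extension.\<close>
    have "polynomial \<U> L"
      unfolding polynomial_def using lan_comonad_k(2)[OF lan] Delta_op_mem small_k_set
      by (intro exI[of _ "Obj Delta_op"] exI[of _ "out_arrs Delta_op"]) auto
    with iso cfun have "polynomial_comonad \<U> M"
      by (simp add: polynomial_comonad_def comonad_iso_def)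
    moreover have "corresponding_category \<U> M Delta_op"
      using iso category_Delta_op Delta_op_mem small_k_set by (simp add: corresponding_category_def)
    ultimately show ?thesis ..
  qed
  then show ?thesis
    \<comment> \<open>\<open>is_lan_K\<close> is the existence half, and the witness for the
      corresponding category is \<open>Delta_op\<close> whatever extension is given.\<close>
    using is_lan_K iso_Delta_op by blast
qed

end
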